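(* Let $p,q\ge 2$ be integers, let $m\ge 1$ and $n\ge 1$ be integers, and let $\alpha\in\mathbb C$. Let $\mathcal G(A)$ be the Kac–Moody algebra with Cartan matrix $A=\begin{pmatrix}2&-p\\-q&2\end{pmatrix}$, $N_-\subset\mathcal G(A)$ the subalgebra generated by $f_1,f_2$, and $\pi':\mathcal U(N_-)\to\mathcal U(sl_2)$ the projection defined in the context. With the words $V_k,\tilde V_k\in\mathcal U(N_-)$ (depending on $m,\alpha$), the numbers $\Gamma^k_1,\Gamma^k_2$ and the products $\mathcal J^{r,s}_w,\tilde{\mathcal J}^{r,s}_w$ defined in the context, the singular vectors of Verma modules over $\mathcal G(A)$ corresponding to real roots project as follows. 1. For the root $(a_{2n-1},\sigma a_{2n-2})$ (word $V_{2n-1}$): $$\pi'(V_{2n-1})=\Big(\prod_{w=1}^{2n-2}\mathcal J_w^{2n-1,\,2n-3}\Big)\, f_1^{(\Gamma_1^{2n-1}-\Gamma_1^{2n-2})m}.$$ 2. For the root $(a_{2n-1},\sigma a_{2n})$ (word $V_{2n}$): $$\pi'(V_{2n})=\Big(\prod_{w=1}^{2n-1}\mathcal J_w^{2n,\,2n-2}\Big)\, f_2^{(\Gamma_1^{2n}-\Gamma_1^{2n-1})m}.$$ 3. For the root $(\sigma^{-1}a_{2n-2},a_{2n-1})$ (word $\tilde V_{2n-1}$): $$\pi'(\tilde V_{2n-1})=\Big(\prod_{w=1}^{2n-2}\tilde{\mathcal J}_w^{2n-2,\,2n-2}\Big)\, f_2^{(\Gamma_2^{2n}-\Gamma_2^{2n-1})m}.$$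 4. For the root $(\sigma^{-1}a_{2n},a_{2n-1})$ (word $\tilde V_{2n}$): $$\pi'(\tilde V_{2n})=\Big(\prod_{w=1}^{2n-1}\tilde{\mathcal J}_w^{2n-1,\,2n-1}\Big)\, f_1^{(\Gamma_2^{2n+1}-\Gamma_2^{2n})m}.$$
   Context: **Algebra.** $\mathcal G(A)$ is the complex Lie algebra with generators $e_i,h_i,f_i$ ($i=1,2$) and relations $[h_i,h_j]=0$, $[h_i,e_j]=a_{ij}e_j$, $[h_i,f_j]=-a_{ij}f_j$, $[e_i,f_j]=\delta_{ij}h_i$, $(\mathrm{ad}\,e_i)^{1-a_{ij}}e_j=0=(\mathrm{ad}\,f_i)^{1-a_{ij}}f_j$ ($i\neq j$), where $A=(a_{ij})$, $a_{11}=a_{22}=2$, $a_{12}=-p$, $a_{21}=-q$. Thus $N_-$ is generated by $f_1,f_2$ with relations $(\mathrm{ad}f_1)^{p+1}f_2=0=(\mathrm{ad}f_2)^{q+1}f_1$. **Numbers.** $\sigma=\sqrt{q/p}$, $a_0=0$, $a_1=1$, $a_k=\sqrt{pq}\,a_{k-1}-a_{k-2}$; roots are written in coordinates with respect to the simple roots $\alpha_1,\alpha_2$. $\Gamma^0_1=\Gamma^0_2=0$ and $$\Gamma^{2l}_1=q\sum_{i=0}^{l-1}(-1)^i\binom{2l-i-1}{2l-2i-1}(pq)^{l-i-1},\quad \Gamma^{2l}_2=\sum_{i=0}^{l-1}(-1)^i\binom{2(l-1)-i}{2(l-1)-2i}(pq)^{l-i-1}\quad(l\ge1),$$ $$\Gamma^{2l+1}_1=\sum_{i=0}^{l}(-1)^i\binom{2l-i}{2l-2i}(pq)^{l-i},\quad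 \Gamma^{2l+1}_2=p\sum_{i=0}^{l-1}(-1)^i\binom{2l-i-1}{2l-2i-1}(pq)^{l-i-1}\quad(l\ge0).$$ **Complex powers.** For $W\in\mathcal U(N_-)$, $f\in\{f_1,f_2\}$ and $a,b\in\mathbb C$ with $a+b\in\mathbb Z$, the expression $f^aWf^b$ denotes $\sum_{i\ge0}\binom{a}{i}(\mathrm{ad} f)^i(W)\,f^{a+b-i}$ (a finite sum) in the Ore localization of $\mathcal U(N_-)$ at the powers of $f$. **Singular vectors.** Put $V_1=f_1^m$, $\tilde V_1=f_2^m$ and, for $l\ge 1$, $$V_{2l}=f_2^{\Gamma_1^{2l-1}\alpha-\Gamma_1^{2l-2}m}\,V_{2l-1}\,f_2^{-\Gamma_1^{2l-1}\alpha+\Gamma_1^{2l}m},\qquad V_{2l+1}=f_1^{\Gamma_2^{2l+1}\alpha-\Gamma_2^{2l}m}\,V_{2l}\,f_1^{-\Gamma_2^{2l+1}\alpha+\Gamma_2^{2l+2}m},$$ $$\tilde V_{2l}=f_1^{\Gamma_2^{2l}\alpha-\Gamma_2^{2l-1}m}\,\tilde V_{2l-1}\,f_1^{-\Gamma_2^{2l}\alpha+\Gamma_2^{2l+1}m},\qquad \tilde V_{2l+1}=f_2^{\Gamma_1^{2l}\alpha-\Gamma_1^{2l-1}m}\,\tilde V_{2l}\,f_2^{-\Gamma_1^{2l}\alpha+\Gamma_1^{2l+1}m}.$$ All exponent pairs have integer sums, and (Feigin–Fuchs–Malikov) all these expressions lie in $\mathcal U(N_-)$. Applied to the vacuum vector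 of suitable Verma modules they give the singular vectors of degree $m\gamma$, $\gamma$ being the listed real root. **Projection to $\mathcal U(sl_2)$.** Here $sl_2$ is presented as the Lie algebra with basis $f_1,f_2,h$ and brackets $[f_1,f_2]=h$, $[h,f_1]=f_1$, $[h,f_2]=-f_2$. $\pi':\mathcal U(N_-)\to\mathcal U(sl_2)$ is the algebra homomorphism with $f_i\mapsto f_i$, i.e. the quotient by the two-sided ideal generated by $[h,f_1]-f_1$ and $[h,f_2]+f_2$ with $h=[f_1,f_2]$ (defined since $p,q>1$). For $u\in\mathbb C$, $J_u=f_2f_1+uh-\frac{u(u-1)}2$; the $J_u$ commute with each other. **Products.** Sums over empty ranges are $0$, empty products are $1$. For integers $r,s\ge 0$ (or $s=-1$, when all sums up to $s$ are empty), $\mathcal J^{r,s}_0=\tilde{\mathcal J}^{r,s}_0=1$, $$\mathcal J_1^{r,s}=\prod_{k=1}^{(\Gamma_2^2-\Gamma_1^0)m}J_{\big(\sum_{i=2}^r(-1)^{i-1}\Gamma_2^i\big)\alpha+\big(\sum_{i=1}^s(-1)^i\Gamma_1^i\big)m+k},$$ $$\tilde{\mathcal J}_1^{r,s}=\prod_{k=1}^{(\Gamma_2^2-\Gamma_2^1)m}J_{\big(\sum_{i=1}^r(-1)^{i-1}\Gamma_1^i\big)\alpha+\big(\sum_{i=2}^s(-1)^i\Gamma_2^i\big)m-(k-1)},$$ and for $j\ge1$ $$\mathcal J_{2j}^{r,s}=\prod_{k=1}^{(\Gamma_1^{2j}-\Gamma_2^{2j})m}J_{\big(\sum_{i=2j+1}^r(-1)^{i-1}\Gamma_2^i\big)\alpha+\big(\sum_{i=2j-1}^s(-1)^i\Gamma_1^i\big)m-(k-1)},$$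 $$\mathcal J_{2j+1}^{r,s}=\prod_{k=1}^{(\Gamma_2^{2j+2}-\Gamma_1^{2j})m}J_{\big(\sum_{i=2j+2}^r(-1)^{i-1}\Gamma_2^i\big)\alpha+\big(\sum_{i=2j}^s(-1)^i\Gamma_1^i\big)m+k},$$ $$\tilde{\mathcal J}_{2j}^{r,s}=\prod_{k=1}^{(\Gamma_2^{2j+1}-\Gamma_2^{2j})m}J_{\big(\sum_{i=2j}^r(-1)^{i-1}\Gamma_1^i\big)\alpha+\big(\sum_{i=2j}^s(-1)^i\Gamma_2^i\big)m+k},$$ $$\tilde{\mathcal J}_{2j+1}^{r,s}=\prod_{k=1}^{(\Gamma_2^{2j+2}-\Gamma_2^{2j+1})m}J_{\big(\sum_{i=2j+1}^r(-1)^{i-1}\Gamma_1^i\big)\alpha+\big(\sum_{i=2j+1}^s(-1)^i\Gamma_2^i\big)m-(k-1)}.$$ *)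

theory Defs
  imports Complex_Main "HOL-Library.Poly_Mapping" "HOL-Algebra.QuotRing" "HOL-Algebra.Module"
begin

section \<open>Complex Lie algebras given by generators and relations\<close>

record 'a lie_alg =
  lcarrier :: "'a set"
  lzero :: 'a
  ladd :: "'a \<Rightarrow> 'a \<Rightarrow> 'a"
  lscale :: "complex \<Rightarrow> 'a \<Rightarrow> 'a"
  lbracket :: "'a \<Rightarrow> 'a \<Rightarrow> 'a"

datatype 'x lie_term =
    Gen 'x
  | Zero
  | Add "'x lie_term" "'x lie_term"
  | Scale complex "'x lie_term"
  | Br "'x lie_term" "'x lie_term"

text \<open>The least congruence on Lie expressions that enforces the axioms of a complex Lie algebra and
  makes every relator in \<open>R\<close> vanish.\<close>

inductive lie_eq :: "'x lie_term set \<Rightarrow> 'x lie_term \<Rightarrow> 'x lie_term \<Rightarrow> bool" for R where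
  refl: "lie_eq R x x"
| sym: "lie_eq R x y \<Longrightarrow> lie_eq R y x"
| trans: "lie_eq R x y \<Longrightarrow> lie_eq R y z \<Longrightarrow> lie_eq R x z"
| add_cong: "lie_eq R x x' \<Longrightarrow> lie_eq R y y' \<Longrightarrow> lie_eq R (Add x y) (Add x' y')"
| scale_cong: "lie_eq R x x' \<Longrightarrow> lie_eq R (Scale c x) (Scale c x')"
| br_cong: "lie_eq R x x' \<Longrightarrow> lie_eq R y y' \<Longrightarrow> lie_eq R (Br x y) (Br x' y')"
| add_assoc: "lie_eq R (Add (Add x y) z) (Add x (Add y z))"
| add_comm: "lie_eq R (Add x y) (Add y x)"
| add_zero: "lie_eq R (Add Zero x) x"
| add_neg: "lie_eq R (Add x (Scale (-1) x)) Zero"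
| scale_add: "lie_eq R (Scale c (Add x y)) (Add (Scale c x) (Scale c y))"
| add_scale: "lie_eq R (Scale (c + d) x) (Add (Scale c x) (Scale d x))"
| scale_scale: "lie_eq R (Scale c (Scale d x)) (Scale (c * d) x)"
| scale_one: "lie_eq R (Scale 1 x) x"
| br_add_left: "lie_eq R (Br (Add x y) z) (Add (Br x z) (Br y z))"
| br_add_right: "lie_eq R (Br x (Add y z)) (Add (Br x y) (Br x z))"
| br_scale_left: "lie_eq R (Br (Scale c x) y) (Scale c (Br x y))"
| br_scale_right: "lie_eq R (Br x (Scale c y)) (Scale c (Br x y))"
| br_self: "lie_eq R (Br x x) Zero"
| jacobi: "lie_eq R (Add (Br x (Br y z)) (Add (Br y (Br z x)) (Br z (Br x y)))) Zero"
| relator: "x \<in> R \<Longrightarrow> lie_eq R x Zero"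

definition lie_class :: "'x lie_term set \<Rightarrow> 'x lie_term \<Rightarrow> 'x lie_term set" where
  "lie_class R x = {y. lie_eq R x y}"

definition presented_lie :: "'x lie_term set \<Rightarrow> 'x lie_term set lie_alg" where
  "presented_lie R =
    \<lparr>lcarrier = range (lie_class R),
     lzero = lie_class R Zero,
     ladd = (\<lambda>X Y. \<Union>x\<in>X. \<Union>y\<in>Y. lie_class R (Add x y)),
     lscale = (\<lambda>c X. \<Union>x\<in>X. lie_class R (Scale c x)),
     lbracket = (\<lambda>X Y. \<Union>x\<in>X. \<Union>y\<in>Y. lie_class R (Br x y))\<rparr>"

inductive_set lie_gen :: "('a, 'b) lie_alg_scheme \<Rightarrow> 'a set \<Rightarrow> 'a set" for L and S where
  gen: "x \<in> S \<Longrightarrow> x \<in> lie_gen L S"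
| zero: "lzero L \<in> lie_gen L S"
| add: "x \<in> lie_gen L S \<Longrightarrow> y \<in> lie_gen L S \<Longrightarrow> ladd L x y \<in> lie_gen L S"
| scale: "x \<in> lie_gen L S \<Longrightarrow> lscale L c x \<in> lie_gen L S"
| bracket: "x \<in> lie_gen L S \<Longrightarrow> y \<in> lie_gen L S \<Longrightarrow> lbracket L x y \<in> lie_gen L S"

definition lie_subalg :: "'a lie_alg \<Rightarrow> 'a set \<Rightarrow> 'a lie_alg" where
  "lie_subalg L S = L\<lparr>lcarrier := lie_gen L S\<rparr>"


section \<open>The Kac--Moody algebra and its subalgebra $N_-$\<close>

datatype node = N1 | N2

datatype km_gen = E node | H node | F node

fun cartan :: "nat \<Rightarrow> nat \<Rightarrow> node \<Rightarrow> node \<Rightarrow> int" where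
  "cartan p q N1 N1 = 2"
| "cartan p q N1 N2 = - int p"
| "cartan p q N2 N1 = - int q"
| "cartan p q N2 N2 = 2"

abbreviation Sub :: "'x lie_term \<Rightarrow> 'x lie_term \<Rightarrow> 'x lie_term" where
  "Sub x y \<equiv> Add x (Scale (-1) y)"

definition km_relators :: "nat \<Rightarrow> nat \<Rightarrow> km_gen lie_term set" where
  "km_relators p q =
     {Br (Gen (H i)) (Gen (H j)) | i j. True}
   \<union> {Sub (Br (Gen (H i)) (Gen (E j))) (Scale (of_int (cartan p q i j)) (Gen (E j))) | i j. True}
   \<union> {Sub (Br (Gen (H i)) (Gen (F j))) (Scale (- of_int (cartan p q i j)) (Gen (F j))) | i j. True}
   \<union> {Sub (Br (Gen (E i)) (Gen (F j))) (if i = j then Gen (H i) else Zero) | i j. True}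
   \<union> {(Br (Gen (E i)) ^^ nat (1 - cartan p q i j)) (Gen (E j)) | i j. i \<noteq> j}
   \<union> {(Br (Gen (F i)) ^^ nat (1 - cartan p q i j)) (Gen (F j)) | i j. i \<noteq> j}"

definition km_alg :: "nat \<Rightarrow> nat \<Rightarrow> km_gen lie_term set lie_alg" where
  "km_alg p q = presented_lie (km_relators p q)"

definition km_f :: "nat \<Rightarrow> nat \<Rightarrow> node \<Rightarrow> km_gen lie_term set" where
  "km_f p q i = lie_class (km_relators p q) (Gen (F i))"

definition n_minus :: "nat \<Rightarrow> nat \<Rightarrow> km_gen lie_term set lie_alg" where
  "n_minus p q = lie_subalg (km_alg p q) {km_f p q N1, km_f p q N2}"


section \<open>Universal enveloping algebras\<close>

text \<open>Words under concatenation, so that \<open>'a list \<Rightarrow>\<^sub>0 complex\<close> is the free associative algebra.\<close>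

instantiation list :: (type) monoid_add
begin

definition zero_list :: "'a list" where "zero_list = []"
definition plus_list :: "'a list \<Rightarrow> 'a list \<Rightarrow> 'a list" where "plus_list xs ys = xs @ ys"

instance by standard (simp_all add: zero_list_def plus_list_def)

end

text \<open>Associative algebras over the complex numbers are records of type \<open>module\<close>: a ring together with
  a scalar multiplication.\<close>

definition free_alg :: "'a set \<Rightarrow> (complex, 'a list \<Rightarrow>\<^sub>0 complex) module" where
  "free_alg X =
    \<lparr>carrier = {P. \<forall>w \<in> Poly_Mapping.keys P. set w \<subseteq> X},
     mult = (*), one = 1, zero = 0, add = (+),
     smult = (\<lambda>c P. Poly_Mapping.single 0 c * P)\<rparr>"

definition quot_alg :: "(complex, 'a) module \<Rightarrow> 'a set \<Rightarrow> (complex, 'a set) module" where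
  "quot_alg A I =
    \<lparr>carrier = carrier (A Quot I), mult = mult (A Quot I), one = one (A Quot I),
     zero = zero (A Quot I), add = add (A Quot I),
     smult = (\<lambda>c X. \<Union>x\<in>X. I +>\<^bsub>A\<^esub> (c \<odot>\<^bsub>A\<^esub> x))\<rparr>"

definition letter :: "'a \<Rightarrow> 'a list \<Rightarrow>\<^sub>0 complex" where
  "letter x = Poly_Mapping.single [x] 1"

text \<open>The free algebra on the underlying set of \<open>L\<close> modulo the linear relators is the tensor algebra.\<close>

definition env_ideal :: "'a lie_alg \<Rightarrow> ('a list \<Rightarrow>\<^sub>0 complex) set" where
  "env_ideal L = Idl\<^bsub>free_alg (lcarrier L)\<^esub>
    ( {letter (ladd L x y) - letter x - letter y | x y. x \<in> lcarrier L \<and> y \<in> lcarrier L}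
    \<union> {letter (lscale L c x) - Poly_Mapping.single 0 c * letter x | c x. x \<in> lcarrier L}
    \<union> {letter x * letter y - letter y * letter x - letter (lbracket L x y) | x y.
         x \<in> lcarrier L \<and> y \<in> lcarrier L})"

definition env_alg :: "'a lie_alg \<Rightarrow> (complex, ('a list \<Rightarrow>\<^sub>0 complex) set) module" where
  "env_alg L = quot_alg (free_alg (lcarrier L)) (env_ideal L)"

definition env_in :: "'a lie_alg \<Rightarrow> 'a \<Rightarrow> ('a list \<Rightarrow>\<^sub>0 complex) set" where
  "env_in L x = env_ideal L +>\<^bsub>free_alg (lcarrier L)\<^esub> letter x"

type_synonym u_minus = "(km_gen lie_term set list \<Rightarrow>\<^sub>0 complex) set"

definition U_N :: "nat \<Rightarrow> nat \<Rightarrow> (complex, u_minus) module" where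
  "U_N p q = env_alg (n_minus p q)"

definition f_N :: "nat \<Rightarrow> nat \<Rightarrow> node \<Rightarrow> u_minus" where
  "f_N p q i = env_in (n_minus p q) (km_f p q i)"


section \<open>$U(sl_2)$ and the projection\<close>

text \<open>The triple \<open>(a, b, c)\<close> stands for \<open>a f\<^sub>1 + b f\<^sub>2 + c h\<close>.\<close>

type_synonym sl2 = "complex \<times> complex \<times> complex"

fun sl2_add :: "sl2 \<Rightarrow> sl2 \<Rightarrow> sl2" where
  "sl2_add (a, b, c) (a', b', c') = (a + a', b + b', c + c')"

fun sl2_scale :: "complex \<Rightarrow> sl2 \<Rightarrow> sl2" where
  "sl2_scale t (a, b, c) = (t * a, t * b, t * c)"

text \<open>The bilinear extension of $[f_1,f_2]=h$, $[h,f_1]=f_1$, $[h,f_2]=-f_2$.\<close>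

fun sl2_bracket :: "sl2 \<Rightarrow> sl2 \<Rightarrow> sl2" where
  "sl2_bracket (a, b, c) (a', b', c') = (c * a' - a * c', b * c' - c * b', a * b' - b * a')"

definition sl2_alg :: "sl2 lie_alg" where
  "sl2_alg = \<lparr>lcarrier = UNIV, lzero = (0, 0, 0), ladd = sl2_add, lscale = sl2_scale,
     lbracket = sl2_bracket\<rparr>"

type_synonym u_sl2 = "(sl2 list \<Rightarrow>\<^sub>0 complex) set"

definition U_sl2 :: "(complex, u_sl2) module" where
  "U_sl2 = env_alg sl2_alg"

definition f_S :: "node \<Rightarrow> u_sl2" where
  "f_S i = env_in sl2_alg (case i of N1 \<Rightarrow> (1, 0, 0) | N2 \<Rightarrow> (0, 1, 0))"

definition h_S :: u_sl2 where
  "h_S = env_in sl2_alg (0, 0, 1)"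

definition alg_hom :: "(complex, 'a) module \<Rightarrow> (complex, 'b) module \<Rightarrow> ('a \<Rightarrow> 'b) set" where
  "alg_hom A B = {\<phi> \<in> ring_hom A B. \<forall>c. \<forall>x \<in> carrier A. \<phi> (c \<odot>\<^bsub>A\<^esub> x) = c \<odot>\<^bsub>B\<^esub> \<phi> x}"

text \<open>On \<open>carrier (U_N p q)\<close> this determines \<open>\<phi>\<close>, since $f_1,f_2$ generate $U(N_-)$.\<close>

definition is_projection :: "nat \<Rightarrow> nat \<Rightarrow> (u_minus \<Rightarrow> u_sl2) \<Rightarrow> bool" where
  "is_projection p q \<phi> \<longleftrightarrow> \<phi> \<in> alg_hom (U_N p q) U_sl2 \<and> (\<forall>i. \<phi> (f_N p q i) = f_S i)"


section \<open>Ore localization at the powers of an element, and complex powers\<close>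

text \<open>\<open>(x, n)\<close> represents the right fraction $x f^{-n}$. Powers of \<open>f\<close> commute with each other, so they
  suffice as common denominators.\<close>

definition ore_rel :: "('a, 'b) ring_scheme \<Rightarrow> 'a \<Rightarrow> (('a \<times> nat) \<times> ('a \<times> nat)) set" where
  "ore_rel A f = {((x, n), (y, k)). x \<in> carrier A \<and> y \<in> carrier A \<and>
     (\<exists>N. x \<otimes>\<^bsub>A\<^esub> f [^]\<^bsub>A\<^esub> (k + N) = y \<otimes>\<^bsub>A\<^esub> f [^]\<^bsub>A\<^esub> (n + N))}"

definition ore_class :: "('a, 'b) ring_scheme \<Rightarrow> 'a \<Rightarrow> 'a \<times> nat \<Rightarrow> ('a \<times> nat) set" where
  "ore_class A f z = ore_rel A f `` {z}"

text \<open>In the product, the Ore condition $f^n y' = y f^j$ rewrites $f^{-n} y$ as $y' f^{-j}$.\<close>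

definition ore_loc :: "('a, 'b) ring_scheme \<Rightarrow> 'a \<Rightarrow> (('a \<times> nat) set) ring" where
  "ore_loc A f =
    \<lparr>carrier = (carrier A \<times> UNIV) // ore_rel A f,
     mult = (\<lambda>X Y. \<Union>{ore_class A f (x \<otimes>\<^bsub>A\<^esub> y', j + k) | x n y k y' j.
        (x, n) \<in> X \<and> (y, k) \<in> Y \<and> y' \<in> carrier A \<and>
        f [^]\<^bsub>A\<^esub> n \<otimes>\<^bsub>A\<^esub> y' = y \<otimes>\<^bsub>A\<^esub> f [^]\<^bsub>A\<^esub> j}),
     one = ore_class A f (\<one>\<^bsub>A\<^esub>, 0),
     zero = ore_class A f (\<zero>\<^bsub>A\<^esub>, 0),
     add = (\<lambda>X Y. \<Union>{ore_class A f (x \<otimes>\<^bsub>A\<^esub> f [^]\<^bsub>A\<^esub> k \<oplus>\<^bsub>A\<^esub> y \<otimes>\<^bsub>A\<^esub> f [^]\<^bsub>A\<^esub> n, n + k) | x n y k.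
        (x, n) \<in> X \<and> (y, k) \<in> Y})\<rparr>"

text \<open>$x f^s$ for an integer $s$ of either sign.\<close>

definition ore_frac :: "('a, 'b) ring_scheme \<Rightarrow> 'a \<Rightarrow> 'a \<Rightarrow> int \<Rightarrow> ('a \<times> nat) set" where
  "ore_frac A f x s = ore_class A f (x \<otimes>\<^bsub>A\<^esub> f [^]\<^bsub>A\<^esub> nat s, nat (- s))"

definition ore_in :: "('a, 'b) ring_scheme \<Rightarrow> 'a \<Rightarrow> 'a \<Rightarrow> ('a \<times> nat) set" where
  "ore_in A f x = ore_class A f (x, 0)"

definition ad :: "('a, 'b) ring_scheme \<Rightarrow> 'a \<Rightarrow> 'a \<Rightarrow> 'a" where
  "ad A x y = x \<otimes>\<^bsub>A\<^esub> y \<ominus>\<^bsub>A\<^esub> y \<otimes>\<^bsub>A\<^esub> x"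

text \<open>$f^a W f^b$ for $a + b$ an integer; \<open>ad f\<close> is locally nilpotent on $U(N_-)$, so the sum over the
  nonvanishing terms is finite.\<close>

definition complex_power :: "(complex, 'a) module \<Rightarrow> 'a \<Rightarrow> complex \<Rightarrow> 'a \<Rightarrow> complex \<Rightarrow> ('a \<times> nat) set" where
  "complex_power A f a W b =
    (\<Oplus>\<^bsub>ore_loc A f\<^esub> i \<in> {i. (ad A f ^^ i) W \<noteq> \<zero>\<^bsub>A\<^esub>}.
       ore_frac A f ((a gchoose i) \<odot>\<^bsub>A\<^esub> (ad A f ^^ i) W) ((THE s. of_int s = a + b) - int i))"

definition is_complex_power :: "(complex, 'a) module \<Rightarrow> 'a \<Rightarrow> complex \<Rightarrow> 'a \<Rightarrow> complex \<Rightarrow> 'a \<Rightarrow> bool" where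
  "is_complex_power A f a W b X \<longleftrightarrow> X \<in> carrier A \<and> ore_in A f X = complex_power A f a W b"


section \<open>The numbers $\Gamma$ and the singular vectors\<close>

definition \<Gamma>\<^sub>1 :: "nat \<Rightarrow> nat \<Rightarrow> nat \<Rightarrow> int" where
  "\<Gamma>\<^sub>1 p q k = (let l = k div 2 in
     if even k
     then int q * (\<Sum>i<l. (-1) ^ i * int ((2*l - i - 1) choose (2*l - 2*i - 1)) * int (p * q) ^ (l - i - 1))
     else (\<Sum>i\<le>l. (-1) ^ i * int ((2*l - i) choose (2*l - 2*i)) * int (p * q) ^ (l - i)))"

definition \<Gamma>\<^sub>2 :: "nat \<Rightarrow> nat \<Rightarrow> nat \<Rightarrow> int" where
  "\<Gamma>\<^sub>2 p q k = (let l = k div 2 in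
     if even k
     then (\<Sum>i<l. (-1) ^ i * int ((2*(l - 1) - i) choose (2*(l - 1) - 2*i)) * int (p * q) ^ (l - i - 1))
     else int p * (\<Sum>i<l. (-1) ^ i * int ((2*l - i - 1) choose (2*l - 2*i - 1)) * int (p * q) ^ (l - i - 1)))"

text \<open>\<open>singular_words p q m \<alpha> V\<close>: the \<open>V k\<close> are the elements $V_k$ of $U(N_-)$; similarly below for
  $\tilde V_k$. The value \<open>V 0\<close> is irrelevant.\<close>

definition singular_words :: "nat \<Rightarrow> nat \<Rightarrow> nat \<Rightarrow> complex \<Rightarrow> (nat \<Rightarrow> u_minus) \<Rightarrow> bool" where
  "singular_words p q m \<alpha> V \<longleftrightarrow>
     V 1 = f_N p q N1 [^]\<^bsub>U_N p q\<^esub> m \<and>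
     (\<forall>l\<ge>1.
       is_complex_power (U_N p q) (f_N p q N2)
         (of_int (\<Gamma>\<^sub>1 p q (2*l - 1)) * \<alpha> - of_int (\<Gamma>\<^sub>1 p q (2*l - 2)) * of_nat m)
         (V (2*l - 1))
         (- of_int (\<Gamma>\<^sub>1 p q (2*l - 1)) * \<alpha> + of_int (\<Gamma>\<^sub>1 p q (2*l)) * of_nat m)
         (V (2*l)) \<and>
       is_complex_power (U_N p q) (f_N p q N1)
         (of_int (\<Gamma>\<^sub>2 p q (2*l + 1)) * \<alpha> - of_int (\<Gamma>\<^sub>2 p q (2*l)) * of_nat m)
         (V (2*l))
         (- of_int (\<Gamma>\<^sub>2 p q (2*l + 1)) * \<alpha> + of_int (\<Gamma>\<^sub>2 p q (2*l + 2)) * of_nat m)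
         (V (2*l + 1)))"

definition singular_words_tilde :: "nat \<Rightarrow> nat \<Rightarrow> nat \<Rightarrow> complex \<Rightarrow> (nat \<Rightarrow> u_minus) \<Rightarrow> bool" where
  "singular_words_tilde p q m \<alpha> V \<longleftrightarrow>
     V 1 = f_N p q N2 [^]\<^bsub>U_N p q\<^esub> m \<and>
     (\<forall>l\<ge>1.
       is_complex_power (U_N p q) (f_N p q N1)
         (of_int (\<Gamma>\<^sub>2 p q (2*l)) * \<alpha> - of_int (\<Gamma>\<^sub>2 p q (2*l - 1)) * of_nat m)
         (V (2*l - 1))
         (- of_int (\<Gamma>\<^sub>2 p q (2*l)) * \<alpha> + of_int (\<Gamma>\<^sub>2 p q (2*l + 1)) * of_nat m)
         (V (2*l)) \<and>
       is_complex_power (U_N p q) (f_N p q N2)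
         (of_int (\<Gamma>\<^sub>1 p q (2*l)) * \<alpha> - of_int (\<Gamma>\<^sub>1 p q (2*l - 1)) * of_nat m)
         (V (2*l))
         (- of_int (\<Gamma>\<^sub>1 p q (2*l)) * \<alpha> + of_int (\<Gamma>\<^sub>1 p q (2*l + 1)) * of_nat m)
         (V (2*l + 1)))"


section \<open>The products of the $J_u$\<close>

definition J :: "complex \<Rightarrow> u_sl2" where
  "J u = f_S N2 \<otimes>\<^bsub>U_sl2\<^esub> f_S N1 \<oplus>\<^bsub>U_sl2\<^esub> u \<odot>\<^bsub>U_sl2\<^esub> h_S \<ominus>\<^bsub>U_sl2\<^esub> (u * (u - 1) / 2) \<odot>\<^bsub>U_sl2\<^esub> \<one>\<^bsub>U_sl2\<^esub>"

text \<open>Product in the order of the list; $U(sl_2)$ is not commutative, so \<open>finprod\<close> is not available.\<close>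

definition list_prod :: "('a, 'b) monoid_scheme \<Rightarrow> 'a list \<Rightarrow> 'a" where
  "list_prod A xs = foldr (mult A) xs \<one>\<^bsub>A\<^esub>"

text \<open>Upper limits are integers because $s = -1$ occurs; lower limits are at least 1, so such sums are
  empty.\<close>

definition sum_pos :: "(nat \<Rightarrow> int) \<Rightarrow> nat \<Rightarrow> int \<Rightarrow> int" where
  "sum_pos g a r = (\<Sum>i\<in>{a..nat r}. (-1) ^ (i - 1) * g i)"

definition sum_neg :: "(nat \<Rightarrow> int) \<Rightarrow> nat \<Rightarrow> int \<Rightarrow> int" where
  "sum_neg g a s = (\<Sum>i\<in>{a..nat s}. (-1) ^ i * g i)"

definition J_prod_up :: "int \<Rightarrow> complex \<Rightarrow> u_sl2" where
  "J_prod_up b u = list_prod U_sl2 (map (\<lambda>k. J (u + of_int k)) [1..b])"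

definition J_prod_down :: "int \<Rightarrow> complex \<Rightarrow> u_sl2" where
  "J_prod_down b u = list_prod U_sl2 (map (\<lambda>k. J (u - (of_int k - 1))) [1..b])"

definition Jcal :: "nat \<Rightarrow> nat \<Rightarrow> nat \<Rightarrow> complex \<Rightarrow> int \<Rightarrow> int \<Rightarrow> nat \<Rightarrow> u_sl2" where
  "Jcal p q m \<alpha> r s w = (let j = w div 2 in
     if w = 0 then \<one>\<^bsub>U_sl2\<^esub>
     else if w = 1 then
       J_prod_up ((\<Gamma>\<^sub>2 p q 2 - \<Gamma>\<^sub>1 p q 0) * int m)
         (of_int (sum_pos (\<Gamma>\<^sub>2 p q) 2 r) * \<alpha> + of_int (sum_neg (\<Gamma>\<^sub>1 p q) 1 s) * of_nat m)
     else if even w then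
       J_prod_down ((\<Gamma>\<^sub>1 p q (2*j) - \<Gamma>\<^sub>2 p q (2*j)) * int m)
         (of_int (sum_pos (\<Gamma>\<^sub>2 p q) (2*j + 1) r) * \<alpha> + of_int (sum_neg (\<Gamma>\<^sub>1 p q) (2*j - 1) s) * of_nat m)
     else
       J_prod_up ((\<Gamma>\<^sub>2 p q (2*j + 2) - \<Gamma>\<^sub>1 p q (2*j)) * int m)
         (of_int (sum_pos (\<Gamma>\<^sub>2 p q) (2*j + 2) r) * \<alpha> + of_int (sum_neg (\<Gamma>\<^sub>1 p q) (2*j) s) * of_nat m))"

definition Jcal_tilde :: "nat \<Rightarrow> nat \<Rightarrow> nat \<Rightarrow> complex \<Rightarrow> int \<Rightarrow> int \<Rightarrow> nat \<Rightarrow> u_sl2" where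
  "Jcal_tilde p q m \<alpha> r s w = (let j = w div 2 in
     if w = 0 then \<one>\<^bsub>U_sl2\<^esub>
     else if w = 1 then
       J_prod_down ((\<Gamma>\<^sub>2 p q 2 - \<Gamma>\<^sub>2 p q 1) * int m)
         (of_int (sum_pos (\<Gamma>\<^sub>1 p q) 1 r) * \<alpha> + of_int (sum_neg (\<Gamma>\<^sub>2 p q) 2 s) * of_nat m)
     else if even w then
       J_prod_up ((\<Gamma>\<^sub>2 p q (2*j + 1) - \<Gamma>\<^sub>2 p q (2*j)) * int m)
         (of_int (sum_pos (\<Gamma>\<^sub>1 p q) (2*j) r) * \<alpha> + of_int (sum_neg (\<Gamma>\<^sub>2 p q) (2*j) s) * of_nat m)
     else
       J_prod_down ((\<Gamma>\<^sub>2 p q (2*j + 2) - \<Gamma>\<^sub>2 p q (2*j + 1)) * int m)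
         (of_int (sum_pos (\<Gamma>\<^sub>1 p q) (2*j + 1) r) * \<alpha> + of_int (sum_neg (\<Gamma>\<^sub>2 p q) (2*j + 1) s) * of_nat m))"

end

(* Write x = f_i, y for the other generator of sl_2, and K_u = J_u if x = f_1, K_u = J_(1-u) if x = f_2.
   In U(sl_2) one has x y = K_1 and x K_u = K_(u+1) x, hence for natural N >= M

     x^N (K_(u_1) ... K_(u_r) y^M) = K_(u_1+N) ... K_(u_r+N) K_N K_(N-1) ... K_(N-M+1) x^(N-M).

   The left side is also the sum of binom(N,k) (ad x)^k (K_(u_1) ... K_(u_r) y^M) x^(N-k), so both sides,
   divided by a power of x, are polynomial in N and the identity persists for complex exponents.
   A complex power in the localization of U(N_-) says nothing more than an identity
   X f^C = sum_k binom(a,k) (ad f)^k(W) f^(L-k) in U(N_-) for some large C (the sum is finite because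
   ad f is locally nilpotent by the Serre relations); its image in U(sl_2) determines the image of X
   because f_1 and f_2 are right cancellable there, by the Poincare-Birkhoff-Witt theorem.
   Thus each step from V_k to V_(k+1) shifts the indices of the J's already present and appends a new
   block of J's, and the indices add up to the alternating sums in the statement. *)
theory Submission
  imports Defs "HOL-Computational_Algebra.Polynomial"
begin

section \<open>Free algebras and enveloping algebras\<close>

text \<open>Cancellation and extrapolation in the exponent both rest on one faithful action of
  U(sl_2) on functions phi(r,t,s), where t stands for a value of h. Evaluating h at complex numbers
  turns noncommutative identities into identities of ordinary polynomials: right multiplication by x
  is a shift in s, and a family polynomial in the exponent has polynomial coefficients, which
  infinitely many zeros annihilate. The symmetry exchanging f_1 and f_2 and negating h lets every
  formula be written once for both choices of x. Two properties of Gamma govern the bookkeeping. The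
  identity Gamma_2^(2l+2) = Gamma_1^(2l+1) gives each family of words one formula for both parities
  of the step. The bounds p, q >= 2 make both sequences nondecreasing, so block lengths and
  remaining powers are natural numbers. The sums alternate because raising a K-index lowers the
  J-index when x = f_2.\<close>

lemma poly_mapping_induct_single [case_names zero single add]:
  fixes P :: "'a \<Rightarrow>\<^sub>0 'b::comm_monoid_add"
  assumes "Q 0"
    and single: "\<And>w c. w \<in> Poly_Mapping.keys P \<Longrightarrow> Q (Poly_Mapping.single w c)"
    and add: "\<And>P R. Q P \<Longrightarrow> Q R \<Longrightarrow> Q (P + R)"
  shows "Q P"
proof -
  have "P = (\<Sum>w\<in>Poly_Mapping.keys P. Poly_Mapping.single w (Poly_Mapping.lookup P w))"
  proof (rule poly_mapping_eqI)
    fix k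
    show "Poly_Mapping.lookup P k = Poly_Mapping.lookup
      (\<Sum>w\<in>Poly_Mapping.keys P. Poly_Mapping.single w (Poly_Mapping.lookup P w)) k"
      by (simp add: lookup_sum lookup_single when_def sum.delta in_keys_iff)
  qed
  moreover have "Q (\<Sum>w\<in>K. Poly_Mapping.single w (Poly_Mapping.lookup P w))"
    if "K \<subseteq> Poly_Mapping.keys P" for K
    using finite_subset[OF that finite_keys] that
    by (induction K rule: finite_induct) (auto intro!: assms)
  ultimately show ?thesis by (metis order_refl)
qed

lemma mult_single_zero_commute:
  fixes P :: "'a::monoid_add \<Rightarrow>\<^sub>0 'b::comm_semiring_1"
  shows "P * Poly_Mapping.single 0 c = Poly_Mapping.single 0 c * P"
  by (induction P rule: poly_mapping_induct_single)
    (simp_all add: mult_single mult.commute distrib_left distrib_right)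

lemma keys_uminus_poly_mapping:
  fixes P :: "'a \<Rightarrow>\<^sub>0 'b::ab_group_add"
  shows "Poly_Mapping.keys (- P) = Poly_Mapping.keys P"
  by (auto simp: in_keys_iff)

lemma free_alg_simps [simp]:
  "carrier (free_alg X) = {P. \<forall>w \<in> Poly_Mapping.keys P. set w \<subseteq> X}"
  "P \<otimes>\<^bsub>free_alg X\<^esub> Q = P * Q"
  "P \<oplus>\<^bsub>free_alg X\<^esub> Q = P + Q"
  "\<one>\<^bsub>free_alg X\<^esub> = 1"
  "\<zero>\<^bsub>free_alg X\<^esub> = 0"
  "c \<odot>\<^bsub>free_alg X\<^esub> P = Poly_Mapping.single 0 c * P"
  by (simp_all add: free_alg_def)

lemma free_alg_add_closed:
  "P \<in> carrier (free_alg X) \<Longrightarrow> Q \<in> carrier (free_alg X) \<Longrightarrow> P + Q \<in> carrier (free_alg X)"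
  using keys_add[of P Q] by auto

lemma free_alg_uminus_closed: "P \<in> carrier (free_alg X) \<Longrightarrow> - P \<in> carrier (free_alg X)"
  by (simp add: keys_uminus_poly_mapping)

lemma free_alg_diff_closed:
  "P \<in> carrier (free_alg X) \<Longrightarrow> Q \<in> carrier (free_alg X) \<Longrightarrow> P - Q \<in> carrier (free_alg X)"
  using free_alg_add_closed[of P X "- Q"] free_alg_uminus_closed[of Q X] by simp

lemma free_alg_mult_closed:
  assumes "P \<in> carrier (free_alg X)" "Q \<in> carrier (free_alg X)"
  shows "P * Q \<in> carrier (free_alg X)"
proof -
  have "set w \<subseteq> X" if "w \<in> Poly_Mapping.keys (P * Q)" for w
    using keys_mult[of P Q] that assms by (fastforce simp: plus_list_def)
  then show ?thesis by simp
qed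

lemma free_alg_single_closed: "set w \<subseteq> X \<Longrightarrow> Poly_Mapping.single w c \<in> carrier (free_alg X)"
  by simp

lemma free_alg_letter_closed: "x \<in> X \<Longrightarrow> letter x \<in> carrier (free_alg X)"
  by (simp add: letter_def)

lemma ring_free_alg: "ring (free_alg X)"
proof (rule ringI)
  show "abelian_group (free_alg X)"
  proof (rule abelian_groupI)
    fix P assume P: "P \<in> carrier (free_alg X)"
    show "\<exists>Q\<in>carrier (free_alg X). Q \<oplus>\<^bsub>free_alg X\<^esub> P = \<zero>\<^bsub>free_alg X\<^esub>"
      by (rule bexI[OF _ free_alg_uminus_closed[OF P]]) simp
  qed (use free_alg_add_closed in \<open>simp_all add: add.assoc add.commute\<close>)
  show "Group.monoid (free_alg X)"
    by (rule monoidI) (use free_alg_mult_closed in \<open>simp_all add: zero_list_def mult.assoc\<close>)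
qed (simp_all add: distrib_left distrib_right)

lemma minus_free_alg:
  assumes "P \<in> carrier (free_alg X)" "Q \<in> carrier (free_alg X)"
  shows "P \<ominus>\<^bsub>free_alg X\<^esub> Q = P - Q"
proof -
  interpret ring "free_alg X" by (rule ring_free_alg)
  have "\<ominus>\<^bsub>free_alg X\<^esub> Q = - Q"
    using free_alg_uminus_closed[OF assms(2)] assms(2)
    by (intro minus_equality) simp_all
  then show ?thesis by (simp add: a_minus_def)
qed

lemma quot_alg_simps [simp]:
  "carrier (quot_alg A I) = carrier (A Quot I)"
  "monoid.mult (quot_alg A I) = monoid.mult (A Quot I)"
  "add (quot_alg A I) = add (A Quot I)"
  "one (quot_alg A I) = one (A Quot I)"
  "zero (quot_alg A I) = zero (A Quot I)"
  by (simp_all add: quot_alg_def)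

text \<open>\<open>quot_alg\<close> copies the operations of the quotient ring into a record with
  scalars, so the axioms are carried over from \<open>A Quot I\<close> one by one.\<close>

lemma ring_quot_alg:
  assumes "ideal I A"
  shows "ring (quot_alg A I)"
proof -
  interpret Q: ring "A Quot I" by (rule ideal.quotient_is_ring[OF assms])
  show ?thesis
  proof (rule ringI)
    show "abelian_group (quot_alg A I)"
      by (rule abelian_groupI) (simp_all add: Q.a_assoc, rule Q.a_comm, simp_all add: Q.add.l_inv_ex)
    show "Group.monoid (quot_alg A I)"
      by (rule monoidI) (auto simp: Q.m_assoc)
  qed (auto simp: Q.l_distr Q.r_distr)
qed

section \<open>Enveloping algebras: relations between generators and induction over words\<close>

locale lie_closed =
  fixes L :: "'a lie_alg"
  assumes ladd_closed: "x \<in> lcarrier L \<Longrightarrow> y \<in> lcarrier L \<Longrightarrow> ladd L x y \<in> lcarrier L"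
    and lscale_closed: "x \<in> lcarrier L \<Longrightarrow> lscale L c x \<in> lcarrier L"
    and lbracket_closed: "x \<in> lcarrier L \<Longrightarrow> y \<in> lcarrier L \<Longrightarrow> lbracket L x y \<in> lcarrier L"
begin

abbreviation "FA \<equiv> free_alg (lcarrier L)"
abbreviation "I \<equiv> env_ideal L"

definition env_class :: "('a list \<Rightarrow>\<^sub>0 complex) \<Rightarrow> ('a list \<Rightarrow>\<^sub>0 complex) set" where
  "env_class P = I +>\<^bsub>FA\<^esub> P"

definition env_relators :: "('a list \<Rightarrow>\<^sub>0 complex) set" where
  "env_relators =
      {letter (ladd L x y) - letter x - letter y | x y. x \<in> lcarrier L \<and> y \<in> lcarrier L}
    \<union> {letter (lscale L c x) - Poly_Mapping.single 0 c * letter x | c x. x \<in> lcarrier L}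
    \<union> {letter x * letter y - letter y * letter x - letter (lbracket L x y) | x y.
         x \<in> lcarrier L \<and> y \<in> lcarrier L}"

lemma env_ideal_eq: "I = Idl\<^bsub>FA\<^esub> env_relators"
  by (simp add: env_ideal_def env_relators_def)

lemma env_relators_subset: "env_relators \<subseteq> carrier FA"
  unfolding env_relators_def
  by (auto simp del: free_alg_simps(1) intro!: free_alg_diff_closed free_alg_mult_closed
      free_alg_letter_closed ladd_closed lscale_closed lbracket_closed free_alg_single_closed
      simp: zero_list_def)

lemma ideal_env_ideal: "ideal I FA"
  unfolding env_ideal_eq by (rule ring.genideal_ideal[OF ring_free_alg env_relators_subset])

lemma env_relators_in_ideal: "env_relators \<subseteq> I"
  unfolding env_ideal_eq by (rule ring.genideal_self[OF ring_free_alg env_relators_subset])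

lemma carrier_env: "carrier (env_alg L) = env_class ` carrier FA"
  by (auto simp: env_alg_def FactRing_def A_RCOSETS_defs a_r_coset_def env_class_def)

lemma ring_env: "ring (env_alg L)"
  unfolding env_alg_def by (rule ring_quot_alg[OF ideal_env_ideal])

lemma env_class_closed: "P \<in> carrier FA \<Longrightarrow> env_class P \<in> carrier (env_alg L)"
  by (simp add: carrier_env del: free_alg_simps)

lemma env_class_mult:
  assumes "P \<in> carrier FA" "Q \<in> carrier FA"
  shows "env_class P \<otimes>\<^bsub>env_alg L\<^esub> env_class Q = env_class (P * Q)"
  using ideal.rcoset_mult_add[OF ideal_env_ideal assms]
  by (simp add: env_alg_def env_class_def FactRing_def)

lemma env_class_add:
  assumes "P \<in> carrier FA" "Q \<in> carrier FA"
  shows "env_class P \<oplus>\<^bsub>env_alg L\<^esub> env_class Q = env_class (P + Q)"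
  using abelian_subgroup.a_rcos_sum[OF abelian_subgroupI3 assms, of I] ideal_env_ideal
  by (simp add: env_alg_def env_class_def FactRing_def ideal_def additive_subgroup_def
      ring_def ring_free_alg)

lemma env_class_one: "\<one>\<^bsub>env_alg L\<^esub> = env_class 1"
  by (simp add: env_alg_def env_class_def FactRing_def)

lemma env_class_eq_iff:
  assumes "P \<in> carrier FA" "Q \<in> carrier FA"
  shows "env_class P = env_class Q \<longleftrightarrow> P - Q \<in> I"
  using ring.quotient_eq_iff_same_a_r_cos[OF ring_free_alg ideal_env_ideal assms]
    minus_free_alg[OF assms] by (simp add: env_class_def)

lemma env_class_zero: "\<zero>\<^bsub>env_alg L\<^esub> = env_class 0"
proof -
  interpret ring "env_alg L" by (rule ring_env)
  have "env_class 0 \<oplus>\<^bsub>env_alg L\<^esub> env_class 0 = env_class 0"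
    by (simp add: env_class_add)
  moreover have "env_class 0 \<in> carrier (env_alg L)" by (simp add: env_class_closed)
  ultimately show ?thesis by (metis add.r_cancel_one')
qed

text \<open>Scaling a coset is a union over all its representatives. It collapses to one coset
  because scaling is multiplication by \<open>Poly_Mapping.single 0 c\<close>, which the ideal
  absorbs.\<close>

lemma env_class_smult:
  assumes P: "P \<in> carrier FA"
  shows "c \<odot>\<^bsub>env_alg L\<^esub> env_class P = env_class (Poly_Mapping.single 0 c * P)"
proof -
  have sc: "Poly_Mapping.single 0 c * Q \<in> carrier FA" if "Q \<in> carrier FA" for Q
    using that by (intro free_alg_mult_closed free_alg_single_closed) (simp_all add: zero_list_def)
  interpret ideal I FA by (rule ideal_env_ideal)
  have "env_class (Poly_Mapping.single 0 c * Q) = env_class (Poly_Mapping.single 0 c * P)"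
    if Q: "Q \<in> env_class P" for Q
  proof -
    from Q obtain i where i: "i \<in> I" "Q = i + P"
      by (auto simp: env_class_def a_r_coset_def r_coset_def)
    have Qc: "Q \<in> carrier FA" using i P a_subset free_alg_add_closed by blast
    have "Poly_Mapping.single 0 c * Q - Poly_Mapping.single 0 c * P = Poly_Mapping.single 0 c * i"
      using i by (simp add: distrib_left)
    also have "\<dots> \<in> I"
      using I_l_closed[OF i(1), of "Poly_Mapping.single 0 c"] by (simp add: zero_list_def)
    finally show ?thesis using env_class_eq_iff sc P Qc by blast
  qed
  moreover have "P \<in> env_class P" unfolding env_class_def by (rule a_rcos_self[OF P])
  ultimately have "(\<Union>Q\<in>env_class P. env_class (Poly_Mapping.single 0 c * Q)) =
      env_class (Poly_Mapping.single 0 c * P)"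
    by blast
  then show ?thesis
    by (simp only: env_alg_def quot_alg_def env_class_def free_alg_simps module.simps)
qed

lemma env_class_letter: "env_class (letter x) = env_in L x"
  by (simp add: env_class_def env_in_def)

lemma env_in_closed: "x \<in> lcarrier L \<Longrightarrow> env_in L x \<in> carrier (env_alg L)"
  by (metis env_class_letter env_class_closed free_alg_letter_closed)

lemma env_in_add:
  assumes "x \<in> lcarrier L" "y \<in> lcarrier L"
  shows "env_in L (ladd L x y) = env_in L x \<oplus>\<^bsub>env_alg L\<^esub> env_in L y"
proof -
  note c = free_alg_letter_closed[OF assms(1)] free_alg_letter_closed[OF assms(2)]
    free_alg_letter_closed[OF ladd_closed[OF assms]]
  have "letter (ladd L x y) - letter x - letter y \<in> I"
    by (rule subsetD[OF env_relators_in_ideal], unfold env_relators_def) (use assms in blast)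
  then have "letter (ladd L x y) - (letter x + letter y) \<in> I"
    by (simp add: diff_diff_eq)
  then show ?thesis
    using env_class_eq_iff[OF c(3) free_alg_add_closed[OF c(1,2)]] env_class_add[OF c(1,2)]
    by (simp add: env_class_letter)
qed

lemma env_in_scale:
  assumes "x \<in> lcarrier L"
  shows "env_in L (lscale L c x) = c \<odot>\<^bsub>env_alg L\<^esub> env_in L x"
proof -
  note c = free_alg_letter_closed[OF assms] free_alg_letter_closed[OF lscale_closed[OF assms]]
  have sc: "Poly_Mapping.single 0 c * letter x \<in> carrier FA"
    using c(1) by (intro free_alg_mult_closed free_alg_single_closed) (simp_all add: zero_list_def)
  have "letter (lscale L c x) - Poly_Mapping.single 0 c * letter x \<in> I"
    by (rule subsetD[OF env_relators_in_ideal], unfold env_relators_def) (use assms in blast)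
  then show ?thesis
    using env_class_eq_iff[OF c(2) sc] env_class_smult[OF c(1)]
    by (simp add: env_class_letter)
qed

lemma env_in_bracket:
  assumes "x \<in> lcarrier L" "y \<in> lcarrier L"
  shows "env_in L x \<otimes>\<^bsub>env_alg L\<^esub> env_in L y =
    env_in L (lbracket L x y) \<oplus>\<^bsub>env_alg L\<^esub> env_in L y \<otimes>\<^bsub>env_alg L\<^esub> env_in L x"
proof -
  note c = free_alg_letter_closed[OF assms(1)] free_alg_letter_closed[OF assms(2)]
    free_alg_letter_closed[OF lbracket_closed[OF assms]]
  note m = free_alg_mult_closed[OF c(1,2)] free_alg_mult_closed[OF c(2,1)]
  have "letter x * letter y - letter y * letter x - letter (lbracket L x y) \<in> I"
    by (rule subsetD[OF env_relators_in_ideal], unfold env_relators_def) (use assms in blast)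
  then have "letter x * letter y - (letter (lbracket L x y) + letter y * letter x) \<in> I"
    by (simp add: algebra_simps)
  then show ?thesis
    using env_class_eq_iff[OF m(1) free_alg_add_closed[OF c(3) m(2)]]
      env_class_add[OF c(3) m(2)] env_class_mult[OF c(1,2)] env_class_mult[OF c(2,1)]
    by (simp add: env_class_letter)
qed

text \<open>Every class is a linear combination of words, and a word grows by one letter on the
  left; hence the case \<open>mult\<close> treats left multiplication by a single Lie
  element.\<close>

lemma env_induct [consumes 1, case_names one mult scale add]:
  assumes u: "u \<in> carrier (env_alg L)"
    and one: "Q \<one>\<^bsub>env_alg L\<^esub>"
    and mult: "\<And>x v. x \<in> lcarrier L \<Longrightarrow> v \<in> carrier (env_alg L) \<Longrightarrow> Q v \<Longrightarrow>
      Q (env_in L x \<otimes>\<^bsub>env_alg L\<^esub> v)"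
    and scale: "\<And>c v. v \<in> carrier (env_alg L) \<Longrightarrow> Q v \<Longrightarrow> Q (c \<odot>\<^bsub>env_alg L\<^esub> v)"
    and add: "\<And>v w. v \<in> carrier (env_alg L) \<Longrightarrow> w \<in> carrier (env_alg L) \<Longrightarrow> Q v \<Longrightarrow> Q w \<Longrightarrow>
      Q (v \<oplus>\<^bsub>env_alg L\<^esub> w)"
  shows "Q u"
proof -
  from u obtain P where P: "P \<in> carrier FA" "u = env_class P" by (auto simp: carrier_env)
  have word: "Q (env_class (Poly_Mapping.single w 1)) \<and> Poly_Mapping.single w 1 \<in> carrier FA"
    if "set w \<subseteq> lcarrier L" for w
    using that
  proof (induction w)
    case Nil
    then show ?case using one by (simp add: env_class_one flip: zero_list_def)
  next
    case (Cons x w)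
    then have "letter x * Poly_Mapping.single w 1 = Poly_Mapping.single (x # w) 1"
      by (simp add: letter_def mult_single plus_list_def)
    moreover have "Q (env_in L x \<otimes>\<^bsub>env_alg L\<^esub> env_class (Poly_Mapping.single w 1))"
      using Cons by (intro mult env_class_closed) auto
    ultimately show ?case
      using Cons env_class_mult[OF free_alg_letter_closed, of x "Poly_Mapping.single w 1"]
      by (simp add: env_class_letter)
  qed
  have single: "Q (env_class (Poly_Mapping.single w c))" if w: "set w \<subseteq> lcarrier L" for w c
  proof -
    have "c \<odot>\<^bsub>env_alg L\<^esub> env_class (Poly_Mapping.single w 1) = env_class (Poly_Mapping.single w c)"
      using word[OF w] by (subst env_class_smult) (simp_all add: mult_single)
    then show ?thesis using word[OF w] scale[OF env_class_closed] by metis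
  qed
  \<comment> \<open>Membership is proved along with \<open>Q\<close>, since the case
    \<open>add\<close> needs it for both summands; the single terms inherit it from the keys of the
    original \<open>P\<close>.\<close>
  have "P \<in> carrier FA \<and> Q (env_class P)"
  proof (induction rule: poly_mapping_induct_single)
    case zero
    show ?case using single[of "[]" 0] by simp
  next
    case (single w c)
    then have "set w \<subseteq> lcarrier L" using P(1) by simp
    then show ?case using \<open>\<And>w c. set w \<subseteq> lcarrier L \<Longrightarrow> Q (env_class (Poly_Mapping.single w c))\<close>
      free_alg_single_closed by blast
  next
    case (add P R)
    then have c: "P \<in> carrier FA" "R \<in> carrier FA" by blast+
    have "Q (env_class P \<oplus>\<^bsub>env_alg L\<^esub> env_class R)"
      using add c by (intro assms(5) env_class_closed) auto
    then show ?case
      using env_class_add[OF c] free_alg_add_closed[OF c] by simp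
  qed
  then show ?thesis using P by simp
qed

end

section \<open>The algebra $U(sl_2)$ as a type\<close>

interpretation sl2: lie_closed sl2_alg
  by standard (simp_all add: sl2_alg_def)

lemma lcarrier_sl2 [simp]: "lcarrier sl2_alg = UNIV"
  by (simp add: sl2_alg_def)

lemma carrier_free_UNIV [simp]: "carrier (free_alg UNIV) = UNIV"
  by simp

text \<open>The function \<open>\<phi>\<close> encodes the normally ordered series $\sum_{r,s} y^r\,\phi(r,h,s)\,x^s$ for the
  triple $(x,y,h)=(f_1,f_2,h)$ (\<open>N1\<close>) or $(f_2,f_1,-h)$ (\<open>N2\<close>); \<open>sl2_op\<close> is left multiplication
  in these coordinates.\<close>

type_synonym series = "nat \<Rightarrow> complex \<Rightarrow> nat \<Rightarrow> complex"

fun sl2_coords :: "node \<Rightarrow> sl2 \<Rightarrow> sl2" where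
  "sl2_coords N1 (a, b, c) = (a, b, c)"
| "sl2_coords N2 (a, b, c) = (b, a, - c)"

text \<open>The coefficients come from normal ordering: x g(h) = g(h-1) x, h y^r = y^r (h-r), and x
  y^(r+1) = y^(r+1) x + y^r ((r+1) h - (0+1+...+r)).\<close>

definition sl2_op :: "node \<Rightarrow> sl2 \<Rightarrow> series \<Rightarrow> series" where
  "sl2_op i v \<phi> r t s = (case sl2_coords i v of (a, b, c) \<Rightarrow>
     a * ((if s = 0 then 0 else \<phi> r (t - 1) (s - 1))
          + (of_nat (Suc r) * t - of_nat (\<Sum>k\<le>r. k)) * \<phi> (Suc r) t s)
   + b * (if r = 0 then 0 else \<phi> (r - 1) t s)
   + c * (t - of_nat r) * \<phi> r t s)"

definition word_op :: "node \<Rightarrow> sl2 list \<Rightarrow> series \<Rightarrow> series" where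
  "word_op i w \<phi> = foldr (sl2_op i) w \<phi>"

definition free_op :: "node \<Rightarrow> (sl2 list \<Rightarrow>\<^sub>0 complex) \<Rightarrow> series \<Rightarrow> series" where
  "free_op i P \<phi> r t s = (\<Sum>w\<in>Poly_Mapping.keys P. Poly_Mapping.lookup P w * word_op i w \<phi> r t s)"

lemma sl2_op_linear:
  "sl2_op i v (\<lambda>r t s. c * \<phi> r t s + d * \<psi> r t s) r t s
    = c * sl2_op i v \<phi> r t s + d * sl2_op i v \<psi> r t s"
  by (cases "sl2_coords i v") (simp add: sl2_op_def algebra_simps)

lemma word_op_linear:
  "word_op i w (\<lambda>r t s. c * \<phi> r t s + d * \<psi> r t s)
    = (\<lambda>r t s. c * word_op i w \<phi> r t s + d * word_op i w \<psi> r t s)"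
  by (induction w) (auto simp: word_op_def sl2_op_linear)

lemma word_op_append: "word_op i (v @ w) \<phi> = word_op i v (word_op i w \<phi>)"
  by (simp add: word_op_def)

lemma free_op_add: "free_op i (P + Q) \<phi> r t s = free_op i P \<phi> r t s + free_op i Q \<phi> r t s"
  unfolding free_op_def by (rule setsum_keys_plus_distrib) (simp_all add: distrib_right)

lemma free_op_zero [simp]: "free_op i 0 \<phi> r t s = 0"
  by (simp add: free_op_def)

lemma free_op_uminus: "free_op i (- P) \<phi> r t s = - free_op i P \<phi> r t s"
  by (metis add.right_inverse add_eq_0_iff free_op_add free_op_zero)

lemma free_op_diff: "free_op i (P - Q) \<phi> r t s = free_op i P \<phi> r t s - free_op i Q \<phi> r t s"
  using free_op_add[of i P "- Q"] by (simp add: free_op_uminus)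

lemma free_op_single: "free_op i (Poly_Mapping.single w c) \<phi> = (\<lambda>r t s. c * word_op i w \<phi> r t s)"
  by (intro ext) (cases "c = 0"; simp add: free_op_def)

lemma free_op_scale: "free_op i P (\<lambda>r t s. c * \<phi> r t s) r t s = c * free_op i P \<phi> r t s"
  using word_op_linear[of i _ c \<phi> 0 \<phi>]
  by (simp add: free_op_def sum_distrib_left mult.left_commute)

lemma free_op_plus:
  "free_op i P (\<lambda>r t s. \<phi> r t s + \<psi> r t s) r t s = free_op i P \<phi> r t s + free_op i P \<psi> r t s"
  using word_op_linear[of i _ 1 \<phi> 1 \<psi>]
  by (simp add: free_op_def sum.distrib distrib_left)

lemma free_op_mult: "free_op i (P * Q) \<phi> = free_op i P (free_op i Q \<phi>)"
proof (induction P rule: poly_mapping_induct_single)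
  case zero
  show ?case by (intro ext) simp
next
  case (single w c)
  show ?case
  proof (induction Q rule: poly_mapping_induct_single)
    case zero
    show ?case
      using free_op_scale[of i "Poly_Mapping.single w c" 0] by (intro ext) simp
  next
    case (single v d)
    show ?case
      using word_op_linear[of i w d "word_op i v \<phi>" 0 \<phi>]
      by (simp add: mult_single free_op_single word_op_append plus_list_def mult.assoc)
  next
    case (add P R)
    have "free_op i (P + R) \<phi> = (\<lambda>r t s. free_op i P \<phi> r t s + free_op i R \<phi> r t s)"
      by (intro ext) (rule free_op_add)
    then show ?case
      using add by (intro ext) (simp add: distrib_left free_op_add free_op_plus)
  qed
next
  case (add P R)
  then show ?case by (intro ext) (simp add: distrib_right free_op_add)
qed

text \<open>This is the representation property: it makes the action of words compatible with the
  commutator relators of U(sl_2).\<close>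

lemma sl2_op_bracket:
  "sl2_op i u (sl2_op i v \<phi>) r t s =
    sl2_op i v (sl2_op i u \<phi>) r t s + sl2_op i (sl2_bracket u v) \<phi> r t s"
proof -
  obtain a b c a' b' c' where uv: "u = (a, b, c)" "v = (a', b', c')" by (metis prod.exhaust)
  \<comment> \<open>The triangular numbers enter through their recursion alone, which leaves
    polynomial identities in t and r; the cases r = 0 and s = 0 are the boundary values of
    \<open>sl2_op\<close>.\<close>
  define T where "T n = (of_nat (\<Sum>k\<le>n. k) :: complex)" for n
  have T: "T 0 = 0" "T (Suc n) = T n + of_nat n + 1" for n by (simp_all add: T_def)
  show ?thesis
  proof (cases r)
    case 0
    then show ?thesis unfolding uv sl2_op_def T_def[symmetric]
      by (cases i; cases s) (simp_all add: algebra_simps T)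
  next
    case (Suc n)
    show ?thesis unfolding uv sl2_op_def Suc T_def[symmetric]
      by (cases i; cases s) (simp_all add: algebra_simps T)
  qed
qed

text \<open>The elements acting by zero on every series form a two-sided ideal. It contains the
  relators, hence the whole defining ideal, and the action descends to U(sl_2).\<close>

lemma env_ideal_sl2_op:
  assumes "P \<in> env_ideal sl2_alg"
  shows "free_op i P \<phi> r t s = 0"
proof -
  define K where "K = {P. \<forall>\<phi> r t s. free_op i P \<phi> r t s = 0}"
  let ?A = "free_alg UNIV :: (complex, sl2 list \<Rightarrow>\<^sub>0 complex) module"
  have "ideal K ?A"
  proof (rule idealI)
    show "ring ?A" by (rule ring_free_alg)
    interpret ring ?A by (rule ring_free_alg)
    show "subgroup K (add_monoid ?A)"
    proof (rule add.subgroupI)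
      show "K \<subseteq> carrier ?A" by simp
      have "0 \<in> K" by (simp add: K_def)
      then show "K \<noteq> {}" by blast
      fix P Q assume P: "P \<in> K" and Q: "Q \<in> K"
      have "\<ominus>\<^bsub>?A\<^esub> P = - P" by (rule minus_equality) simp_all
      then show "\<ominus>\<^bsub>?A\<^esub> P \<in> K" using P by (simp add: K_def free_op_uminus)
      show "P \<oplus>\<^bsub>?A\<^esub> Q \<in> K" using P Q by (simp add: K_def free_op_add)
    qed
    fix P x assume "P \<in> K"
    then have P: "free_op i P \<phi> = (\<lambda>_ _ _. 0)" for \<phi>
      by (intro ext) (simp add: K_def)
    show "P \<otimes>\<^bsub>?A\<^esub> x \<in> K" by (simp add: K_def free_op_mult P)
    have "free_op i x (\<lambda>_ _ _. 0) r t s = 0" for r t s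
      using free_op_scale[of i x 0 "\<lambda>_ _ _. 0"] by simp
    then show "x \<otimes>\<^bsub>?A\<^esub> P \<in> K" by (simp add: K_def free_op_mult P)
  qed
  moreover have "sl2.env_relators \<subseteq> K"
  proof -
    have l: "free_op i (letter v) = sl2_op i v" for v
      by (intro ext) (simp add: letter_def free_op_single word_op_def)
    have add: "sl2_op i (a + a', b + b', c + c') \<phi> r t s
        = sl2_op i (a, b, c) \<phi> r t s + sl2_op i (a', b', c') \<phi> r t s" for a b c a' b' c' \<phi> r t s
      by (cases i) (simp_all add: sl2_op_def algebra_simps)
    have scale: "sl2_op i (d * a, d * b, d * c) \<phi> r t s = d * sl2_op i (a, b, c) \<phi> r t s"
      for a b c d \<phi> r t s
      by (cases i) (simp_all add: sl2_op_def algebra_simps)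
    have c: "free_op i (Poly_Mapping.single 0 c) \<phi> r t s = c * \<phi> r t s" for c \<phi> r t s
      by (simp add: free_op_single word_op_def zero_list_def)
    have bracket: "sl2_op i (a, b, c) (sl2_op i (a', b', c') \<phi>) r t s
        - sl2_op i (a', b', c') (sl2_op i (a, b, c) \<phi>) r t s
        = sl2_op i (c * a' - a * c', b * c' - c * b', a * b' - b * a') \<phi> r t s"
      for a b c a' b' c' \<phi> r t s
      using sl2_op_bracket[of i "(a, b, c)" "(a', b', c')" \<phi> r t s] by simp
    show ?thesis
      unfolding sl2.env_relators_def K_def
      by (auto simp: sl2_alg_def free_op_diff l free_op_mult add scale c bracket)
  qed
  ultimately have "env_ideal sl2_alg \<subseteq> K"
    unfolding sl2.env_ideal_eq using ring.genideal_minimal[OF ring_free_alg] by simp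
  then show ?thesis using assms by (auto simp: K_def)
qed

interpretation U: ring U_sl2
  unfolding U_sl2_def by (rule sl2.ring_env)

text \<open>As a type of class \<open>ring_1\<close>, U(sl_2) admits simplification without carrier
  conditions; results return to the record \<open>U_sl2\<close> through \<open>to_U\<close>.\<close>

typedef usl2 = "carrier U_sl2" morphisms to_U of_U
  using U.zero_closed by blast

setup_lifting type_definition_usl2

lift_definition ucls :: "(sl2 list \<Rightarrow>\<^sub>0 complex) \<Rightarrow> usl2" is sl2.env_class
  using sl2.env_class_closed by (simp add: U_sl2_def)

lemma ucls_cases: obtains P where "u = ucls P"
  using to_U[of u] by (auto simp: U_sl2_def sl2.carrier_env to_U_inject simp flip: ucls.rep_eq)

lemma ucls_eq_iff: "ucls P = ucls Q \<longleftrightarrow> P - Q \<in> env_ideal sl2_alg"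
  by (simp add: ucls.rep_eq sl2.env_class_eq_iff flip: to_U_inject)

lemma free_op_cong: "ucls P = ucls Q \<Longrightarrow> free_op i P = free_op i Q"
  by (intro ext) (metis env_ideal_sl2_op ucls_eq_iff free_op_diff eq_iff_diff_eq_0)

instantiation usl2 :: ring_1
begin

lift_definition zero_usl2 :: usl2 is "\<zero>\<^bsub>U_sl2\<^esub>" by simp
lift_definition one_usl2 :: usl2 is "\<one>\<^bsub>U_sl2\<^esub>" by simp
lift_definition plus_usl2 :: "usl2 \<Rightarrow> usl2 \<Rightarrow> usl2" is "\<lambda>x y. x \<oplus>\<^bsub>U_sl2\<^esub> y" by simp
lift_definition minus_usl2 :: "usl2 \<Rightarrow> usl2 \<Rightarrow> usl2" is "\<lambda>x y. x \<ominus>\<^bsub>U_sl2\<^esub> y" by simp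
lift_definition uminus_usl2 :: "usl2 \<Rightarrow> usl2" is "\<lambda>x. \<ominus>\<^bsub>U_sl2\<^esub> x" by simp
lift_definition times_usl2 :: "usl2 \<Rightarrow> usl2 \<Rightarrow> usl2" is "\<lambda>x y. x \<otimes>\<^bsub>U_sl2\<^esub> y" by simp

lemma ucls_one: "ucls 1 = 1"
  by (simp add: ucls.rep_eq one_usl2.rep_eq U_sl2_def sl2.env_class_one flip: to_U_inject)

lemma ucls_zero: "ucls 0 = 0"
  by (simp add: ucls.rep_eq zero_usl2.rep_eq U_sl2_def sl2.env_class_zero flip: to_U_inject)

instance
proof
  \<comment> \<open>The action separates the two elements: on the constant series 1 they give the
    values 0 and 1.\<close>
  show "(0::usl2) \<noteq> 1"
  proof
    assume "(0::usl2) = 1"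
    then have "free_op N1 0 = free_op N1 1"
      by (intro free_op_cong) (simp add: ucls_one ucls_zero)
    then have "free_op N1 0 (\<lambda>_ _ _. 1) 0 0 0 = free_op N1 1 (\<lambda>_ _ _. 1) 0 0 0" by simp
    then show False by (simp add: free_op_def word_op_def lookup_one zero_list_def)
  qed
  fix a b c :: usl2
  show "a * b * c = a * (b * c)" by transfer (rule U.m_assoc)
  show "1 * a = a" by transfer (rule U.l_one)
  show "a * 1 = a" by transfer (rule U.r_one)
  show "a + b + c = a + (b + c)" by transfer (rule U.a_assoc)
  show "a + b = b + a" by transfer (rule U.a_comm)
  show "0 + a = a" by transfer (rule U.l_zero)
  show "- a + a = 0" by transfer (rule U.l_neg)
  show "a - b = a + - b" by transfer (rule a_minus_def)
  show "(a + b) * c = a * c + b * c" by transfer (rule U.l_distr)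
  show "a * (b + c) = a * b + a * c" by transfer (rule U.r_distr)
qed

end

section \<open>Scalars, generators and commutation relations in the type\<close>

lemma ucls_mult: "ucls (P * Q) = ucls P * ucls Q"
  by (simp add: ucls.rep_eq times_usl2.rep_eq U_sl2_def sl2.env_class_mult flip: to_U_inject)

lemma ucls_add: "ucls (P + Q) = ucls P + ucls Q"
  by (simp add: ucls.rep_eq plus_usl2.rep_eq U_sl2_def sl2.env_class_add flip: to_U_inject)

text \<open>Scalars become central elements, so that scalar multiplication is ordinary ring
  multiplication.\<close>

definition cst :: "complex \<Rightarrow> usl2" where
  "cst c = ucls (Poly_Mapping.single 0 c)"

definition gen :: "sl2 \<Rightarrow> usl2" where
  "gen v = ucls (letter v)"

definition gf :: "node \<Rightarrow> usl2" where
  "gf i = gen (case i of N1 \<Rightarrow> (1, 0, 0) | N2 \<Rightarrow> (0, 1, 0))"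

text \<open>The sign is chosen so that x = \<open>gf i\<close>, y = \<open>gf (other i)\<close> and
  h = \<open>gh i\<close> satisfy [x,y] = h, [h,x] = x, [h,y] = -y for either
  \<open>i\<close>.\<close>

definition gh :: "node \<Rightarrow> usl2" where
  "gh i = (case i of N1 \<Rightarrow> gen (0, 0, 1) | N2 \<Rightarrow> - gen (0, 0, 1))"

fun other :: "node \<Rightarrow> node" where
  "other N1 = N2"
| "other N2 = N1"

lemma other_other [simp]: "other (other i) = i"
  by (cases i) simp_all

lemma gh_other: "gh (other i) = - gh i"
  by (cases i) (simp_all add: gh_def)

lemma cst_1 [simp]: "cst 1 = 1" and cst_0 [simp]: "cst 0 = 0"
  by (simp_all add: cst_def ucls_one ucls_zero)

lemma cst_add: "cst (c + d) = cst c + cst d"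
  by (simp add: cst_def single_add ucls_add)

lemma cst_mult: "cst (c * d) = cst c * cst d"
  by (simp add: cst_def mult_single flip: ucls_mult)

lemma cst_uminus: "cst (- c) = - cst c"
  using cst_add[of "- c" c] by (simp add: eq_neg_iff_add_eq_0)

lemma cst_diff: "cst (c - d) = cst c - cst d"
  using cst_add[of c "- d"] by (simp add: cst_uminus)

lemma cst_commute: "u * cst c = cst c * u"
  by (cases u rule: ucls_cases) (simp add: cst_def mult_single_zero_commute flip: ucls_mult)

lemma cst_left_commute: "u * (cst c * v) = cst c * (u * v)"
  by (metis cst_commute mult.assoc)

lemma cst_of_nat: "cst (of_nat n) = of_nat n"
  by (induction n) (simp_all add: cst_add)

lemma to_U_cst_mult: "to_U (cst c * u) = c \<odot>\<^bsub>U_sl2\<^esub> to_U u"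
proof -
  obtain P where "u = ucls P" by (rule ucls_cases)
  then show ?thesis
    by (simp add: cst_def ucls.rep_eq U_sl2_def sl2.env_class_smult flip: ucls_mult)
qed

lemma to_U_gen: "to_U (gen v) = env_in sl2_alg v"
  by (simp add: gen_def ucls.rep_eq sl2.env_class_letter)

lemma gen_add: "gen (sl2_add u v) = gen u + gen v"
  using sl2.env_in_add[of u v]
  by (simp add: to_U_gen plus_usl2.rep_eq U_sl2_def flip: to_U_inject)
    (simp add: sl2_alg_def)

lemma gen_scale: "gen (sl2_scale c v) = cst c * gen v"
  using sl2.env_in_scale[of v c]
  by (simp add: to_U_gen to_U_cst_mult U_sl2_def flip: to_U_inject)
    (simp add: sl2_alg_def)

lemma gen_bracket: "gen u * gen v = gen (sl2_bracket u v) + gen v * gen u"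
  using sl2.env_in_bracket[of u v]
  by (simp add: to_U_gen plus_usl2.rep_eq times_usl2.rep_eq U_sl2_def flip: to_U_inject)
    (simp add: sl2_alg_def)

lemma gen_neg: "gen (- a, - b, - c) = - gen (a, b, c)"
  using gen_scale[of "-1" "(a, b, c)"] by (simp add: cst_uminus)

lemma gf_gf: "gf i * gf (other i) = gh i + gf (other i) * gf i"
proof (cases i)
  case N1
  then show ?thesis
    using gen_bracket[of "(1, 0, 0)" "(0, 1, 0)"] by (simp add: gf_def gh_def)
next
  case N2
  then show ?thesis
    using gen_bracket[of "(0, 1, 0)" "(1, 0, 0)"] gen_neg[of 0 0 1] by (simp add: gf_def gh_def)
qed

lemma gh_gf: "gh i * gf i = gf i + gf i * gh i"
  using gen_neg[of 0 1 0] gen_bracket[of "(0, 0, 1)" "(1, 0, 0)"] gen_bracket[of "(0, 0, 1)" "(0, 1, 0)"]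
  by (cases i) (simp_all add: gf_def gh_def)

lemma gh_gf_other: "gh i * gf (other i) = - gf (other i) + gf (other i) * gh i"
  using gh_gf[of "other i"] by (simp add: gh_other) (metis minus_diff_eq minus_minus)

text \<open>The commutation relations are also needed in front of a further factor, since products
  are kept associated to the right.\<close>

lemma gf_gf_left: "gf i * (gf (other i) * u) = gh i * u + gf (other i) * (gf i * u)"
  by (metis gf_gf distrib_right mult.assoc)

lemma gh_gf_left: "gh i * (gf i * u) = gf i * u + gf i * (gh i * u)"
  by (metis gh_gf distrib_right mult.assoc)

lemma gh_gf_other_left: "gh i * (gf (other i) * u) = - (gf (other i) * u) + gf (other i) * (gh i * u)"
  by (metis gh_gf_other distrib_right mult.assoc mult_minus_left)

lemma gen_eq: "gen (a, b, c) = cst a * gf N1 + cst b * gf N2 + cst c * gh N1"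
  using gen_add[of "(a, 0, 0)" "(0, b, c)"] gen_add[of "(0, b, 0)" "(0, 0, c)"]
    gen_scale[of a "(1, 0, 0)"] gen_scale[of b "(0, 1, 0)"] gen_scale[of c "(0, 0, 1)"]
  by (simp add: gf_def gh_def)

lemma usl2_induct [case_names one gf gh scale add]:
  assumes "Q 1" and gf: "\<And>i v. Q v \<Longrightarrow> Q (gf i * v)" and gh: "\<And>v. Q v \<Longrightarrow> Q (gh N1 * v)"
    and scale: "\<And>c v. Q v \<Longrightarrow> Q (cst c * v)" and add: "\<And>v w. Q v \<Longrightarrow> Q w \<Longrightarrow> Q (v + w)"
  shows "Q u"
proof -
  have "\<forall>v. to_U v = x \<longrightarrow> Q v" if "x \<in> carrier U_sl2" for x
    using that unfolding U_sl2_def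
  proof (induction rule: sl2.env_induct)
    case one
    then show ?case using assms(1) by (metis U_sl2_def one_usl2.rep_eq to_U_inject)
  next
    case (mult x v)
    obtain a b c where x: "x = (a, b, c)" by (metis prod.exhaust)
    obtain v' where v': "to_U v' = v" using mult of_U_inverse unfolding U_sl2_def by blast
    have "Q (cst a * (gf N1 * v') + cst b * (gf N2 * v') + cst c * (gh N1 * v'))"
      using mult v' by (intro add scale gf gh) simp_all
    then have "Q (gen x * v')" by (simp add: x gen_eq distrib_right mult.assoc)
    moreover have "env_in sl2_alg x \<otimes>\<^bsub>env_alg sl2_alg\<^esub> v = to_U (gen x * v')"
      using v' by (simp add: times_usl2.rep_eq to_U_gen U_sl2_def)
    ultimately show ?case by (simp add: to_U_inject)
  next
    case (scale c v)
    obtain v' where v': "to_U v' = v" using scale of_U_inverse unfolding U_sl2_def by blast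
    then have "c \<odot>\<^bsub>env_alg sl2_alg\<^esub> v = to_U (cst c * v')"
      by (simp add: to_U_cst_mult U_sl2_def)
    then show ?case using scale v' assms(4) by (simp add: to_U_inject)
  next
    case (add v w)
    obtain v' where v': "to_U v' = v" using add of_U_inverse unfolding U_sl2_def by blast
    obtain w' where w': "to_U w' = w" using add of_U_inverse unfolding U_sl2_def by blast
    have "v \<oplus>\<^bsub>env_alg sl2_alg\<^esub> w = to_U (v' + w')"
      using v' w' by (simp add: plus_usl2.rep_eq U_sl2_def)
    then show ?case using add v' w' assms(5) by (simp add: to_U_inject)
  qed
  then show ?thesis using to_U by blast
qed

section \<open>The Poincare--Birkhoff--Witt theorem for $sl_2$\<close>

text \<open>The choice of a representative is immaterial by \<open>free_op_cong\<close>, so this is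
  the induced action of U(sl_2).\<close>

definition usl2_op :: "node \<Rightarrow> usl2 \<Rightarrow> series \<Rightarrow> series" where
  "usl2_op i u = free_op i (SOME P. ucls P = u)"

lemma usl2_op_ucls: "usl2_op i (ucls P) = free_op i P"
  unfolding usl2_op_def by (rule free_op_cong) (metis (mono_tags, lifting) someI)

lemma usl2_op_add: "usl2_op i (u + v) \<phi> r t s = usl2_op i u \<phi> r t s + usl2_op i v \<phi> r t s"
  by (cases u rule: ucls_cases; cases v rule: ucls_cases)
    (simp add: usl2_op_ucls free_op_add flip: ucls_add)

lemma usl2_op_mult: "usl2_op i (u * v) \<phi> = usl2_op i u (usl2_op i v \<phi>)"
  by (cases u rule: ucls_cases; cases v rule: ucls_cases)
    (simp add: usl2_op_ucls free_op_mult flip: ucls_mult)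

lemma usl2_op_cst: "usl2_op i (cst c) \<phi> r t s = c * \<phi> r t s"
  by (simp add: cst_def usl2_op_ucls free_op_single word_op_def zero_list_def)

lemma usl2_op_one [simp]: "usl2_op i 1 \<phi> = \<phi>"
  using usl2_op_cst[of i 1] by (intro ext) simp

lemma usl2_op_zero [simp]: "usl2_op i 0 \<phi> r t s = 0"
  using usl2_op_cst[of i 0] by simp

lemma usl2_op_uminus: "usl2_op i (- u) \<phi> r t s = - usl2_op i u \<phi> r t s"
  using usl2_op_add[of i "- u" u \<phi> r t s] by (simp add: eq_neg_iff_add_eq_0)

lemma usl2_op_sum: "usl2_op i (\<Sum>z\<in>Z. f z) \<phi> r t s = (\<Sum>z\<in>Z. usl2_op i (f z) \<phi> r t s)"
  by (induction Z rule: infinite_finite_induct) (simp_all add: usl2_op_add)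

lemma usl2_op_gen: "usl2_op i (gen v) = sl2_op i v"
  by (intro ext) (simp add: gen_def usl2_op_ucls letter_def free_op_single word_op_def)

lemma usl2_op_gf: "usl2_op i (gf i) \<phi> r t s = (if s = 0 then 0 else \<phi> r (t - 1) (s - 1))
    + (of_nat (Suc r) * t - of_nat (\<Sum>k\<le>r. k)) * \<phi> (Suc r) t s"
  by (cases i) (simp_all add: gf_def usl2_op_gen sl2_op_def)

lemma usl2_op_gf_other: "usl2_op i (gf (other i)) \<phi> r t s = (if r = 0 then 0 else \<phi> (r - 1) t s)"
  by (cases i) (simp_all add: gf_def usl2_op_gen sl2_op_def)

lemma usl2_op_gh: "usl2_op i (gh i) \<phi> r t s = (t - of_nat r) * \<phi> r t s"
  by (cases i) (simp_all add: gh_def usl2_op_gen usl2_op_uminus sl2_op_def algebra_simps)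

text \<open>The normally ordered series of 1; applying u to it reads off the normally ordered
  coefficients of u.\<close>

definition unit_series :: series where
  "unit_series r t s = (if r = 0 \<and> s = 0 then 1 else 0)"

definition right_shift :: "series \<Rightarrow> series" where
  "right_shift \<phi> r t s = (if s = 0 then 0 else \<phi> r t (s - 1))"

text \<open>\<open>right_shift\<close> is right multiplication by x on series, and right
  multiplications commute with left ones.\<close>

lemma usl2_op_right_shift: "usl2_op i u (right_shift \<phi>) = right_shift (usl2_op i u \<phi>)"
proof -
  have op: "sl2_op i v (right_shift \<phi>) = right_shift (sl2_op i v \<phi>)" for v \<phi>
  proof (intro ext)
    fix r t s
    show "sl2_op i v (right_shift \<phi>) r t s = right_shift (sl2_op i v \<phi>) r t s"
      by (cases "sl2_coords i v"; cases s) (simp_all add: sl2_op_def right_shift_def)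
  qed
  have word: "word_op i w (right_shift \<phi>) = right_shift (word_op i w \<phi>)" for w
    by (induction w) (simp_all add: word_op_def op)
  obtain P where "u = ucls P" by (rule ucls_cases)
  then show ?thesis
    by (intro ext) (auto simp: usl2_op_ucls free_op_def word right_shift_def)
qed

lemma usl2_op_mult_gf: "usl2_op i (u * gf i) unit_series = right_shift (usl2_op i u unit_series)"
proof -
  have "usl2_op i (gf i) unit_series = right_shift unit_series"
    by (intro ext) (simp add: usl2_op_gf unit_series_def right_shift_def)
  then show ?thesis by (simp add: usl2_op_mult usl2_op_right_shift)
qed

fun pbw_monomial :: "node \<Rightarrow> nat \<times> nat \<times> nat \<Rightarrow> usl2" where
  "pbw_monomial i (a, b, d) = gf (other i) ^ a * (gh i ^ b * gf i ^ d)"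

definition pbw_sum :: "node \<Rightarrow> (nat \<times> nat \<times> nat \<Rightarrow>\<^sub>0 complex) \<Rightarrow> usl2" where
  "pbw_sum i P = (\<Sum>z\<in>Poly_Mapping.keys P. cst (Poly_Mapping.lookup P z) * pbw_monomial i z)"

lemma pbw_sum_add: "pbw_sum i (P + Q) = pbw_sum i P + pbw_sum i Q"
  unfolding pbw_sum_def
  by (rule setsum_keys_plus_distrib[where f = "\<lambda>z c. cst c * pbw_monomial i z"])
    (simp_all add: cst_add distrib_right)

lemma pbw_sum_single: "pbw_sum i (Poly_Mapping.single z c) = cst c * pbw_monomial i z"
  by (cases "c = 0") (simp_all add: pbw_sum_def)

text \<open>The span contains 1 and is stable under left multiplication by y, h and x, hence is
  everything. Stability is shown in this order because moving h past y leaves terms that begin with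
  y, and moving x inward leaves terms that begin with y or h.\<close>

lemma pbw_span: "u \<in> range (pbw_sum i)"
proof -
  let ?S = "range (pbw_sum i)"
  have add: "v + w \<in> ?S" if "v \<in> ?S" "w \<in> ?S" for v w
    using that by (auto simp flip: pbw_sum_add)
  have mono: "cst c * pbw_monomial i z \<in> ?S" for c z
    by (metis pbw_sum_single rangeI)
  have mono': "pbw_monomial i z \<in> ?S" for z
    using mono[of 1 z] by simp
  have lift: "\<forall>v\<in>?S. g * v \<in> ?S" if g: "\<And>z. g * pbw_monomial i z \<in> ?S"
    and cc: "\<And>c v. v \<in> ?S \<Longrightarrow> cst c * v \<in> ?S" for g
  proof
    fix v assume "v \<in> ?S"
    then obtain P where v: "v = pbw_sum i P" by blast
    show "g * v \<in> ?S" unfolding v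
    proof (induction P rule: poly_mapping_induct_single)
      case zero
      show ?case using mono[of 0] by (simp add: pbw_sum_def)
    next
      case (single z c)
      show ?case using cc[OF g, of c z] by (simp add: pbw_sum_single cst_left_commute)
    next
      case (add P R)
      then show ?case using \<open>\<And>v w. v \<in> ?S \<Longrightarrow> w \<in> ?S \<Longrightarrow> v + w \<in> ?S\<close>
        by (simp add: pbw_sum_add distrib_left)
    qed
  qed
  have scale: "cst c * v \<in> ?S" if "v \<in> ?S" for c v
  proof -
    from that obtain P where v: "v = pbw_sum i P" by blast
    show ?thesis unfolding v
    proof (induction P rule: poly_mapping_induct_single)
      case zero
      show ?case using mono[of 0] by (simp add: pbw_sum_def)
    next
      case (single z d)
      show ?case using mono[of "c * d" z] by (simp add: pbw_sum_single cst_mult mult.assoc)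
    next
      case (add P R)
      then show ?case using \<open>\<And>v w. v \<in> ?S \<Longrightarrow> w \<in> ?S \<Longrightarrow> v + w \<in> ?S\<close>
        by (simp add: pbw_sum_add distrib_left)
    qed
  qed
  have diff: "v - w \<in> ?S" if "v \<in> ?S" "w \<in> ?S" for v w
    using add[OF that(1) scale[OF that(2), of "-1"]] by (simp add: cst_uminus)
  let ?x = "gf i" and ?y = "gf (other i)" and ?h = "gh i"
  have y: "?y * v \<in> ?S" if "v \<in> ?S" for v
  proof -
    have "?y * pbw_monomial i z \<in> ?S" for z
      using mono'[of "(Suc (fst z), snd z)"] by (cases z) (simp add: mult.assoc)
    then show ?thesis using lift[of ?y] scale that by blast
  qed
  have h: "?h * v \<in> ?S" if "v \<in> ?S" for v
  proof -
    have "?h * (?y ^ a * (?h ^ b * ?x ^ d)) \<in> ?S" for a b d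
    proof (induction a)
      case 0
      then show ?case using mono'[of "(0, Suc b, d)"] by (simp add: mult.assoc)
    next
      case (Suc a)
      have "?h * (?y ^ Suc a * (?h ^ b * ?x ^ d))
          = ?y * (?h * (?y ^ a * (?h ^ b * ?x ^ d))) - ?y ^ Suc a * (?h ^ b * ?x ^ d)"
        by (simp add: mult.assoc gh_gf_other_left)
      then show ?case using diff[OF y[OF Suc] mono'[of "(Suc a, b, d)"]] by simp
    qed
    then have "?h * pbw_monomial i z \<in> ?S" for z by (cases z) simp
    then show ?thesis using lift[of ?h] scale that by blast
  qed
  have x: "?x * v \<in> ?S" if "v \<in> ?S" for v
  proof -
    \<comment> \<open>Here x h = h x - x trades one power of h for terms already known to lie in the
      span.\<close>
    have xh: "?x * (?h ^ b * ?x ^ d) \<in> ?S" for b d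
    proof (induction b)
      case 0
      then show ?case using mono'[of "(0, 0, Suc d)"] by simp
    next
      case (Suc b)
      have "?x * (?h ^ Suc b * ?x ^ d) = ?h * (?x * (?h ^ b * ?x ^ d)) - ?x * (?h ^ b * ?x ^ d)"
        by (simp add: mult.assoc gh_gf_left)
      then show ?case using diff[OF h[OF Suc] Suc] by simp
    qed
    have "?x * (?y ^ a * (?h ^ b * ?x ^ d)) \<in> ?S" for a b d
    proof (induction a)
      case 0
      then show ?case using xh by simp
    next
      case (Suc a)
      have "?x * (?y ^ Suc a * (?h ^ b * ?x ^ d))
          = ?y * (?x * (?y ^ a * (?h ^ b * ?x ^ d))) + ?h * (?y ^ a * (?h ^ b * ?x ^ d))"
        by (simp add: mult.assoc gf_gf_left add.commute)
      then show ?case using add[OF y[OF Suc] h[OF mono'[of "(a, b, d)"]]] by simp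
    qed
    then have "?x * pbw_monomial i z \<in> ?S" for z by (cases z) simp
    then show ?thesis using lift[of ?x] scale that by blast
  qed
  show ?thesis
  proof (induction u rule: usl2_induct)
    case one
    show ?case using mono'[of "(0, 0, 0)"] by simp
  next
    case (gf j v)
    then show ?case using x y by (cases i; cases j) auto
  next
    case (gh v)
    then have "cst (-1) * (?h * v) \<in> ?S" "?h * v \<in> ?S" using h scale by blast+
    then show ?case by (cases i) (simp_all add: gh_def cst_uminus)
  qed (use scale add in auto)
qed

text \<open>The factors act from right to left and arrive in normal order, so no correction appears:
  x^d moves the entry to s = d, h^b multiplies it by t^b while r is still 0, and y^a moves it to r =
  a.\<close>

lemma usl2_op_pbw_monomial:
  "usl2_op i (pbw_monomial i (a, b, d)) unit_series r t s = (if r = a \<and> s = d then t ^ b else 0)"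
proof -
  have x: "usl2_op i (gf i ^ d) unit_series = (\<lambda>r t s. if r = 0 \<and> s = d then 1 else 0)"
  proof (induction d)
    case 0
    then show ?case by (intro ext) (simp add: unit_series_def)
  next
    case (Suc d)
    show ?case
      unfolding power_Suc usl2_op_mult Suc
      by (intro ext) (auto simp: usl2_op_gf)
  qed
  have h: "usl2_op i (gh i ^ b * gf i ^ d) unit_series = (\<lambda>r t s. if r = 0 \<and> s = d then t ^ b else 0)"
  proof (induction b)
    case 0
    then show ?case by (simp add: x cong: if_cong)
  next
    case (Suc b)
    show ?case
      unfolding power_Suc mult.assoc usl2_op_mult Suc[unfolded usl2_op_mult]
      by (intro ext) (auto simp: usl2_op_gh)
  qed
  have "usl2_op i (gf (other i) ^ a * (gh i ^ b * gf i ^ d)) unit_series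
      = (\<lambda>r t s. if r = a \<and> s = d then t ^ b else 0)"
  proof (induction a)
    case 0
    then show ?case by (simp add: h)
  next
    case (Suc a)
    show ?case
      unfolding power_Suc mult.assoc usl2_op_mult Suc[unfolded usl2_op_mult]
      by (intro ext) (auto simp: usl2_op_gf_other)
  qed
  then show ?thesis by simp
qed

text \<open>Linear independence of the PBW monomials. For fixed outer exponents a and d, the value
  at (a,t,d) is a polynomial q in t whose coefficients are those of u; it vanishes at every complex
  t.\<close>

lemma usl2_op_faithful:
  assumes "\<And>r t s. usl2_op i u unit_series r t s = 0"
  shows "u = 0"
proof -
  obtain P where u: "u = pbw_sum i P" using pbw_span[of u i] by blast
  have "Poly_Mapping.lookup P (a, b, d) = 0" for a b d
  proof -
    let ?Z = "{z \<in> Poly_Mapping.keys P. fst z = a \<and> snd (snd z) = d}"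
    define q where "q = (\<Sum>z\<in>?Z. monom (Poly_Mapping.lookup P z) (fst (snd z)))"
    have "poly q t = 0" for t
    proof -
      have "poly q t = (\<Sum>z\<in>?Z. Poly_Mapping.lookup P z * t ^ fst (snd z))"
        by (simp add: q_def poly_sum poly_monom)
      also have "\<dots> = (\<Sum>z\<in>Poly_Mapping.keys P.
          if fst z = a \<and> snd (snd z) = d then Poly_Mapping.lookup P z * t ^ fst (snd z) else 0)"
        by (simp add: sum.inter_filter)
      also have "\<dots> = usl2_op i u unit_series a t d"
        unfolding u pbw_sum_def usl2_op_sum
      proof (rule sum.cong[OF HOL.refl])
        fix z :: "nat \<times> nat \<times> nat"
        obtain a' b' d' where z: "z = (a', b', d')" by (metis prod.exhaust)
        show "(if fst z = a \<and> snd (snd z) = d then Poly_Mapping.lookup P z * t ^ fst (snd z) else 0)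
          = usl2_op i (cst (Poly_Mapping.lookup P z) * pbw_monomial i z) unit_series a t d"
          unfolding z usl2_op_mult usl2_op_cst usl2_op_pbw_monomial by auto
      qed
      finally show ?thesis using assms by simp
    qed
    then have "q = 0" using poly_all_0_iff_0 by blast
    then have "coeff q b = 0" by simp
    moreover have "coeff q b = (\<Sum>z\<in>?Z. if z = (a, b, d) then Poly_Mapping.lookup P z else 0)"
      unfolding q_def coeff_sum by (rule sum.cong) auto
    ultimately show ?thesis by (simp add: in_keys_iff split: if_splits)
  qed
  then have "P = 0" by (intro poly_mapping_eqI) (simp add: split_paired_all)
  then show ?thesis by (simp add: u pbw_sum_def)
qed

text \<open>Right multiplication by x shifts the coefficient array in s, so every coefficient of u -
  v survives as a coefficient of the product.\<close>

lemma gf_right_cancel: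
  assumes "u * gf i = v * gf i"
  shows "u = v"
proof -
  have "(u - v) * gf i = 0" using assms by (simp add: left_diff_distrib)
  then have "right_shift (usl2_op i (u - v) unit_series) r t (Suc s) = 0" for r t s
    using usl2_op_mult_gf[of i "u - v"] by (metis usl2_op_zero)
  then have "u - v = 0" by (intro usl2_op_faithful[of i]) (simp add: right_shift_def)
  then show ?thesis by simp
qed

lemma gf_power_right_cancel: "u * gf i ^ n = v * gf i ^ n \<Longrightarrow> u = v"
  by (induction n) (auto simp: power_Suc2 dest: gf_right_cancel simp flip: mult.assoc simp del: power_Suc)

section \<open>Polynomial families in $U(sl_2)$\<close>

text \<open>Polynomial maps with coefficients in U(sl_2), as finite sums of terms a^k z. The
  inductive form turns closure properties and passage to coefficients into rule inductions.\<close>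

inductive poly_fun :: "(complex \<Rightarrow> usl2) \<Rightarrow> bool" where
  monomial: "poly_fun (\<lambda>a. cst (a ^ k) * z)"
| sum: "poly_fun f \<Longrightarrow> poly_fun g \<Longrightarrow> poly_fun (\<lambda>a. f a + g a)"

lemma poly_fun_const: "poly_fun (\<lambda>a. z)"
  using poly_fun.monomial[of 0 z] by simp

lemma poly_fun_cst: "poly_fun cst"
  using poly_fun.monomial[of 1 1] by simp

lemma poly_fun_mult:
  assumes "poly_fun f" "poly_fun g"
  shows "poly_fun (\<lambda>a. f a * g a)"
  using assms(1)
proof (induction rule: poly_fun.induct)
  case (monomial k z)
  show ?case
    using assms(2)
  proof (induction rule: poly_fun.induct)
    case (monomial l z')
    show ?case
      using poly_fun.monomial[of "k + l" "z * z'"]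
      by (simp add: power_add cst_mult mult.assoc cst_left_commute[of z])
  next
    case (sum f g)
    then show ?case by (simp add: distrib_left poly_fun.sum)
  qed
next
  case (sum f g)
  then show ?case by (simp add: distrib_right poly_fun.sum)
qed

lemma poly_fun_uminus: "poly_fun f \<Longrightarrow> poly_fun (\<lambda>a. - f a)"
  using poly_fun_mult[OF poly_fun_const[of "-1"], of f] by simp

lemma poly_fun_diff: "poly_fun f \<Longrightarrow> poly_fun g \<Longrightarrow> poly_fun (\<lambda>a. f a - g a)"
  using poly_fun.sum[OF _ poly_fun_uminus, of f g] by simp

lemma poly_fun_sum: "(\<And>k. k \<in> S \<Longrightarrow> poly_fun (f k)) \<Longrightarrow> poly_fun (\<lambda>a. \<Sum>k\<in>S. f k a)"
  by (induction S rule: infinite_finite_induct) (simp_all add: poly_fun_const poly_fun.sum)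

lemma poly_fun_prod_list:
  "(\<And>v. v \<in> set vs \<Longrightarrow> poly_fun (f v)) \<Longrightarrow> poly_fun (\<lambda>a. prod_list (map (\<lambda>v. f v a) vs))"
  by (induction vs) (simp_all add: poly_fun_const poly_fun_mult)

lemma poly_fun_gchoose: "poly_fun (\<lambda>a. cst (a gchoose k))"
proof -
  have "poly_fun (\<lambda>a. cst (\<Prod>i<k. a - of_nat i))"
  proof (induction k)
    case 0
    show ?case by (simp add: poly_fun_const)
  next
    case (Suc k)
    then show ?case
      by (simp add: cst_mult cst_diff poly_fun_mult poly_fun_diff poly_fun_const poly_fun_cst)
  qed
  then have "poly_fun (\<lambda>a. cst (\<Prod>i<k. a - of_nat i) * cst (1 / fact k))"
    by (intro poly_fun_mult poly_fun_const)
  then show ?thesis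
    by (simp add: gbinomial_prod_rev lessThan_atLeast0 flip: cst_mult)
qed

text \<open>Each coefficient of p(a) in the faithful action is an ordinary polynomial in a that
  vanishes at all large naturals.\<close>

lemma poly_fun_eq_zero:
  assumes p: "poly_fun p" and zero: "\<And>N. N \<ge> N0 \<Longrightarrow> p (of_nat N) = 0"
  shows "p a = 0"
proof (rule usl2_op_faithful[of N1])
  fix r t s
  from p have "\<exists>q. \<forall>a. usl2_op N1 (p a) unit_series r t s = poly q a"
  proof (induction rule: poly_fun.induct)
    case (monomial k z)
    show ?case
      by (rule exI[of _ "monom (usl2_op N1 z unit_series r t s) k"])
        (simp add: usl2_op_mult usl2_op_cst poly_monom)
  next
    case (sum f g)
    then obtain q q' where "\<forall>a. usl2_op N1 (f a) unit_series r t s = poly q a"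
      "\<forall>a. usl2_op N1 (g a) unit_series r t s = poly q' a" by blast
    then show ?case by (intro exI[of _ "q + q'"]) (simp add: usl2_op_add)
  qed
  then obtain q where q: "\<And>a. usl2_op N1 (p a) unit_series r t s = poly q a" by blast
  have "of_nat ` {N0..} \<subseteq> {x. poly q x = 0}"
    using zero by (auto simp flip: q)
  moreover have "infinite ((of_nat :: nat \<Rightarrow> complex) ` {N0..})"
    by (simp add: finite_image_iff inj_on_def infinite_Ici)
  ultimately have "q = 0" using poly_roots_finite finite_subset by blast
  then show "usl2_op N1 (p a) unit_series r t s = 0" by (simp add: q)
qed

section \<open>Conjugation by complex powers in $U(sl_2)$\<close>

definition Jt :: "complex \<Rightarrow> usl2" where
  "Jt u = gf N2 * gf N1 + cst u * gh N1 - cst (u * (u - 1) / 2)"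

text \<open>Heuristically $K_v = x^v y x^{1-v}$ for $x = f_i$ and $y$ the other generator.\<close>

definition Kt :: "node \<Rightarrow> complex \<Rightarrow> usl2" where
  "Kt i v = gf (other i) * gf i + cst v * gh i - cst (v * (v - 1) / 2)"

lemma Kt_N1: "Kt N1 v = Jt v"
  by (simp add: Kt_def Jt_def)

text \<open>Passing from f_1 f_2 to f_2 f_1 adds h, which turns -v h into (1-v) h; the constant
  v(v-1)/2 is invariant under v -> 1-v.\<close>

lemma Kt_N2: "Kt N2 v = Jt (1 - v)"
proof -
  have "(1 - v) * (1 - v - 1) / 2 = v * (v - 1) / 2" by (simp add: algebra_simps)
  moreover have "gf N1 * gf N2 = gh N1 + gf N2 * gf N1" using gf_gf[of N1] by simp
  ultimately show ?thesis
    using gh_other[of N1] by (simp add: Kt_def Jt_def cst_diff algebra_simps)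
qed

text \<open>This explains the constant in K_v: moving x past v h produces -v x, and v(v-1)/2 + v =
  (v+1)v/2 absorbs it.\<close>

lemma gf_Kt: "gf i * Kt i v = Kt i (v + 1) * gf i"
proof -
  have c: "cst ((v + 1) * (v + 1 - 1) / 2) = cst (v * (v - 1) / 2) + cst v"
    by (simp add: field_simps flip: cst_add)
  have "gf i * gh i = gh i * gf i - gf i" by (simp add: gh_gf)
  then show ?thesis
    unfolding Kt_def c
    by (simp add: cst_add distrib_left distrib_right left_diff_distrib right_diff_distrib
        gf_gf_left cst_left_commute[of "gf i"] cst_commute[of "gf i"] mult.assoc)
qed

lemma gf_gf_Kt: "gf i * gf (other i) = Kt i 1"
  by (simp add: Kt_def gf_gf)

lemma gf_power_Kt: "gf i ^ N * Kt i v = Kt i (v + of_nat N) * gf i ^ N"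
proof (induction N)
  case (Suc N)
  have "gf i ^ Suc N * Kt i v = gf i * Kt i (v + of_nat N) * gf i ^ N"
    using Suc by (simp add: mult.assoc)
  then show ?case by (simp add: gf_Kt mult.assoc add_ac)
qed simp

lemma gf_power_prod_Kt:
  "gf i ^ N * prod_list (map (Kt i) vs) = prod_list (map (\<lambda>v. Kt i (v + of_nat N)) vs) * gf i ^ N"
proof (induction vs)
  case (Cons v vs)
  have "gf i ^ N * prod_list (map (Kt i) (v # vs))
      = Kt i (v + of_nat N) * (gf i ^ N * prod_list (map (Kt i) vs))"
    by (simp add: gf_power_Kt flip: mult.assoc)
  then show ?case by (simp add: Cons mult.assoc)
qed simp

lemma gf_power_gf_other: "gf i ^ Suc n * gf (other i) = Kt i (of_nat (Suc n)) * gf i ^ n"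
proof -
  have "gf i ^ Suc n * gf (other i) = gf i ^ n * Kt i 1"
    by (simp only: power_Suc2 mult.assoc gf_gf_Kt)
  then show ?thesis by (simp add: gf_power_Kt)
qed

text \<open>The factors y are absorbed one at a time: the one numbered k, from 0, meets x^(N-k),
  uses up one x and leaves K_(N-k). The bound on \<open>M\<close> supplies an x for each y.\<close>

lemma gf_power_gf_other_power:
  "M \<le> N \<Longrightarrow> gf i ^ N * gf (other i) ^ M
    = prod_list (map (\<lambda>k. Kt i (of_nat N - of_nat k)) [0..<M]) * gf i ^ (N - M)"
proof (induction M)
  case (Suc M)
  then have NM: "N - M = Suc (N - Suc M)" and MN: "M \<le> N" by simp_all
  have N: "of_nat (Suc (N - Suc M)) = (of_nat N - of_nat M :: complex)"
    using Suc.prems by (metis NM Suc_leD of_nat_diff)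
  have "gf i ^ N * gf (other i) ^ Suc M = gf i ^ N * gf (other i) ^ M * gf (other i)"
    by (simp only: power_Suc2 mult.assoc)
  also have "\<dots> = prod_list (map (\<lambda>k. Kt i (of_nat N - of_nat k)) [0..<M])
      * (gf i ^ Suc (N - Suc M) * gf (other i))"
    unfolding Suc.IH[OF MN] NM mult.assoc ..
  also have "\<dots> = prod_list (map (\<lambda>k. Kt i (of_nat N - of_nat k)) [0..<Suc M]) * gf i ^ (N - Suc M)"
    unfolding gf_power_gf_other N by (simp add: mult.assoc)
  finally show ?case .
qed simp

section \<open>From natural to complex exponents\<close>

definition adt :: "node \<Rightarrow> usl2 \<Rightarrow> usl2" where
  "adt i u = gf i * u - u * gf i"

text \<open>The binomial theorem: left multiplication by x is the sum of two commuting operators, ad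
  x and right multiplication by x.\<close>

lemma gf_power_mult:
  "gf i ^ N * u = (\<Sum>k\<le>N. of_nat (N choose k) * ((adt i ^^ k) u * gf i ^ (N - k)))"
proof (induction N)
  case (Suc N)
  let ?t = "\<lambda>k. (adt i ^^ k) u"
  have D: "gf i * v = adt i v + v * gf i" for v by (simp add: adt_def)
  have step: "gf i * (of_nat c * (?t k * gf i ^ n))
      = of_nat c * (?t (Suc k) * gf i ^ n) + of_nat c * (?t k * gf i ^ Suc n)" for c k n
  proof -
    have "gf i * (of_nat c * (?t k * gf i ^ n)) = of_nat c * ((gf i * ?t k) * gf i ^ n)"
      by (metis mult.assoc mult_of_nat_commute)
    then show ?thesis by (simp add: D distrib_left distrib_right mult.assoc)
  qed
  have "gf i ^ Suc N * u = gf i * (gf i ^ N * u)" by (simp add: mult.assoc)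
  also have "\<dots> = (\<Sum>k\<le>N. of_nat (N choose k) * (?t (Suc k) * gf i ^ (N - k)))
      + (\<Sum>k\<le>N. of_nat (N choose k) * (?t k * gf i ^ Suc (N - k)))"
    by (simp only: Suc sum_distrib_left step sum.distrib)
  \<comment> \<open>The extra index \<open>Suc N\<close> has binomial coefficient zero. Splitting
    off k = 0 afterwards aligns the two sums for Pascal's rule.\<close>
  also have "(\<Sum>k\<le>N. of_nat (N choose k) * (?t k * gf i ^ Suc (N - k)))
      = (\<Sum>k\<le>Suc N. of_nat (N choose k) * (?t k * gf i ^ (Suc N - k)))"
    by (simp add: Suc_diff_le binomial_eq_0)
  also have "\<dots> = u * gf i ^ Suc N + (\<Sum>k\<le>N. of_nat (N choose Suc k) * (?t (Suc k) * gf i ^ (N - k)))"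
    by (subst sum.atMost_Suc_shift) simp
  also have "(\<Sum>k\<le>N. of_nat (N choose k) * (?t (Suc k) * gf i ^ (N - k))) + \<dots>
      = u * gf i ^ Suc N + (\<Sum>k\<le>N. of_nat (Suc N choose Suc k) * (?t (Suc k) * gf i ^ (N - k)))"
    by (simp add: sum.distrib distrib_right)
  also have "\<dots> = (\<Sum>k\<le>Suc N. of_nat (Suc N choose k) * (?t k * gf i ^ (Suc N - k)))"
    by (subst sum.atMost_Suc_shift) simp
  finally show ?case .
qed simp

text \<open>Both sides are polynomial in \<open>a\<close> and agree for large natural \<open>a\<close>, where the left-hand sum is
  an honest product.\<close>

lemma complex_power_usl2:
  fixes a :: complex
  assumes S: "finite S" "\<And>k. k \<in> S \<Longrightarrow> k \<le> L" "\<And>k. k \<notin> S \<Longrightarrow> (adt i ^^ k) Y = 0"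
    and Y: "Y = prod_list (map (Kt i) vs) * gf (other i) ^ M"
    and L: "M + C \<le> L"
    and X: "X * gf i ^ C = (\<Sum>k\<in>S. cst (a gchoose k) * (adt i ^^ k) Y * gf i ^ (L - k))"
  shows "X = prod_list (map (\<lambda>v. Kt i (v + a)) vs)
    * prod_list (map (\<lambda>k. Kt i (a - of_nat k)) [0..<M]) * gf i ^ (L - C - M)"
proof -
  define Z where "Z a = prod_list (map (\<lambda>v. Kt i (v + a)) vs)
    * prod_list (map (\<lambda>k. Kt i (a - of_nat k)) [0..<M])" for a
  define p where "p a = (\<Sum>k\<in>S. cst (a gchoose k) * (adt i ^^ k) Y * gf i ^ (L - k))
    - Z a * gf i ^ (L - M)" for a
  have Kt_poly: "poly_fun (\<lambda>a. Kt i (a + c))" for c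
  proof -
    \<comment> \<open>The division is rewritten as a product with a fixed scalar, so that the
      closure rules of \<open>poly_fun\<close> apply.\<close>
    have half: "cst (v * w / 2) = cst v * cst w * cst (1/2)" for v w by (simp flip: cst_mult)
    show ?thesis
      unfolding Kt_def half
      by (simp only: cst_add cst_diff)
        (intro poly_fun.sum poly_fun_diff poly_fun_mult poly_fun_const poly_fun_cst)
  qed
  have "poly_fun Z"
    unfolding Z_def using Kt_poly Kt_poly[of "- of_nat k" for k]
    by (intro poly_fun_mult poly_fun_prod_list) (simp_all add: add.commute)
  then have "poly_fun p"
    unfolding p_def
    by (intro poly_fun_diff poly_fun_sum poly_fun_mult poly_fun_gchoose poly_fun_const)
  moreover have "p (of_nat N) = 0" if N: "N \<ge> L" for N
  proof -
    \<comment> \<open>The factor x^(N-L) raises the exponents L-k to the N-k of the binomial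
      expansion; it is cancelled at the end.\<close>
    have "(\<Sum>k\<in>S. cst (of_nat N gchoose k) * (adt i ^^ k) Y * gf i ^ (L - k)) * gf i ^ (N - L)
        = (\<Sum>k\<in>S. of_nat (N choose k) * ((adt i ^^ k) Y * gf i ^ (N - k)))"
      unfolding sum_distrib_right
    proof (rule sum.cong[OF HOL.refl])
      fix k assume "k \<in> S"
      then have "N - k = (L - k) + (N - L)" using S(2) N by fastforce
      then show "cst (of_nat N gchoose k) * (adt i ^^ k) Y * gf i ^ (L - k) * gf i ^ (N - L)
          = of_nat (N choose k) * ((adt i ^^ k) Y * gf i ^ (N - k))"
        by (simp add: power_add mult.assoc cst_of_nat flip: binomial_gbinomial)
    qed
    \<comment> \<open>Indices outside \<open>S\<close> contribute zero, and those in
      \<open>S\<close> are at most \<open>L\<close>, hence at most \<open>N\<close>.\<close>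
    also have "\<dots> = (\<Sum>k\<le>N. of_nat (N choose k) * ((adt i ^^ k) Y * gf i ^ (N - k)))"
      using S N by (intro sum.mono_neutral_left) force+
    also have "\<dots> = gf i ^ N * Y" by (simp add: gf_power_mult)
    also have "\<dots> = prod_list (map (\<lambda>v. Kt i (v + of_nat N)) vs) * (gf i ^ N * gf (other i) ^ M)"
      unfolding Y mult.assoc[symmetric] gf_power_prod_Kt ..
    also have "\<dots> = Z (of_nat N) * gf i ^ (N - M)"
      using N L by (simp add: gf_power_gf_other_power Z_def mult.assoc)
    also have "gf i ^ (N - M) = gf i ^ (L - M) * gf i ^ (N - L)"
      using N L by (simp flip: power_add)
    finally have "p (of_nat N) * gf i ^ (N - L) = 0 * gf i ^ (N - L)"
      by (simp add: p_def left_diff_distrib mult.assoc)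
    then show ?thesis by (rule gf_power_right_cancel)
  qed
  ultimately have "p a = 0" by (rule poly_fun_eq_zero)
  moreover have "L - M = (L - C - M) + C" using L by simp
  ultimately have "X * gf i ^ C = Z a * gf i ^ (L - C - M) * gf i ^ C"
    unfolding X p_def by (simp add: power_add mult.assoc)
  then show ?thesis unfolding Z_def by (rule gf_power_right_cancel)
qed

section \<open>Sums of right fractions\<close>

locale ore_denominator = ring R for R (structure) +
  fixes f
  assumes f_closed [simp, intro]: "f \<in> carrier R"
begin

lemma f_pow_closed [simp, intro]: "f [^] (n::nat) \<in> carrier R"
  by simp

lemma f_pow_mult: "x \<in> carrier R \<Longrightarrow> x \<otimes> f [^] (n::nat) \<otimes> f [^] (k::nat) = x \<otimes> f [^] (n + k)"
  by (simp add: m_assoc nat_pow_mult)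

lemma ore_rel_iff: "((x, n), (y, k)) \<in> ore_rel R f \<longleftrightarrow> x \<in> carrier R \<and> y \<in> carrier R \<and>
    (\<exists>N. x \<otimes> f [^] (k + N) = y \<otimes> f [^] (n + N))"
  by (simp add: ore_rel_def)

lemma ore_rel_refl: "x \<in> carrier R \<Longrightarrow> ((x, n), (x, n)) \<in> ore_rel R f"
  by (auto simp: ore_rel_iff)

lemma ore_rel_sym: "(u, v) \<in> ore_rel R f \<Longrightarrow> (v, u) \<in> ore_rel R f"
  by (cases u; cases v) (auto simp: ore_rel_iff intro: HOL.sym)

lemma ore_rel_trans:
  assumes "(u, v) \<in> ore_rel R f" "(v, w) \<in> ore_rel R f"
  shows "(u, w) \<in> ore_rel R f"
proof -
  obtain x n y k z l where e: "u = (x, n)" "v = (y, k)" "w = (z, l)" by (metis prod.exhaust)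
  from assms obtain N M where c: "x \<in> carrier R" "y \<in> carrier R" "z \<in> carrier R"
    and N: "x \<otimes> f [^] (k + N) = y \<otimes> f [^] (n + N)"
    and M: "y \<otimes> f [^] (l + M) = z \<otimes> f [^] (k + M)"
    unfolding e ore_rel_iff by blast
  have "x \<otimes> f [^] (l + (k + N + M)) = x \<otimes> f [^] (k + N) \<otimes> f [^] (l + M)"
    using c by (simp add: f_pow_mult add_ac)
  also have "\<dots> = y \<otimes> f [^] (l + M) \<otimes> f [^] (n + N)"
    unfolding N using c by (simp add: f_pow_mult add_ac)
  also have "\<dots> = z \<otimes> f [^] (n + (k + N + M))"
    unfolding M using c by (simp add: f_pow_mult add_ac)
  finally show ?thesis using c unfolding e ore_rel_iff by blast
qed

lemma ore_class_eq_iff: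
  assumes "x \<in> carrier R" "y \<in> carrier R"
  shows "ore_class R f (x, n) = ore_class R f (y, k) \<longleftrightarrow> ((x, n), (y, k)) \<in> ore_rel R f"
proof
  assume "ore_class R f (x, n) = ore_class R f (y, k)"
  then show "((x, n), (y, k)) \<in> ore_rel R f"
    using ore_rel_refl[OF assms(2)] by (auto simp: ore_class_def)
next
  assume "((x, n), (y, k)) \<in> ore_rel R f"
  then show "ore_class R f (x, n) = ore_class R f (y, k)"
    unfolding ore_class_def using ore_rel_trans ore_rel_sym by blast
qed

lemma ore_class_scale:
  "x \<in> carrier R \<Longrightarrow> ore_class R f (x \<otimes> f [^] (j::nat), n + j) = ore_class R f (x, n)"
  by (subst ore_class_eq_iff) (auto simp: ore_rel_iff f_pow_mult intro!: exI[of _ 0] simp: add_ac)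

lemma ore_class_common:
  assumes "((x, n), (x', n')) \<in> ore_rel R f"
  obtains j j' where "x \<otimes> f [^] (j::nat) = x' \<otimes> f [^] (j'::nat)" "n + j = n' + j'"
proof -
  from assms obtain N where "x \<otimes> f [^] (n' + N) = x' \<otimes> f [^] (n + N)"
    unfolding ore_rel_iff by blast
  then show ?thesis by (intro that[of "n' + N" "n + N"]) simp_all
qed

lemma ore_loc_carrier: "carrier (ore_loc R f) = {ore_class R f (x, n) | x n. x \<in> carrier R}"
  by (auto simp: ore_loc_def quotient_def ore_class_def)

lemma ore_add_scale:
  assumes "x \<in> carrier R" "y \<in> carrier R"
  shows "ore_class R f (x \<otimes> f [^] (j::nat) \<otimes> f [^] k \<oplus> y \<otimes> f [^] (n + j), n + j + k)
    = ore_class R f (x \<otimes> f [^] k \<oplus> y \<otimes> f [^] (n::nat), n + (k::nat))"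
proof -
  have "x \<otimes> f [^] j \<otimes> f [^] k \<oplus> y \<otimes> f [^] (n + j) = (x \<otimes> f [^] k \<oplus> y \<otimes> f [^] n) \<otimes> f [^] j"
    using assms by (simp add: l_distr f_pow_mult add.commute)
  moreover have "n + j + k = n + k + j" by simp
  ultimately show ?thesis using assms by (simp only: ore_class_scale m_closed a_closed f_pow_closed)
qed

text \<open>One summand is replaced at a time, by scaling both of its representatives to a common
  form; commutativity reduces the second replacement to the first.\<close>

lemma ore_add_cong:
  assumes x: "((x, n), (x', n')) \<in> ore_rel R f" and y: "((y, k), (y', k')) \<in> ore_rel R f"
  shows "ore_class R f (x \<otimes> f [^] k \<oplus> y \<otimes> f [^] n, n + k)
    = ore_class R f (x' \<otimes> f [^] k' \<oplus> y' \<otimes> f [^] n', n' + k')"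
proof -
  have c: "x \<in> carrier R" "x' \<in> carrier R" "y \<in> carrier R" "y' \<in> carrier R"
    using x y by (auto simp: ore_rel_iff)
  have 1: "ore_class R f (x \<otimes> f [^] k \<oplus> y \<otimes> f [^] n, n + k)
      = ore_class R f (x' \<otimes> f [^] k \<oplus> y \<otimes> f [^] n', n' + k)"
    if "((x, n), (x', n')) \<in> ore_rel R f" "x \<in> carrier R" "x' \<in> carrier R" "y \<in> carrier R"
    for x n x' n' y k
  proof -
    from that(1) obtain j j' where j: "x \<otimes> f [^] (j::nat) = x' \<otimes> f [^] (j'::nat)" "n + j = n' + j'"
      by (rule ore_class_common)
    show ?thesis
      using ore_add_scale[of x y j k n] ore_add_scale[of x' y j' k n'] j that by simp
  qed
  have 2: "ore_class R f (x \<otimes> f [^] k \<oplus> y \<otimes> f [^] n, n + k)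
      = ore_class R f (y \<otimes> f [^] n \<oplus> x \<otimes> f [^] k, k + n)"
    if "x \<in> carrier R" "y \<in> carrier R" for x y n k
    using that by (simp add: a_comm add.commute)
  show ?thesis
    using 1[OF x c(1,2,3)] 1[OF y c(3,4,2)] 2[OF c(2,3)] 2[OF c(2,4)] by simp
qed

text \<open>The sum is defined as a union over all representatives; by \<open>ore_add_cong\<close>
  they all yield the same class, so the union is that class.\<close>

lemma ore_add_class:
  assumes "x \<in> carrier R" "y \<in> carrier R"
  shows "ore_class R f (x, n) \<oplus>\<^bsub>ore_loc R f\<^esub> ore_class R f (y, k)
    = ore_class R f (x \<otimes> f [^] k \<oplus> y \<otimes> f [^] n, n + k)"
proof -
  let ?C = "ore_class R f (x \<otimes> f [^] k \<oplus> y \<otimes> f [^] n, n + k)"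
  let ?T = "{ore_class R f (x' \<otimes> f [^] k' \<oplus> y' \<otimes> f [^] n', n' + k') | x' n' y' k'.
        (x', n') \<in> ore_class R f (x, n) \<and> (y', k') \<in> ore_class R f (y, k)}"
  have mem: "u \<in> ore_class R f v \<longleftrightarrow> (v, u) \<in> ore_rel R f" for u v by (simp add: ore_class_def)
  have "?T \<subseteq> {?C}"
  proof
    fix X assume "X \<in> ?T"
    then obtain x' n' y' k' where "X = ore_class R f (x' \<otimes> f [^] k' \<oplus> y' \<otimes> f [^] n', n' + k')"
      "((x, n), (x', n')) \<in> ore_rel R f" "((y, k), (y', k')) \<in> ore_rel R f"
      unfolding mem by blast
    then show "X \<in> {?C}" using ore_add_cong by simp
  qed
  moreover have "?C \<in> ?T"
    using ore_rel_refl assms by (force simp: ore_class_def)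
  ultimately have "?T = {?C}" by blast
  then have "\<Union>?T = ?C" by simp
  then show ?thesis by (simp add: ore_loc_def)
qed

lemma ore_add_class_same:
  assumes "x \<in> carrier R" "y \<in> carrier R"
  shows "ore_class R f (x, n) \<oplus>\<^bsub>ore_loc R f\<^esub> ore_class R f (y, n) = ore_class R f (x \<oplus> y, n)"
  using ore_class_scale[of "x \<oplus> y" n n] assms by (simp add: ore_add_class l_distr)

lemma ore_zero: "\<zero>\<^bsub>ore_loc R f\<^esub> = ore_class R f (\<zero>, n)"
  using ore_class_scale[of \<zero> n 0] by (simp add: ore_loc_def)

lemma ore_common_denominator:
  assumes "X \<in> carrier (ore_loc R f)" "Y \<in> carrier (ore_loc R f)"
  obtains x y n where "x \<in> carrier R" "y \<in> carrier R"
    "X = ore_class R f (x, n)" "Y = ore_class R f (y, n)"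
proof -
  from assms obtain x n y k where c: "x \<in> carrier R" "y \<in> carrier R"
    and X: "X = ore_class R f (x, n)" and Y: "Y = ore_class R f (y, k)"
    unfolding ore_loc_carrier by blast
  show ?thesis
    by (rule that[of "x \<otimes> f [^] k" "y \<otimes> f [^] n" "n + k"])
      (use c X Y ore_class_scale[OF c(1), of k n] ore_class_scale[OF c(2), of n k] in
        \<open>simp_all add: add.commute\<close>)
qed

text \<open>These laws make \<open>finsum\<close> in the localization usable. Over a common
  denominator they are the laws of the ring itself.\<close>

lemma abelian_monoid_ore_loc: "abelian_monoid (ore_loc R f)"
proof (rule abelian_monoidI)
  fix X Y assume XY: "X \<in> carrier (ore_loc R f)" "Y \<in> carrier (ore_loc R f)"
  then obtain x y n where c: "x \<in> carrier R" "y \<in> carrier R"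
    "X = ore_class R f (x, n)" "Y = ore_class R f (y, n)"
    by (rule ore_common_denominator)
  then show "X \<oplus>\<^bsub>ore_loc R f\<^esub> Y \<in> carrier (ore_loc R f)"
    by (auto simp: ore_add_class_same ore_loc_carrier)
  show "X \<oplus>\<^bsub>ore_loc R f\<^esub> Y = Y \<oplus>\<^bsub>ore_loc R f\<^esub> X"
    using c by (simp add: ore_add_class_same a_comm)
  show "\<zero>\<^bsub>ore_loc R f\<^esub> \<oplus>\<^bsub>ore_loc R f\<^esub> X = X"
    using c by (simp add: ore_zero[of n] ore_add_class_same)
  fix Z assume "Z \<in> carrier (ore_loc R f)"
  then obtain z k where z: "z \<in> carrier R" "Z = ore_class R f (z, k)"
    unfolding ore_loc_carrier by blast
  have X: "X = ore_class R f (x \<otimes> f [^] k, n + k)" and Y: "Y = ore_class R f (y \<otimes> f [^] k, n + k)"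
    and Z: "Z = ore_class R f (z \<otimes> f [^] n, n + k)"
    using ore_class_scale[of x k n] ore_class_scale[of y k n] ore_class_scale[of z n k] c z
    by (simp_all add: add.commute)
  show "X \<oplus>\<^bsub>ore_loc R f\<^esub> Y \<oplus>\<^bsub>ore_loc R f\<^esub> Z = X \<oplus>\<^bsub>ore_loc R f\<^esub> (Y \<oplus>\<^bsub>ore_loc R f\<^esub> Z)"
    unfolding X Y Z using c z by (simp add: ore_add_class_same a_assoc)
next
  show "\<zero>\<^bsub>ore_loc R f\<^esub> \<in> carrier (ore_loc R f)"
    by (auto simp: ore_zero[of 0] ore_loc_carrier)
qed

lemma ore_frac_eq:
  assumes "x \<in> carrier R" "0 \<le> s + int K"
  shows "ore_frac R f x s = ore_class R f (x \<otimes> f [^] nat (s + int K), K)"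
proof -
  have "nat s + K = nat (s + int K) + nat (- s)" using assms(2) by linarith
  then show ?thesis
    unfolding ore_frac_def using assms
    by (subst ore_class_eq_iff)
      (auto simp: ore_rel_iff f_pow_mult simp del: pow_nat intro!: exI[of _ 0])
qed

lemma finsum_ore_frac:
  assumes "finite S" and "\<And>i. i \<in> S \<Longrightarrow> x i \<in> carrier R" and "\<And>i. i \<in> S \<Longrightarrow> 0 \<le> s i + int K"
  shows "(\<Oplus>\<^bsub>ore_loc R f\<^esub> i \<in> S. ore_frac R f (x i) (s i))
    = ore_class R f (\<Oplus> i \<in> S. x i \<otimes> f [^] nat (s i + int K), K)"
  using assms
proof (induction S rule: finite_induct)
  interpret L: abelian_monoid "ore_loc R f" by (rule abelian_monoid_ore_loc)
  case empty
  show ?case by (simp add: ore_zero)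
next
  interpret L: abelian_monoid "ore_loc R f" by (rule abelian_monoid_ore_loc)
  case (insert j S)
  have fr: "ore_frac R f (x i) (s i) \<in> carrier (ore_loc R f)" if "i \<in> insert j S" for i
  proof -
    have "ore_frac R f (x i) (s i) = ore_class R f (x i \<otimes> f [^] nat (s i + int K), K)"
      "x i \<otimes> f [^] nat (s i + int K) \<in> carrier R"
      using that insert.prems by (auto intro!: ore_frac_eq m_closed simp del: pow_nat)
    then show ?thesis unfolding ore_loc_carrier by blast
  qed
  have sum: "(\<Oplus> i \<in> S. x i \<otimes> f [^] nat (s i + int K)) \<in> carrier R"
    using insert.prems by (intro finsum_closed) (auto simp del: pow_nat)
  have "(\<Oplus>\<^bsub>ore_loc R f\<^esub> i \<in> insert j S. ore_frac R f (x i) (s i))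
      = ore_class R f (x j \<otimes> f [^] nat (s j + int K), K)
        \<oplus>\<^bsub>ore_loc R f\<^esub> ore_class R f (\<Oplus> i \<in> S. x i \<otimes> f [^] nat (s i + int K), K)"
  proof -
    have "(\<Oplus>\<^bsub>ore_loc R f\<^esub> i \<in> insert j S. ore_frac R f (x i) (s i))
        = ore_frac R f (x j) (s j) \<oplus>\<^bsub>ore_loc R f\<^esub> (\<Oplus>\<^bsub>ore_loc R f\<^esub> i \<in> S. ore_frac R f (x i) (s i))"
      using insert.hyps fr by (intro L.finsum_insert) auto
    then show ?thesis
      using insert by (simp add: ore_frac_eq[of "x j" "s j" K] del: pow_nat)
  qed
  also have "\<dots> = ore_class R f (\<Oplus> i \<in> insert j S. x i \<otimes> f [^] nat (s i + int K), K)"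
    using insert.hyps insert.prems sum by (subst ore_add_class_same) (auto simp: finsum_insert simp del: pow_nat)
  finally show ?case .
qed

text \<open>Equality of fractions is equality after a further right factor f^N; merging
  \<open>N\<close> with the common denominator leaves an identity in the ring, to which a
  homomorphism can be applied.\<close>

lemma ore_in_eq_finsum:
  assumes "finite S" and "\<And>i. i \<in> S \<Longrightarrow> x i \<in> carrier R" and "\<And>i. i \<in> S \<Longrightarrow> 0 \<le> s i + int K"
    and X: "X \<in> carrier R"
    and eq: "ore_in R f X = (\<Oplus>\<^bsub>ore_loc R f\<^esub> i \<in> S. ore_frac R f (x i) (s i))"
  obtains N where "X \<otimes> f [^] (K + N) = (\<Oplus> i \<in> S. x i \<otimes> f [^] nat (s i + int (K + N)))"
proof -
  have sum: "(\<Oplus> i \<in> S. x i \<otimes> f [^] nat (s i + int K)) \<in> carrier R"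
    using assms(2) by (intro finsum_closed) (auto simp del: pow_nat)
  from eq have "ore_class R f (X, 0) = ore_class R f (\<Oplus> i \<in> S. x i \<otimes> f [^] nat (s i + int K), K)"
    using finsum_ore_frac[where x = x and s = s, OF assms(1-3)] by (simp add: ore_in_def)
  then obtain N where "X \<otimes> f [^] (K + N) = (\<Oplus> i \<in> S. x i \<otimes> f [^] nat (s i + int K)) \<otimes> f [^] N"
    unfolding ore_class_eq_iff[OF X sum] ore_rel_iff by auto
  also have "\<dots> = (\<Oplus> i \<in> S. x i \<otimes> f [^] nat (s i + int K) \<otimes> f [^] N)"
    using assms(1,2) by (intro finsum_ldistr) (auto simp del: pow_nat)
  also have "\<dots> = (\<Oplus> i \<in> S. x i \<otimes> f [^] nat (s i + int (K + N)))"
  proof (rule finsum_cong'[OF HOL.refl])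
    fix i assume i: "i \<in> S"
    have "nat (s i + int K) + N = nat (s i + int (K + N))" using assms(3)[OF i] by linarith
    then show "x i \<otimes> f [^] nat (s i + int K) \<otimes> f [^] N = x i \<otimes> f [^] nat (s i + int (K + N))"
      using assms(2)[OF i] by (simp add: f_pow_mult del: pow_nat)
  qed (use assms(2) in \<open>auto simp del: pow_nat\<close>)
  finally show ?thesis by (rule that)
qed

section \<open>Local nilpotency of the adjoint action\<close>

lemma ad_closed [simp]: "x \<in> carrier R \<Longrightarrow> ad R f x \<in> carrier R"
  by (simp add: ad_def)

lemma ad_pow_closed [simp]: "x \<in> carrier R \<Longrightarrow> (ad R f ^^ n) x \<in> carrier R"
  by (induction n) auto

lemma ad_zero: "ad R f \<zero> = \<zero>"
  by (simp add: ad_def a_minus_def r_neg)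

lemma ad_pow_zero [simp]: "(ad R f ^^ n) \<zero> = \<zero>"
  by (induction n) (auto simp: ad_zero)

lemma ad_add:
  "x \<in> carrier R \<Longrightarrow> y \<in> carrier R \<Longrightarrow> ad R f (x \<oplus> y) = ad R f x \<oplus> ad R f y"
  by (simp add: ad_def ring_simprules)

lemma ad_pow_add:
  "x \<in> carrier R \<Longrightarrow> y \<in> carrier R \<Longrightarrow> (ad R f ^^ n) (x \<oplus> y) = (ad R f ^^ n) x \<oplus> (ad R f ^^ n) y"
  by (induction n) (auto simp: ad_add)

lemma ad_mult:
  assumes "x \<in> carrier R" "y \<in> carrier R"
  shows "ad R f (x \<otimes> y) = ad R f x \<otimes> y \<oplus> x \<otimes> ad R f y"
proof -
  have "f \<otimes> x \<otimes> y \<ominus> x \<otimes> y \<otimes> f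
      = (f \<otimes> x \<otimes> y \<ominus> x \<otimes> f \<otimes> y) \<oplus> (x \<otimes> f \<otimes> y \<ominus> x \<otimes> y \<otimes> f)"
    using assms by (simp add: a_minus_def a_assoc r_neg1 l_neg[symmetric] a_lcomm)
      (simp add: r_neg2)
  then show ?thesis
    using assms by (simp add: ad_def a_minus_def l_distr r_distr m_assoc l_minus r_minus)
qed

lemma ad_pow_le: "(ad R f ^^ n) x = \<zero> \<Longrightarrow> n \<le> k \<Longrightarrow> (ad R f ^^ k) x = \<zero>"
  by (metis ad_pow_zero comp_apply funpow_add le_add_diff_inverse2)

text \<open>By the Leibniz rule such elements are closed under sums and products, so local
  nilpotency can be checked on generators.\<close>

definition ad_nilpotent :: "'a \<Rightarrow> bool" where
  "ad_nilpotent x \<longleftrightarrow> x \<in> carrier R \<and> (\<exists>n. (ad R f ^^ n) x = \<zero>)"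

lemma ad_nilpotentI: "x \<in> carrier R \<Longrightarrow> (ad R f ^^ n) x = \<zero> \<Longrightarrow> ad_nilpotent x"
  by (auto simp: ad_nilpotent_def)

lemma ad_nilpotent_if_commutes: "x \<in> carrier R \<Longrightarrow> f \<otimes> x = x \<otimes> f \<Longrightarrow> ad_nilpotent x"
  by (rule ad_nilpotentI[of _ 1]) (simp_all add: ad_def a_minus_def r_neg)

lemma ad_nilpotent_add:
  assumes "ad_nilpotent x" "ad_nilpotent y"
  shows "ad_nilpotent (x \<oplus> y)"
proof -
  from assms obtain n k where c: "x \<in> carrier R" "y \<in> carrier R"
    and n: "(ad R f ^^ n) x = \<zero>" and k: "(ad R f ^^ k) y = \<zero>"
    unfolding ad_nilpotent_def by blast
  have "(ad R f ^^ (n + k)) (x \<oplus> y) = \<zero>"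
    using c ad_pow_le[OF n, of "n + k"] ad_pow_le[OF k, of "n + k"] by (simp add: ad_pow_add)
  then show ?thesis using c by (auto simp: ad_nilpotent_def)
qed

text \<open>Induction on n + k: the Leibniz rule lets one derivation fall on either factor, which
  lowers n or k by one; if either is 0, that factor is zero.\<close>

lemma ad_pow_mult_eq_zero:
  assumes "x \<in> carrier R" "y \<in> carrier R" "(ad R f ^^ n) x = \<zero>" "(ad R f ^^ k) y = \<zero>"
  shows "(ad R f ^^ (n + k)) (x \<otimes> y) = \<zero>"
  using assms
proof (induction "n + k" arbitrary: n k x y)
  case 0
  then show ?case by simp
next
  case (Suc l)
  show ?case
  proof (cases n)
    case 0
    then show ?thesis using Suc.prems by simp
  next
    case n: (Suc n')
    show ?thesis
    proof (cases k)
      case 0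
      then show ?thesis using Suc.prems by simp
    next
      case k: (Suc k')
      have "(ad R f ^^ (n' + k)) (ad R f x \<otimes> y) = \<zero>"
        using Suc.prems Suc.hyps(2) n by (intro Suc.hyps(1)) (auto simp: funpow_swap1)
      moreover have "(ad R f ^^ (n + k')) (x \<otimes> ad R f y) = \<zero>"
        using Suc.prems Suc.hyps(2) k by (intro Suc.hyps(1)) (auto simp: funpow_swap1)
      moreover have "n' + k = l" "n + k' = l" using Suc.hyps(2) n k by simp_all
      ultimately have "(ad R f ^^ l) (ad R f (x \<otimes> y)) = \<zero>"
        using Suc.prems by (simp add: ad_mult ad_pow_add)
      then show ?thesis by (simp add: funpow_swap1 flip: Suc.hyps(2))
    qed
  qed
qed

lemma ad_nilpotent_mult: "ad_nilpotent x \<Longrightarrow> ad_nilpotent y \<Longrightarrow> ad_nilpotent (x \<otimes> y)"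
  unfolding ad_nilpotent_def using ad_pow_mult_eq_zero by blast

lemma ad_nilpotent_diff:
  assumes "ad_nilpotent x" "ad_nilpotent y"
  shows "ad_nilpotent (x \<ominus> y)"
proof -
  have "ad_nilpotent (\<ominus> \<one>)" by (rule ad_nilpotent_if_commutes) (simp_all add: l_minus r_minus)
  then have "ad_nilpotent (x \<oplus> \<ominus> \<one> \<otimes> y)"
    using assms by (intro ad_nilpotent_add ad_nilpotent_mult)
  then show ?thesis using assms by (simp add: ad_nilpotent_def l_minus a_minus_def)
qed

end

section \<open>The enveloping algebra of $N_-$\<close>

lemma lie_class_eqI: "lie_eq R x y \<Longrightarrow> lie_class R x = lie_class R y"
  unfolding lie_class_def using lie_eq.sym lie_eq.trans by blast

lemma lie_class_self: "x \<in> lie_class R x"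
  by (simp add: lie_class_def lie_eq.refl)

text \<open>Bracketing respects the congruence, so the union over representatives is a single
  class.\<close>

lemma presented_lie_bracket:
  "lbracket (presented_lie R) (lie_class R x) (lie_class R y) = lie_class R (Br x y)"
proof -
  have "lie_class R (Br x' y') = lie_class R (Br x y)"
    if "x' \<in> lie_class R x" "y' \<in> lie_class R y" for x' y'
    using that by (intro lie_class_eqI) (auto simp: lie_class_def intro: lie_eq.br_cong lie_eq.sym)
  then have "(\<Union>x'\<in>lie_class R x. \<Union>y'\<in>lie_class R y. lie_class R (Br x' y'))
      = (\<Union>x'\<in>lie_class R x. \<Union>y'\<in>lie_class R y. lie_class R (Br x y))" by simp
  then show ?thesis
    using lie_class_self[of x R] lie_class_self[of y R] by (auto simp: presented_lie_def)
qed

lemma presented_lie_zero: "lzero (presented_lie R) = lie_class R Zero"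
  by (simp add: presented_lie_def)

lemma presented_lie_add_zero:
  "ladd (presented_lie R) (lie_class R Zero) (lie_class R Zero) = lie_class R Zero"
proof -
  have "lie_class R (Add x' y') = lie_class R Zero"
    if "x' \<in> lie_class R Zero" "y' \<in> lie_class R Zero" for x' y'
    using that
    by (intro lie_class_eqI)
      (auto simp: lie_class_def intro: lie_eq.trans[OF lie_eq.add_cong lie_eq.add_zero] lie_eq.sym)
  then have "(\<Union>x'\<in>lie_class R Zero. \<Union>y'\<in>lie_class R Zero. lie_class R (Add x' y'))
      = (\<Union>x'\<in>lie_class R Zero. \<Union>y'\<in>lie_class R Zero. lie_class R Zero)" by simp
  then show ?thesis
    using lie_class_self[of Zero R] by (auto simp: presented_lie_def)
qed

lemma n_minus_simps [simp]:
  "lcarrier (n_minus p q) = lie_gen (km_alg p q) {km_f p q N1, km_f p q N2}"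
  "ladd (n_minus p q) = ladd (km_alg p q)"
  "lscale (n_minus p q) = lscale (km_alg p q)"
  "lbracket (n_minus p q) = lbracket (km_alg p q)"
  by (simp_all add: n_minus_def lie_subalg_def)

interpretation N: lie_closed "n_minus p q" for p q
  by standard (auto intro: lie_gen.intros)

lemma km_f_closed: "km_f p q i \<in> lie_gen (km_alg p q) {km_f p q N1, km_f p q N2}"
  by (cases i) (auto intro: lie_gen.gen)

lemma km_f_bracket_power:
  "(lbracket (km_alg p q) (km_f p q i) ^^ k) (km_f p q j)
    = lie_class (km_relators p q) ((Br (Gen (F i)) ^^ k) (Gen (F j)))"
  by (induction k) (simp_all add: km_f_def km_alg_def presented_lie_bracket)

lemma serre_n_minus:
  assumes "i \<noteq> j"
  shows "(lbracket (km_alg p q) (km_f p q i) ^^ nat (1 - cartan p q i j)) (km_f p q j)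
    = lzero (km_alg p q)"
proof -
  have "lie_class (km_relators p q) ((Br (Gen (F i)) ^^ nat (1 - cartan p q i j)) (Gen (F j)))
      = lie_class (km_relators p q) Zero"
    using assms by (intro lie_class_eqI lie_eq.relator) (auto simp: km_relators_def)
  then show ?thesis
    by (simp only: km_f_bracket_power) (simp add: km_alg_def presented_lie_zero)
qed

lemma km_f_bracket_power_closed:
  "(lbracket (km_alg p q) (km_f p q i) ^^ k) (km_f p q j)
    \<in> lie_gen (km_alg p q) {km_f p q N1, km_f p q N2}"
  by (induction k) (auto intro: km_f_closed lie_gen.bracket)

interpretation UN: ore_denominator "U_N p q" "f_N p q i" for p q i
  unfolding U_N_def f_N_def ore_denominator_def ore_denominator_axioms_def
  using N.ring_env N.env_in_closed km_f_closed by simp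

text \<open>Additivity applied to 0 + 0 = 0 in the Lie algebra gives z + z = z for the image z. This
  carries the Serre relations into U(N_-).\<close>

lemma env_in_zero: "env_in (n_minus p q) (lzero (km_alg p q)) = \<zero>\<^bsub>U_N p q\<^esub>"
proof -
  let ?z = "lzero (km_alg p q)"
  have "ladd (km_alg p q) ?z ?z = ?z"
    by (simp add: km_alg_def presented_lie_zero presented_lie_add_zero)
  then have "env_in (n_minus p q) ?z \<oplus>\<^bsub>U_N p q\<^esub> env_in (n_minus p q) ?z = env_in (n_minus p q) ?z"
    using N.env_in_add[of ?z p q ?z] by (simp add: U_N_def lie_gen.zero)
  moreover have "env_in (n_minus p q) ?z \<in> carrier (U_N p q)"
    unfolding U_N_def by (intro N.env_in_closed) (simp add: lie_gen.zero)
  ultimately show ?thesis by (metis UN.add.r_cancel_one')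
qed

lemma ad_env_in:
  assumes "x \<in> lcarrier (n_minus p q)"
  shows "ad (U_N p q) (f_N p q i) (env_in (n_minus p q) x)
    = env_in (n_minus p q) (lbracket (km_alg p q) (km_f p q i) x)"
proof -
  have c: "env_in (n_minus p q) x \<in> carrier (U_N p q)"
    "env_in (n_minus p q) (lbracket (km_alg p q) (km_f p q i) x) \<in> carrier (U_N p q)"
    using assms km_f_closed unfolding U_N_def by (auto intro!: N.env_in_closed lie_gen.bracket)
  have "f_N p q i \<otimes>\<^bsub>U_N p q\<^esub> env_in (n_minus p q) x
      = env_in (n_minus p q) (lbracket (km_alg p q) (km_f p q i) x)
        \<oplus>\<^bsub>U_N p q\<^esub> env_in (n_minus p q) x \<otimes>\<^bsub>U_N p q\<^esub> f_N p q i"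
    using N.env_in_bracket[of "km_f p q i" p q x] assms km_f_closed
    by (simp add: U_N_def f_N_def)
  then show ?thesis
    using c by (simp add: ad_def a_minus_def UN.a_assoc UN.r_neg)
qed

lemma ad_power_km_f:
  "(ad (U_N p q) (f_N p q i) ^^ k) (env_in (n_minus p q) (km_f p q j))
    = env_in (n_minus p q) ((lbracket (km_alg p q) (km_f p q i) ^^ k) (km_f p q j))"
  by (induction k) (simp_all add: ad_env_in km_f_bracket_power_closed)

text \<open>Realizes a scalar as multiplication by a central element, so statements about scalar
  multiples follow from those about products.\<close>

lemma smult_U_N:
  assumes "v \<in> carrier (U_N p q)"
  obtains c' where "c' \<in> carrier (U_N p q)" "c \<odot>\<^bsub>U_N p q\<^esub> v = c' \<otimes>\<^bsub>U_N p q\<^esub> v"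
    "\<And>w. w \<in> carrier (U_N p q) \<Longrightarrow> c' \<otimes>\<^bsub>U_N p q\<^esub> w = w \<otimes>\<^bsub>U_N p q\<^esub> c'"
proof -
  have s: "Poly_Mapping.single 0 c \<in> carrier (free_alg (lcarrier (n_minus p q)))"
    by (intro free_alg_single_closed) (simp add: zero_list_def)
  show ?thesis
  proof (rule that[of "N.env_class p q (Poly_Mapping.single 0 c)"])
    show "N.env_class p q (Poly_Mapping.single 0 c) \<in> carrier (U_N p q)"
      unfolding U_N_def by (rule N.env_class_closed[OF s])
    show "c \<odot>\<^bsub>U_N p q\<^esub> v = N.env_class p q (Poly_Mapping.single 0 c) \<otimes>\<^bsub>U_N p q\<^esub> v"
      using assms N.env_class_smult N.env_class_mult[OF s] unfolding U_N_def N.carrier_env by force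
    show "N.env_class p q (Poly_Mapping.single 0 c) \<otimes>\<^bsub>U_N p q\<^esub> w
        = w \<otimes>\<^bsub>U_N p q\<^esub> N.env_class p q (Poly_Mapping.single 0 c)" if "w \<in> carrier (U_N p q)" for w
      using that N.env_class_mult[OF s] N.env_class_mult[OF _ s]
      unfolding U_N_def N.carrier_env by (force simp: mult_single_zero_commute)
  qed
qed

lemma smult_U_N_closed: "v \<in> carrier (U_N p q) \<Longrightarrow> c \<odot>\<^bsub>U_N p q\<^esub> v \<in> carrier (U_N p q)"
  by (rule smult_U_N[of v p q c]) auto

lemma ad_nilpotent_smult:
  assumes "UN.ad_nilpotent p q i v"
  shows "UN.ad_nilpotent p q i (c \<odot>\<^bsub>U_N p q\<^esub> v)"
proof -
  have v: "v \<in> carrier (U_N p q)" using assms by (simp add: UN.ad_nilpotent_def)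
  obtain c' where c': "c' \<in> carrier (U_N p q)" "c \<odot>\<^bsub>U_N p q\<^esub> v = c' \<otimes>\<^bsub>U_N p q\<^esub> v"
    "\<And>w. w \<in> carrier (U_N p q) \<Longrightarrow> c' \<otimes>\<^bsub>U_N p q\<^esub> w = w \<otimes>\<^bsub>U_N p q\<^esub> c'"
    by (rule smult_U_N[OF v, of c]) blast
  have "UN.ad_nilpotent p q i c'"
    using c'(1) c'(3)[of "f_N p q i"] by (intro UN.ad_nilpotent_if_commutes) simp_all
  then show ?thesis unfolding c'(2) using assms by (rule UN.ad_nilpotent_mult)
qed

text \<open>A generator either commutes with f_i or is killed by the Serre power of ad f_i; brackets
  become commutators, which the closure properties handle.\<close>

lemma ad_nilpotent_env_in:
  assumes "x \<in> lie_gen (km_alg p q) {km_f p q N1, km_f p q N2}"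
  shows "UN.ad_nilpotent p q i (env_in (n_minus p q) x)"
  using assms
proof (induction rule: lie_gen.induct)
  case (gen x)
  then obtain j where x: "x = km_f p q j" by blast
  have c: "env_in (n_minus p q) x \<in> carrier (U_N p q)"
    unfolding U_N_def x by (intro N.env_in_closed) (simp add: km_f_closed)
  show ?case
  proof (cases "i = j")
    case True
    then show ?thesis
      using c by (intro UN.ad_nilpotent_if_commutes) (simp_all add: x f_N_def)
  next
    case False
    then show ?thesis
      using c unfolding x
      by (intro UN.ad_nilpotentI[where n = "nat (1 - cartan p q i j)"])
        (simp_all add: ad_power_km_f serre_n_minus env_in_zero)
  qed
next
  case zero
  show ?case unfolding env_in_zero by (rule UN.ad_nilpotent_if_commutes) simp_all
next
  case (add x y)
  then show ?case
    using N.env_in_add[of x p q y] UN.ad_nilpotent_add by (simp add: U_N_def)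
next
  case (scale x c)
  then show ?case
    using N.env_in_scale[of x p q c] ad_nilpotent_smult by (simp add: U_N_def)
next
  case (bracket x y)
  have c: "env_in (n_minus p q) z \<in> carrier (U_N p q)" if "z \<in> lcarrier (n_minus p q)" for z
    unfolding U_N_def using that by (rule N.env_in_closed)
  let ?x = "env_in (n_minus p q) x" and ?y = "env_in (n_minus p q) y"
  have xy: "?x \<in> carrier (U_N p q)" "?y \<in> carrier (U_N p q)"
    "env_in (n_minus p q) (lbracket (km_alg p q) x y) \<in> carrier (U_N p q)"
    using bracket.hyps by (auto intro!: c lie_gen.bracket)
  have "?x \<otimes>\<^bsub>U_N p q\<^esub> ?y \<ominus>\<^bsub>U_N p q\<^esub> ?y \<otimes>\<^bsub>U_N p q\<^esub> ?x = env_in (n_minus p q) (lbracket (km_alg p q) x y)"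
    using N.env_in_bracket[of x p q y] bracket.hyps xy
    by (simp add: U_N_def[symmetric] a_minus_def UN.a_assoc UN.r_neg)
  then show ?case
    using UN.ad_nilpotent_diff[OF UN.ad_nilpotent_mult UN.ad_nilpotent_mult] bracket.IH by metis
qed

lemma ad_nilpotent_U_N:
  assumes "u \<in> carrier (U_N p q)"
  shows "UN.ad_nilpotent p q i u"
  using assms unfolding U_N_def
proof (induction rule: N.env_induct)
  case one
  show ?case
    unfolding U_N_def[symmetric] by (rule UN.ad_nilpotent_if_commutes) simp_all
next
  case (mult x v)
  then show ?case unfolding U_N_def[symmetric]
    using UN.ad_nilpotent_mult ad_nilpotent_env_in by simp
next
  case (scale c v)
  then show ?case unfolding U_N_def[symmetric] using ad_nilpotent_smult by simp
next
  case (add v w)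
  then show ?case unfolding U_N_def[symmetric] using UN.ad_nilpotent_add by simp
qed

section \<open>The numbers $\Gamma$\<close>

context
  fixes x :: int
begin

text \<open>For x = y^2 with y nonzero and U_n the Chebyshev polynomials of the second kind,
  \<open>cheb_odd l\<close> is U_(2l)(y/2) and \<open>cheb_even l\<close> is U_(2l-1)(y/2)/y. At x =
  pq these are a_(2l+1) and a_(2l) divided by the square root of pq.\<close>

definition cheb_odd :: "nat \<Rightarrow> int" where
  "cheb_odd l = (\<Sum>i\<le>l. (-1) ^ i * int ((2 * l - i) choose i) * x ^ (l - i))"

definition cheb_even :: "nat \<Rightarrow> int" where
  "cheb_even l = (\<Sum>i<l. (-1) ^ i * int ((2 * l - 1 - i) choose i) * x ^ (l - 1 - i))"

lemma cheb_0: "cheb_odd 0 = 1" "cheb_even 0 = 0"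
  by (simp_all add: cheb_odd_def cheb_even_def)

text \<open>The Chebyshev recursion U_n(y/2) = y U_(n-1)(y/2) - U_(n-2)(y/2) in terms of x = y^2,
  obtained from Pascal's rule.\<close>

lemma cheb_odd_Suc: "cheb_odd (Suc l) = x * cheb_even (Suc l) - cheb_odd l"
proof -
  let ?f = "\<lambda>i. (-1) ^ i * int ((2 * l + 1 - i) choose i) * x ^ (Suc l - i)"
  let ?g = "\<lambda>i. (-1) ^ i * int ((2 * l - i) choose i) * x ^ (l - i)"
  have "cheb_odd (Suc l) = x ^ Suc l
      + (\<Sum>i\<le>l. (-1) ^ Suc i * int ((2 * Suc l - Suc i) choose Suc i) * x ^ (Suc l - Suc i))"
    unfolding cheb_odd_def by (subst sum.atMost_Suc_shift) simp
  also have "(\<Sum>i\<le>l. (-1) ^ Suc i * int ((2 * Suc l - Suc i) choose Suc i) * x ^ (Suc l - Suc i))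
      = (\<Sum>i\<le>l. ?f (Suc i) - ?g i)"
  proof (rule sum.cong[OF HOL.refl])
    fix i assume "i \<in> {..l}"
    then have "2 * Suc l - Suc i = Suc (2 * l - i)" "2 * l + 1 - Suc i = 2 * l - i" by auto
    then show "(-1) ^ Suc i * int ((2 * Suc l - Suc i) choose Suc i) * x ^ (Suc l - Suc i)
        = ?f (Suc i) - ?g i"
      by (simp add: algebra_simps)
  qed
  also have "x ^ Suc l + (\<Sum>i\<le>l. ?f (Suc i) - ?g i) = (\<Sum>i\<le>Suc l. ?f i) - cheb_odd l"
    unfolding cheb_odd_def sum_subtractf by (subst sum.atMost_Suc_shift) simp
  \<comment> \<open>The top term carries the coefficient l choose (l+1), which is 0.\<close>
  also have "(\<Sum>i\<le>Suc l. ?f i) = (\<Sum>i<Suc l. ?f i)"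
    by (simp add: lessThan_Suc_atMost)
  also have "\<dots> = x * cheb_even (Suc l)"
    unfolding cheb_even_def sum_distrib_left
  proof (rule sum.cong[OF HOL.refl])
    fix i assume "i \<in> {..<Suc l}"
    then have "Suc l - i = Suc (Suc l - 1 - i)" "2 * l + 1 - i = 2 * Suc l - 1 - i" by auto
    then show "?f i = x * ((-1) ^ i * int ((2 * Suc l - 1 - i) choose i) * x ^ (Suc l - 1 - i))"
      by (simp only: power_Suc mult.left_commute)
  qed
  finally show ?thesis .
qed

lemma cheb_even_Suc: "cheb_even (Suc l) = cheb_odd l - cheb_even l"
proof (cases l)
  case 0
  then show ?thesis by (simp add: cheb_odd_def cheb_even_def)
next
  case l: (Suc n)
  let ?f = "\<lambda>i. (-1) ^ i * int ((2 * l - i) choose i) * x ^ (l - i)"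
  let ?g = "\<lambda>i. (-1) ^ i * int ((2 * l - 1 - i) choose i) * x ^ (l - 1 - i)"
  have "cheb_even (Suc l) = (\<Sum>i\<le>Suc n. (-1) ^ i * int ((2 * l + 1 - i) choose i) * x ^ (l - i))"
    by (simp add: cheb_even_def lessThan_Suc_atMost l)
  also have "\<dots> = x ^ l
      + (\<Sum>i\<le>n. (-1) ^ Suc i * int ((2 * l + 1 - Suc i) choose Suc i) * x ^ (l - Suc i))"
    by (subst sum.atMost_Suc_shift) simp
  also have "(\<Sum>i\<le>n. (-1) ^ Suc i * int ((2 * l + 1 - Suc i) choose Suc i) * x ^ (l - Suc i))
      = (\<Sum>i\<le>n. ?f (Suc i) - ?g i)"
  proof (rule sum.cong[OF HOL.refl])
    fix i assume "i \<in> {..n}"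
    then have "2 * l + 1 - Suc i = Suc (2 * l - 1 - i)" "2 * l - Suc i = 2 * l - 1 - i"
      using l by auto
    then show "(-1) ^ Suc i * int ((2 * l + 1 - Suc i) choose Suc i) * x ^ (l - Suc i)
        = ?f (Suc i) - ?g i"
      by (simp add: algebra_simps)
  qed
  also have "x ^ l + (\<Sum>i\<le>n. ?f (Suc i) - ?g i) = (\<Sum>i\<le>Suc n. ?f i) - (\<Sum>i\<le>n. ?g i)"
    unfolding sum_subtractf by (subst sum.atMost_Suc_shift) simp
  also have "\<dots> = cheb_odd l - cheb_even l"
    by (simp add: cheb_odd_def cheb_even_def lessThan_Suc_atMost l)
  finally show ?thesis .
qed

end

section \<open>Gamma in terms of the Chebyshev values, and its monotonicity\<close>

lemma \<Gamma>\<^sub>1_odd: "\<Gamma>\<^sub>1 p q (2 * l + 1) = cheb_odd (int (p * q)) l"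
proof -
  have "(2 * l - i) choose (2 * l - 2 * i) = (2 * l - i) choose i" if "i \<le> l" for i
    using that binomial_symmetric[of i "2 * l - i"] by (simp add: mult_2)
  then show ?thesis by (simp add: \<Gamma>\<^sub>1_def cheb_odd_def Let_def)
qed

lemma binomial_symmetric_odd:
  assumes "i < l"
  shows "(2 * l - Suc i) choose (2 * l - Suc (2 * i)) = (2 * l - Suc i) choose i"
proof -
  have "2 * l - Suc (2 * i) = 2 * l - Suc i - i" "i \<le> 2 * l - Suc i"
    using assms by auto
  then show ?thesis using binomial_symmetric[of i "2 * l - Suc i"] by simp
qed

lemma \<Gamma>\<^sub>1_even: "\<Gamma>\<^sub>1 p q (2 * l) = int q * cheb_even (int (p * q)) l"
  by (simp add: \<Gamma>\<^sub>1_def cheb_even_def Let_def binomial_symmetric_odd)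

lemma \<Gamma>\<^sub>2_odd: "\<Gamma>\<^sub>2 p q (2 * l + 1) = int p * cheb_even (int (p * q)) l"
  by (simp add: \<Gamma>\<^sub>2_def cheb_even_def Let_def binomial_symmetric_odd)

text \<open>This coincidence of the two sequences makes exponents and block lengths uniform in the
  parity of the step.\<close>

lemma \<Gamma>\<^sub>2_Suc_odd: "\<Gamma>\<^sub>2 p q (2 * l + 2) = \<Gamma>\<^sub>1 p q (2 * l + 1)"
  by (simp add: \<Gamma>\<^sub>1_def \<Gamma>\<^sub>2_def Let_def lessThan_Suc_atMost)

text \<open>The inequalities propagate jointly. With consecutive values a, b, c of the two
  sequences, c = pqb - a >= 2qb - qb = qb, and likewise c >= pb; then p(c-b) >= 2c - pb >= c, and
  the same with q.\<close>

lemma cheb_bounds: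
  assumes "2 \<le> p" "2 \<le> q"
  shows "0 \<le> cheb_even (p * q) l \<and> p * cheb_even (p * q) l \<le> cheb_odd (p * q) l
    \<and> q * cheb_even (p * q) l \<le> cheb_odd (p * q) l
    \<and> cheb_odd (p * q) l \<le> p * cheb_even (p * q) (Suc l)
    \<and> cheb_odd (p * q) l \<le> q * cheb_even (p * q) (Suc l)"
proof (induction l)
  case 0
  show ?case using assms by (simp add: cheb_0 cheb_even_Suc)
next
  case (Suc l)
  define a where "a = cheb_odd (p * q) l"
  define b where "b = cheb_even (p * q) (Suc l)"
  define c where "c = cheb_odd (p * q) (Suc l)"
  have c: "c = p * (q * b) - a" unfolding a_def b_def c_def by (simp add: cheb_odd_Suc)
  have a: "0 \<le> a"
    using Suc assms unfolding a_def by (smt (verit) mult_nonneg_nonneg)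
  have ab: "a \<le> p * b" "a \<le> q * b" using Suc unfolding a_def b_def by auto
  have b: "0 \<le> b" using a ab(1) assms by (smt (verit) mult_pos_neg)
  have "2 * (q * b) \<le> p * (q * b)" "2 * (p * b) \<le> q * (p * b)"
    using assms b by (intro mult_right_mono; simp)+
  then have bc: "q * b \<le> c" "p * b \<le> c" using ab c by (auto simp: mult.left_commute)
  have "0 \<le> c" using bc(1) assms b by (smt (verit) mult_nonneg_nonneg)
  then have "2 * c \<le> p * c" "2 * c \<le> q * c"
    using assms by (intro mult_right_mono; simp)+
  then show ?case
    using bc b unfolding b_def[symmetric] c_def[symmetric] cheb_even_Suc[of _ "Suc l"]
    by (auto simp: right_diff_distrib)
qed

text \<open>The differences of consecutive Gammas are powers and block lengths; their nonnegativity
  makes the conversions by \<open>nat\<close> lossless.\<close>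

lemma \<Gamma>_mono:
  assumes "2 \<le> p" "2 \<le> q"
  shows "\<Gamma>\<^sub>1 p q k \<le> \<Gamma>\<^sub>1 p q (Suc k)" "\<Gamma>\<^sub>2 p q k \<le> \<Gamma>\<^sub>2 p q (Suc k)"
proof -
  have bounds: "0 \<le> cheb_even (int (p * q)) l"
    "int p * cheb_even (int (p * q)) l \<le> cheb_odd (int (p * q)) l"
    "int q * cheb_even (int (p * q)) l \<le> cheb_odd (int (p * q)) l"
    "cheb_odd (int (p * q)) l \<le> int p * cheb_even (int (p * q)) (Suc l)"
    "cheb_odd (int (p * q)) l \<le> int q * cheb_even (int (p * q)) (Suc l)" for l
    using cheb_bounds[of "int p" "int q" l] assms by auto
  show "\<Gamma>\<^sub>1 p q k \<le> \<Gamma>\<^sub>1 p q (Suc k)"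
  proof (cases "even k")
    case True
    then obtain l where "k = 2 * l" by blast
    then show ?thesis using bounds(3)[of l] \<Gamma>\<^sub>1_even[of p q l] \<Gamma>\<^sub>1_odd[of p q l] by simp
  next
    case False
    then obtain l where "k = 2 * l + 1" by (rule oddE)
    then show ?thesis using bounds(5)[of l] \<Gamma>\<^sub>1_even[of p q "Suc l"] \<Gamma>\<^sub>1_odd[of p q l] by simp
  qed
  show "\<Gamma>\<^sub>2 p q k \<le> \<Gamma>\<^sub>2 p q (Suc k)"
  proof (cases "even k")
    case True
    then obtain l where l: "k = 2 * l" by blast
    show ?thesis
    proof (cases l)
      case 0
      then show ?thesis by (simp add: l \<Gamma>\<^sub>2_def)
    next
      case (Suc n)
      then show ?thesis
        using bounds(4)[of n] \<Gamma>\<^sub>2_odd[of p q l] \<Gamma>\<^sub>2_Suc_odd[of p q n] \<Gamma>\<^sub>1_odd[of p q n] by (simp add: l)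
    qed
  next
    case False
    then obtain l where "k = 2 * l + 1" by (rule oddE)
    then show ?thesis
      using bounds(2)[of l] \<Gamma>\<^sub>2_odd[of p q l] \<Gamma>\<^sub>2_Suc_odd[of p q l] \<Gamma>\<^sub>1_odd[of p q l] by simp
  qed
qed

lemma \<Gamma>_initial: "\<Gamma>\<^sub>1 p q 0 = 0" "\<Gamma>\<^sub>1 p q 1 = 1" "\<Gamma>\<^sub>2 p q 1 = 0" "\<Gamma>\<^sub>2 p q 2 = 1"
  by (simp_all add: \<Gamma>\<^sub>1_def \<Gamma>\<^sub>2_def)

section \<open>The projection of complex powers\<close>

lemma to_U_gf: "to_U (gf i) = f_S i"
  by (simp add: gf_def to_U_gen f_S_def)

lemma to_U_power: "to_U (u ^ n) = to_U u [^]\<^bsub>U_sl2\<^esub> n"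
  by (induction n) (simp_all add: one_usl2.rep_eq times_usl2.rep_eq power_Suc2 del: power_Suc)

lemma list_prod_to_U: "list_prod U_sl2 (map (\<lambda>x. to_U (h x)) xs) = to_U (prod_list (map h xs))"
  by (induction xs) (simp_all add: list_prod_def one_usl2.rep_eq times_usl2.rep_eq)

lemma prod_list_concat_map:
  "prod_list (map h (concat (map g xs))) = prod_list (map (\<lambda>x. prod_list (map h (g x))) xs)"
  by (induction xs) simp_all

lemma J_eq_to_U: "J u = to_U (Jt u)"
proof -
  have one: "to_U (cst c) = c \<odot>\<^bsub>U_sl2\<^esub> \<one>\<^bsub>U_sl2\<^esub>" for c
    using to_U_cst_mult[of c 1] by (simp add: one_usl2.rep_eq)
  show ?thesis
    unfolding J_def Jt_def minus_usl2.rep_eq plus_usl2.rep_eq to_U_cst_mult one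
    by (simp add: times_usl2.rep_eq to_U_gf gh_def to_U_gen h_S_def)
qed

text \<open>The change of a J-index when the K-index grows by a. For \<open>N2\<close> the relation
  K_v = J_(1-v) reverses the sign, which is where the alternating signs originate.\<close>

fun conj_shift :: "node \<Rightarrow> complex \<Rightarrow> complex" where
  "conj_shift N1 a = a"
| "conj_shift N2 a = - a"

fun new_index :: "node \<Rightarrow> complex \<Rightarrow> nat \<Rightarrow> complex" where
  "new_index N1 a k = a - of_nat k"
| "new_index N2 a k = 1 - a + of_nat k"

lemma Kt_new_index: "Kt i (a - of_nat k) = Jt (new_index i a k)"
  by (cases i) (simp_all add: Kt_N1 Kt_N2 algebra_simps)

text \<open>The substitution $u \mapsto 1 - u$ translates between $K_u$ and $J_u$ when \<open>i = N2\<close>.\<close>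

lemma Jt_eq_Kt: "\<exists>v. Jt u = Kt i v \<and> (\<forall>a. Kt i (v + a) = Jt (u + conj_shift i a))"
proof (cases i)
  case N1
  then show ?thesis by (auto simp: Kt_N1 intro!: exI[of _ u])
next
  case N2
  then show ?thesis by (auto simp: Kt_N2 algebra_simps intro!: exI[of _ "1 - u"])
qed

section \<open>The projection as a map into the type, and its effect on whole words\<close>

locale usl2_projection =
  fixes p q :: nat and \<phi> :: "u_minus \<Rightarrow> u_sl2"
  assumes projection: "is_projection p q \<phi>"
begin

abbreviation "UNpq \<equiv> U_N p q"

definition proj :: "u_minus \<Rightarrow> usl2" where
  "proj x = of_U (\<phi> x)"

lemma phi_hom: "\<phi> \<in> ring_hom UNpq U_sl2"
  using projection by (simp add: is_projection_def alg_hom_def)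

lemma to_U_proj: "x \<in> carrier UNpq \<Longrightarrow> to_U (proj x) = \<phi> x"
  using ring_hom_closed[OF phi_hom] by (simp add: proj_def of_U_inverse)

lemma proj_f: "proj (f_N p q i) = gf i"
  using projection by (simp add: proj_def is_projection_def to_U_inverse flip: to_U_gf)

lemma proj_mult:
  "x \<in> carrier UNpq \<Longrightarrow> y \<in> carrier UNpq \<Longrightarrow> proj (x \<otimes>\<^bsub>UNpq\<^esub> y) = proj x * proj y"
  using ring_hom_mult[OF phi_hom] by (simp add: to_U_proj times_usl2.rep_eq flip: to_U_inject)

lemma proj_add:
  "x \<in> carrier UNpq \<Longrightarrow> y \<in> carrier UNpq \<Longrightarrow> proj (x \<oplus>\<^bsub>UNpq\<^esub> y) = proj x + proj y"
  using ring_hom_add[OF phi_hom] by (simp add: to_U_proj plus_usl2.rep_eq flip: to_U_inject)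

lemma proj_one: "proj \<one>\<^bsub>UNpq\<^esub> = 1"
  using ring_hom_one[OF phi_hom] by (simp add: to_U_proj one_usl2.rep_eq flip: to_U_inject)

lemma proj_smult: "x \<in> carrier UNpq \<Longrightarrow> proj (c \<odot>\<^bsub>UNpq\<^esub> x) = cst c * proj x"
  using projection unfolding is_projection_def alg_hom_def
  by (simp add: to_U_proj to_U_cst_mult smult_U_N_closed flip: to_U_inject)

lemma proj_zero: "proj \<zero>\<^bsub>UNpq\<^esub> = 0"
  using proj_add[of "\<zero>\<^bsub>UNpq\<^esub>" "\<zero>\<^bsub>UNpq\<^esub>"] by simp

lemma proj_uminus: "x \<in> carrier UNpq \<Longrightarrow> proj (\<ominus>\<^bsub>UNpq\<^esub> x) = - proj x"
  using proj_add[of "\<ominus>\<^bsub>UNpq\<^esub> x" x] by (simp add: UN.l_neg proj_zero eq_neg_iff_add_eq_0)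

lemma proj_power: "x \<in> carrier UNpq \<Longrightarrow> proj (x [^]\<^bsub>UNpq\<^esub> (n::nat)) = proj x ^ n"
  by (induction n) (simp_all add: proj_one proj_mult power_Suc2 del: power_Suc)

lemma proj_finsum:
  "(\<And>i. i \<in> S \<Longrightarrow> x i \<in> carrier UNpq) \<Longrightarrow> finite S \<Longrightarrow>
    proj (\<Oplus>\<^bsub>UNpq\<^esub> i \<in> S. x i) = (\<Sum>i\<in>S. proj (x i))"
proof (induction S rule: infinite_finite_induct)
  case (insert j S)
  have "(\<Oplus>\<^bsub>UNpq\<^esub> i \<in> insert j S. x i) = x j \<oplus>\<^bsub>UNpq\<^esub> (\<Oplus>\<^bsub>UNpq\<^esub> i \<in> S. x i)"
    using insert by (intro UN.finsum_insert) auto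
  moreover have "(\<Oplus>\<^bsub>UNpq\<^esub> i \<in> S. x i) \<in> carrier UNpq"
    using insert by (intro UN.finsum_closed) auto
  ultimately show ?case using insert by (simp add: proj_add)
qed (simp_all add: proj_zero)

lemma proj_ad_power:
  "x \<in> carrier UNpq \<Longrightarrow> proj ((ad UNpq (f_N p q i) ^^ k) x) = (adt i ^^ k) (proj x)"
proof (induction k)
  case (Suc k)
  have "proj (ad UNpq (f_N p q i) y) = adt i (proj y)" if "y \<in> carrier UNpq" for y
    using that by (simp add: ad_def adt_def a_minus_def proj_add proj_uminus proj_mult proj_f)
  then show ?case using Suc by simp
qed simp

text \<open>Clearing denominators gives an identity in U(N_-); its image under the homomorphism is
  the premise of \<open>complex_power_usl2\<close> with L = s + C.\<close>

lemma proj_complex_power: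
  assumes W: "W \<in> carrier UNpq" and X: "is_complex_power UNpq (f_N p q i) a W b X"
    and ab: "a + b = of_nat s" and M: "M \<le> s"
    and proj_W: "proj W = prod_list (map Jt us) * gf (other i) ^ M"
  shows "proj X = prod_list (map Jt (map (\<lambda>u. u + conj_shift i a) us @ map (new_index i a) [0..<M]))
    * gf i ^ (s - M)"
proof -
  let ?f = "f_N p q i"
  let ?D = "\<lambda>k. (ad UNpq ?f ^^ k) W"
  let ?S = "{k. ?D k \<noteq> \<zero>\<^bsub>UNpq\<^esub>}"
  obtain n0 where n0: "?D n0 = \<zero>\<^bsub>UNpq\<^esub>"
    using ad_nilpotent_U_N[OF W, of i] unfolding UN.ad_nilpotent_def by blast
  have S: "k < n0" if "k \<in> ?S" for k
    using that UN.ad_pow_le[OF n0, of k] by (cases "k < n0") simp_all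
  then have fin: "finite ?S" using finite_nat_set_iff_bounded by blast
  have Xc: "X \<in> carrier UNpq" using X by (simp add: is_complex_power_def)
  have the_s: "(THE t. of_int t = a + b) = int s"
    unfolding ab of_int_of_nat_eq[symmetric, where 'a = complex] of_int_eq_iff by simp
  have ore: "ore_in UNpq ?f X = (\<Oplus>\<^bsub>ore_loc UNpq ?f\<^esub> k \<in> ?S.
      ore_frac UNpq ?f ((a gchoose k) \<odot>\<^bsub>UNpq\<^esub> ?D k) (int s - int k))"
    using X by (simp add: is_complex_power_def complex_power_def the_s)
  have nonneg: "0 \<le> int s - int k + int n0" if "k \<in> ?S" for k using S[OF that] by simp
  have closed: "(a gchoose k) \<odot>\<^bsub>UNpq\<^esub> ?D k \<in> carrier UNpq" for k
    using W by (simp add: smult_U_N_closed)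
  obtain N where N: "X \<otimes>\<^bsub>UNpq\<^esub> ?f [^]\<^bsub>UNpq\<^esub> (n0 + N)
      = (\<Oplus>\<^bsub>UNpq\<^esub> k \<in> ?S. ((a gchoose k) \<odot>\<^bsub>UNpq\<^esub> ?D k)
          \<otimes>\<^bsub>UNpq\<^esub> ?f [^]\<^bsub>UNpq\<^esub> nat (int s - int k + int (n0 + N)))"
    by (rule UN.ore_in_eq_finsum[where x = "\<lambda>k. (a gchoose k) \<odot>\<^bsub>UNpq\<^esub> ?D k"
          and s = "\<lambda>k. int s - int k" and K = n0, OF fin closed nonneg Xc ore])
  \<comment> \<open>Every index k in the sum is below \<open>n0\<close>, hence below
    \<open>C\<close>, so s + C - k involves no truncation.\<close>
  define C where "C = n0 + N"
  have "proj X * gf i ^ C = proj (X \<otimes>\<^bsub>UNpq\<^esub> ?f [^]\<^bsub>UNpq\<^esub> C)"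
    using Xc by (simp add: proj_mult proj_power proj_f)
  also have "\<dots> = (\<Sum>k\<in>?S. proj (((a gchoose k) \<odot>\<^bsub>UNpq\<^esub> ?D k)
          \<otimes>\<^bsub>UNpq\<^esub> ?f [^]\<^bsub>UNpq\<^esub> nat (int s - int k + int C)))"
    unfolding C_def N using W smult_U_N_closed fin
    by (intro proj_finsum) (auto simp del: pow_nat)
  also have "\<dots> = (\<Sum>k\<in>?S. cst (a gchoose k) * (adt i ^^ k) (proj W) * gf i ^ (s + C - k))"
  proof (rule sum.cong[OF HOL.refl])
    fix k assume "k \<in> ?S"
    then have "nat (int s - int k + int C) = s + C - k" using S[of k] by (simp add: C_def)
    then show "proj (((a gchoose k) \<odot>\<^bsub>UNpq\<^esub> ?D k)
          \<otimes>\<^bsub>UNpq\<^esub> ?f [^]\<^bsub>UNpq\<^esub> nat (int s - int k + int C))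
        = cst (a gchoose k) * (adt i ^^ k) (proj W) * gf i ^ (s + C - k)"
      using W by (simp add: proj_mult proj_power proj_smult proj_f proj_ad_power smult_U_N_closed
          del: pow_nat)
  qed
  finally have eq: "proj X * gf i ^ C
      = (\<Sum>k\<in>?S. cst (a gchoose k) * (adt i ^^ k) (proj W) * gf i ^ (s + C - k))" .
  obtain v where v: "\<And>u. Jt u = Kt i (v u)" "\<And>u a. Kt i (v u + a) = Jt (u + conj_shift i a)"
    using Jt_eq_Kt[of _ i] by metis
  have "proj X = prod_list (map (\<lambda>w. Kt i (w + a)) (map v us))
      * prod_list (map (\<lambda>k. Kt i (a - of_nat k)) [0..<M]) * gf i ^ (s + C - C - M)"
  proof (rule complex_power_usl2[OF fin _ _ _ _ eq])
    show "k \<le> s + C" if "k \<in> ?S" for k using S[OF that] by (simp add: C_def)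
    show "(adt i ^^ k) (proj W) = 0" if "k \<notin> ?S" for k
      using that proj_ad_power[OF W, where i = i and k = k] by (simp add: proj_zero)
    show "proj W = prod_list (map (Kt i) (map v us)) * gf (other i) ^ M"
    proof -
      have "Jt = Kt i \<circ> v" using v(1) by (simp add: fun_eq_iff)
      then show ?thesis using proj_W by simp
    qed
    show "M + C \<le> s + C" using M by simp
  qed
  then show ?thesis by (simp add: v(2) Kt_new_index comp_def mult.assoc)
qed

text \<open>Stated for abstract data so that it serves both families. \<open>nd k\<close> is the
  generator conjugating V_k, \<open>M k\<close> the power still standing in the image of V_k, and
  \<open>idx k w\<close> the J-indices of block w in that image. Step k shifts the blocks below k
  and creates block k from the \<open>M k\<close> remaining factors.\<close>

lemma proj_words:
  fixes V :: "nat \<Rightarrow> u_minus" and nd :: "nat \<Rightarrow> node" and a b :: "nat \<Rightarrow> complex"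
    and M :: "nat \<Rightarrow> nat" and idx :: "nat \<Rightarrow> nat \<Rightarrow> complex list"
  assumes V1: "V 1 = f_N p q (other (nd 1)) [^]\<^bsub>UNpq\<^esub> M 1"
    and nd: "\<And>k. nd (Suc k) = other (nd k)"
    and step: "\<And>k. 1 \<le> k \<Longrightarrow> is_complex_power UNpq (f_N p q (nd k)) (a k) (V k) (b k) (V (Suc k))"
    and sum: "\<And>k. 1 \<le> k \<Longrightarrow> a k + b k = of_nat (M k + M (Suc k))"
    and idx_new: "\<And>k. 1 \<le> k \<Longrightarrow> idx (Suc k) k = map (new_index (nd k) (a k)) [0..<M k]"
    and idx_shift: "\<And>k w. 1 \<le> w \<Longrightarrow> w < k \<Longrightarrow>
      idx (Suc k) w = map (\<lambda>u. u + conj_shift (nd k) (a k)) (idx k w)"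
    and k: "1 \<le> k"
  shows "\<phi> (V k) = list_prod U_sl2 (map (\<lambda>w. to_U (prod_list (map Jt (idx k w)))) [1..<k])
    \<otimes>\<^bsub>U_sl2\<^esub> f_S (other (nd k)) [^]\<^bsub>U_sl2\<^esub> M k"
proof -
  have "V k \<in> carrier UNpq \<and>
    proj (V k) = prod_list (map Jt (concat (map (idx k) [1..<k]))) * gf (other (nd k)) ^ M k"
    using k
  proof (induction k rule: dec_induct)
    case base
    show ?case unfolding V1 by (simp add: proj_power proj_f)
  next
    case (step k)
    have "map (\<lambda>u. u + conj_shift (nd k) (a k)) (concat (map (idx k) [1..<k]))
        @ map (new_index (nd k) (a k)) [0..<M k] = concat (map (idx (Suc k)) [1..<Suc k])"
    proof -
      have "map (idx (Suc k)) [1..<k] = map (map (\<lambda>u. u + conj_shift (nd k) (a k)) \<circ> idx k) [1..<k]"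
        using idx_shift by simp
      moreover have "[1..<Suc k] = [1..<k] @ [k]" using step.hyps by simp
      ultimately show ?thesis
        by (simp only: map_concat map_map map_append concat_append list.map concat.simps append_Nil2
            idx_new[OF step.hyps(1)])
    qed
    moreover have "proj (V (Suc k))
        = prod_list (map Jt (map (\<lambda>u. u + conj_shift (nd k) (a k)) (concat (map (idx k) [1..<k]))
            @ map (new_index (nd k) (a k)) [0..<M k])) * gf (nd k) ^ (M k + M (Suc k) - M k)"
      using step assms(3)[OF step.hyps(1)] sum[OF step.hyps(1)]
      by (intro proj_complex_power[where W = "V k"]) auto
    ultimately show ?case
      using assms(3)[OF step.hyps(1)] by (simp add: nd is_complex_power_def)
  qed
  then show ?thesis
    unfolding list_prod_to_U to_U_gf[symmetric] to_U_power[symmetric] times_usl2.rep_eq[symmetric]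
    by (simp add: prod_list_concat_map flip: to_U_proj)
qed

end

section \<open>The singular vectors\<close>

text \<open>Block indices are counted from 0 in the induction and from 1 in the products; the offset
  becomes the u + 1 of the ascending product and cancels the -1 of the descending one.\<close>

lemma upto_eq_map_upt: "[1..b] = map (\<lambda>k. int k + 1) [0..<nat b]"
  by (rule nth_equalityI) (simp_all add: nth_upto)

lemma J_prod_up_eq:
  "J_prod_up b u = to_U (prod_list (map Jt (map (\<lambda>k. u + 1 + of_nat k) [0..<nat b])))"
  unfolding J_prod_up_def upto_eq_map_upt
  by (simp add: comp_def J_eq_to_U add_ac flip: list_prod_to_U)

lemma J_prod_down_eq:
  "J_prod_down b u = to_U (prod_list (map Jt (map (\<lambda>k. u - of_nat k) [0..<nat b])))"
  unfolding J_prod_down_def upto_eq_map_upt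
  by (simp add: comp_def J_eq_to_U flip: list_prod_to_U)

lemma sum_pos_Suc: "a \<le> Suc k \<Longrightarrow> sum_pos g a (int (Suc k)) = sum_pos g a (int k) + (-1) ^ k * g (Suc k)"
  by (simp add: sum_pos_def del: of_nat_Suc)

lemma sum_neg_Suc: "a \<le> Suc k \<Longrightarrow> sum_neg g a (int (Suc k)) = sum_neg g a (int k) + (-1) ^ Suc k * g (Suc k)"
  by (simp add: sum_neg_def del: of_nat_Suc)

lemma sum_pos_single: "sum_pos g k (int k) = (-1) ^ (k - 1) * g k"
  by (simp add: sum_pos_def)

lemma sum_neg_single: "sum_neg g k (int k) = (-1) ^ k * g k"
  by (simp add: sum_neg_def)

text \<open>The blocks with w = 1 start their m-sum one place later than the general pattern; the
  missing term is Gamma_1^0 = 0 or Gamma_2^1 = 0.\<close>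

lemma sum_neg_first_zero:
  assumes "g a = 0"
  shows "sum_neg g a s = sum_neg g (Suc a) s"
proof (cases "a \<le> nat s")
  case True
  then have "{a..nat s} = insert a {Suc a..nat s}" by auto
  then show ?thesis using assms by (simp add: sum_neg_def)
qed (simp add: sum_neg_def)

text \<open>The generator that conjugates V_k into V_(k+1); for the tilde words it is
  \<open>nd (Suc k)\<close>.\<close>

definition nd :: "nat \<Rightarrow> node" where
  "nd k = (if even k then N1 else N2)"

lemma nd_Suc: "nd (Suc k) = other (nd k)"
  by (simp add: nd_def)

lemma conj_shift_nd: "conj_shift (nd k) a = (-1) ^ k * a"
  by (simp add: nd_def)

section \<open>Uniform formulas for exponents, block lengths and indices\<close>

context
  fixes p q m :: nat and \<alpha> :: complex
begin

text \<open>Both the power of the generator left in the image of V_k and the length of block k,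
  since each remaining factor is absorbed into one J.\<close>

definition word_mult :: "nat \<Rightarrow> nat" where
  "word_mult k = nat ((\<Gamma>\<^sub>1 p q k - \<Gamma>\<^sub>1 p q (k - 1)) * int m)"

definition word_mult_tilde :: "nat \<Rightarrow> nat" where
  "word_mult_tilde k = nat ((\<Gamma>\<^sub>2 p q (k + 1) - \<Gamma>\<^sub>2 p q k) * int m)"

definition base :: "int \<Rightarrow> int \<Rightarrow> nat \<Rightarrow> complex" where
  "base r s w = of_int (sum_pos (\<Gamma>\<^sub>2 p q) (w + 1) r) * \<alpha> + of_int (sum_neg (\<Gamma>\<^sub>1 p q) (w - 1) s) * of_nat m"

definition base_tilde :: "int \<Rightarrow> int \<Rightarrow> nat \<Rightarrow> complex" where
  "base_tilde r s w = of_int (sum_pos (\<Gamma>\<^sub>1 p q) w r) * \<alpha> + of_int (sum_neg (\<Gamma>\<^sub>2 p q) w s) * of_nat m"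

definition indices :: "int \<Rightarrow> int \<Rightarrow> nat \<Rightarrow> complex list" where
  "indices r s w = map (\<lambda>j. if even w then base r s w - of_nat j else base r s w + 1 + of_nat j)
    [0..<word_mult w]"

definition indices_tilde :: "int \<Rightarrow> int \<Rightarrow> nat \<Rightarrow> complex list" where
  "indices_tilde r s w = map (\<lambda>j. if odd w then base_tilde r s w - of_nat j
      else base_tilde r s w + 1 + of_nat j) [0..<word_mult_tilde w]"

text \<open>The block lengths mix the two Gammas; Gamma_2^(2j+2) = Gamma_1^(2j+1) rewrites them as
  differences of consecutive values of Gamma_1.\<close>

lemma Jcal_eq:
  assumes "1 \<le> w"
  shows "Jcal p q m \<alpha> r s w = to_U (prod_list (map Jt (indices r s w)))"
proof (cases "even w")
  case True
  then obtain j where j: "w = 2 * Suc j" using assms by (metis evenE gr0_implies_Suc mult_is_0 not_one_le_zero not_gr_zero)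
  have "\<Gamma>\<^sub>2 p q w = \<Gamma>\<^sub>1 p q (w - 1)" using \<Gamma>\<^sub>2_Suc_odd[of p q j] by (simp add: j)
  then show ?thesis
    by (simp add: Jcal_def Let_def j J_prod_down_eq indices_def base_def word_mult_def)
next
  case False
  then obtain j where j: "w = 2 * j + 1" by (rule oddE)
  have G: "\<Gamma>\<^sub>2 p q (2 * j + 2) = \<Gamma>\<^sub>1 p q (2 * j + 1)" by (rule \<Gamma>\<^sub>2_Suc_odd)
  show ?thesis
  proof (cases "j = 0")
    case True
    have "sum_neg (\<Gamma>\<^sub>1 p q) 0 s = sum_neg (\<Gamma>\<^sub>1 p q) 1 s"
      using sum_neg_first_zero[of "\<Gamma>\<^sub>1 p q" 0 s] \<Gamma>_initial(1) by simp
    then show ?thesis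
      using \<Gamma>_initial[of p q]
      by (simp add: Jcal_def Let_def j True J_prod_up_eq indices_def base_def word_mult_def numeral_2_eq_2)
  next
    case False
    then show ?thesis
      using G by (simp add: Jcal_def Let_def j J_prod_up_eq indices_def base_def word_mult_def)
  qed
qed

lemma Jcal_tilde_eq:
  assumes "1 \<le> w"
  shows "Jcal_tilde p q m \<alpha> r s w = to_U (prod_list (map Jt (indices_tilde r s w)))"
proof (cases "even w")
  case True
  then obtain j where j: "w = 2 * Suc j" using assms by (metis evenE gr0_implies_Suc mult_is_0 not_one_le_zero not_gr_zero)
  show ?thesis
    by (simp add: Jcal_tilde_def Let_def j J_prod_up_eq indices_tilde_def base_tilde_def word_mult_tilde_def)
next
  case False
  then obtain j where j: "w = 2 * j + 1" by (rule oddE)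
  show ?thesis
  proof (cases "j = 0")
    case True
    have "sum_neg (\<Gamma>\<^sub>2 p q) 1 s = sum_neg (\<Gamma>\<^sub>2 p q) 2 s"
      using sum_neg_first_zero[of "\<Gamma>\<^sub>2 p q" 1 s] \<Gamma>_initial(3) by (simp add: numeral_2_eq_2)
    then show ?thesis
      by (simp add: Jcal_tilde_def Let_def j True J_prod_down_eq indices_tilde_def base_tilde_def
          word_mult_tilde_def numeral_2_eq_2)
  next
    case False
    then show ?thesis
      by (simp add: Jcal_tilde_def Let_def j J_prod_down_eq indices_tilde_def base_tilde_def word_mult_tilde_def)
  qed
qed

text \<open>The left exponent in the step from V_k to V_(k+1), with the two parity cases merged by
  the coincidence of the Gamma sequences.\<close>

definition exponent :: "nat \<Rightarrow> complex" where
  "exponent k = of_int (\<Gamma>\<^sub>2 p q (k + 1)) * \<alpha> - of_int (\<Gamma>\<^sub>1 p q (k - 1)) * of_nat m"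

definition exponent_tilde :: "nat \<Rightarrow> complex" where
  "exponent_tilde k = of_int (\<Gamma>\<^sub>1 p q k) * \<alpha> - of_int (\<Gamma>\<^sub>2 p q k) * of_nat m"

text \<open>At the creation of a block each alternating sum has a single term, and together they
  give (-1)^k times the exponent: a - j for f_1 (even k) and 1 - a + j for f_2 (odd k).\<close>

lemma indices_new:
  assumes "1 \<le> k"
  shows "indices (int (Suc k)) (int (Suc k) - 2) k = map (new_index (nd k) (exponent k)) [0..<word_mult k]"
proof -
  have "int (Suc k) - 2 = int (k - 1)" using assms by simp
  then have "base (int (Suc k)) (int (Suc k) - 2) k = (-1) ^ k * exponent k"
    using assms sum_pos_single[of "\<Gamma>\<^sub>2 p q" "Suc k"] sum_neg_single[of "\<Gamma>\<^sub>1 p q" "k - 1"]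
    by (cases k) (simp_all add: base_def exponent_def algebra_simps)
  then show ?thesis by (simp add: indices_def nd_def)
qed

text \<open>One more step appends one term to each alternating sum, and these two terms add up to
  (-1)^k times the exponent of step k.\<close>

lemma indices_shift:
  assumes "1 \<le> w" "w < k"
  shows "indices (int (Suc k)) (int (Suc k) - 2) w
    = map (\<lambda>u. u + conj_shift (nd k) (exponent k)) (indices (int k) (int k - 2) w)"
proof -
  \<comment> \<open>This keeps the upper limit k - 2 nonnegative, so that \<open>nat\<close> in
    \<open>sum_neg\<close> does not truncate it and exactly one term is added.\<close>
  have "2 \<le> k" using assms by simp
  then obtain l where l: "k = Suc (Suc l)" by (metis add_2_eq_Suc le_Suc_ex)
  have pos: "sum_pos (\<Gamma>\<^sub>2 p q) (w + 1) (int (Suc k))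
      = sum_pos (\<Gamma>\<^sub>2 p q) (w + 1) (int k) + (-1) ^ k * \<Gamma>\<^sub>2 p q (k + 1)"
    using sum_pos_Suc[of "w + 1" k "\<Gamma>\<^sub>2 p q"] assms by simp
  have e: "int (Suc k) - 2 = int (Suc l)" "int k - 2 = int l" "k - 1 = Suc l" by (simp_all add: l)
  have neg: "sum_neg (\<Gamma>\<^sub>1 p q) (w - 1) (int (Suc k) - 2)
      = sum_neg (\<Gamma>\<^sub>1 p q) (w - 1) (int k - 2) + (-1) ^ Suc k * \<Gamma>\<^sub>1 p q (k - 1)"
    unfolding e using sum_neg_Suc[of "w - 1" l "\<Gamma>\<^sub>1 p q"] assms by (simp add: l)
  have "base (int (Suc k)) (int (Suc k) - 2) w
      = base (int k) (int k - 2) w + conj_shift (nd k) (exponent k)"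
    unfolding base_def pos neg by (simp add: exponent_def conj_shift_nd algebra_simps)
  then show ?thesis by (simp add: indices_def algebra_simps)
qed

lemma indices_tilde_new:
  assumes "1 \<le> k"
  shows "indices_tilde (int (Suc k) - 1) (int (Suc k) - 1) k
    = map (new_index (nd (Suc k)) (exponent_tilde k)) [0..<word_mult_tilde k]"
proof -
  have "(-1) ^ (k - 1) = ((-1) ^ Suc k :: int)" using assms by (cases k) simp_all
  then have "base_tilde (int k) (int k) k = (-1) ^ Suc k * exponent_tilde k"
    by (simp add: base_tilde_def exponent_tilde_def sum_pos_single sum_neg_single algebra_simps)
  then show ?thesis by (simp add: indices_tilde_def nd_def)
qed

lemma indices_tilde_shift:
  assumes "1 \<le> w" "w < k"
  shows "indices_tilde (int (Suc k) - 1) (int (Suc k) - 1) w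
    = map (\<lambda>u. u + conj_shift (nd (Suc k)) (exponent_tilde k)) (indices_tilde (int k - 1) (int k - 1) w)"
proof -
  obtain l where l: "k = Suc l" using assms by (cases k) auto
  have e: "int (Suc k) - 1 = int (Suc l)" "int k - 1 = int l" by (simp_all add: l)
  have pos: "sum_pos (\<Gamma>\<^sub>1 p q) w (int (Suc l))
      = sum_pos (\<Gamma>\<^sub>1 p q) w (int l) + (-1) ^ Suc k * \<Gamma>\<^sub>1 p q k"
    using sum_pos_Suc[of w l "\<Gamma>\<^sub>1 p q"] assms by (simp add: l)
  have neg: "sum_neg (\<Gamma>\<^sub>2 p q) w (int (Suc l))
      = sum_neg (\<Gamma>\<^sub>2 p q) w (int l) + (-1) ^ k * \<Gamma>\<^sub>2 p q k"
    using sum_neg_Suc[of w l "\<Gamma>\<^sub>2 p q"] assms by (simp add: l)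
  have "base_tilde (int (Suc l)) (int (Suc l)) w
      = base_tilde (int l) (int l) w + conj_shift (nd (Suc k)) (exponent_tilde k)"
    unfolding base_tilde_def pos neg by (simp add: exponent_tilde_def conj_shift_nd algebra_simps)
  then show ?thesis unfolding e by (simp add: indices_tilde_def algebra_simps)
qed

lemma word_mult_sum:
  assumes "2 \<le> p" "2 \<le> q" "1 \<le> k"
  shows "int (word_mult k + word_mult (Suc k)) = (\<Gamma>\<^sub>1 p q (k + 1) - \<Gamma>\<^sub>1 p q (k - 1)) * int m"
proof -
  have "0 \<le> (\<Gamma>\<^sub>1 p q k - \<Gamma>\<^sub>1 p q (k - 1)) * int m" "0 \<le> (\<Gamma>\<^sub>1 p q (Suc k) - \<Gamma>\<^sub>1 p q k) * int m"
    using \<Gamma>_mono(1)[OF assms(1,2), of k] \<Gamma>_mono(1)[OF assms(1,2), of "k - 1"] assms(3) by simp_all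
  then have "int (word_mult k + word_mult (Suc k))
      = (\<Gamma>\<^sub>1 p q k - \<Gamma>\<^sub>1 p q (k - 1)) * int m + (\<Gamma>\<^sub>1 p q (Suc k) - \<Gamma>\<^sub>1 p q k) * int m"
    by (simp only: word_mult_def of_nat_add diff_Suc_1 nat_0_le)
  then show ?thesis by (simp add: algebra_simps)
qed

lemma word_mult_tilde_sum:
  assumes "2 \<le> p" "2 \<le> q"
  shows "int (word_mult_tilde k + word_mult_tilde (Suc k)) = (\<Gamma>\<^sub>2 p q (k + 2) - \<Gamma>\<^sub>2 p q k) * int m"
proof -
  have "0 \<le> (\<Gamma>\<^sub>2 p q (k + 1) - \<Gamma>\<^sub>2 p q k) * int m"
    "0 \<le> (\<Gamma>\<^sub>2 p q (Suc k + 1) - \<Gamma>\<^sub>2 p q (Suc k)) * int m"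
    using \<Gamma>_mono(2)[OF assms, of k] \<Gamma>_mono(2)[OF assms, of "Suc k"] by simp_all
  then have "int (word_mult_tilde k + word_mult_tilde (Suc k))
      = (\<Gamma>\<^sub>2 p q (k + 1) - \<Gamma>\<^sub>2 p q k) * int m + (\<Gamma>\<^sub>2 p q (Suc k + 1) - \<Gamma>\<^sub>2 p q (Suc k)) * int m"
    by (simp only: word_mult_tilde_def of_nat_add nat_0_le)
  then show ?thesis by (simp add: algebra_simps)
qed

lemma \<Gamma>_even_odd: "1 \<le> l \<Longrightarrow> \<Gamma>\<^sub>2 p q (2 * l) = \<Gamma>\<^sub>1 p q (2 * l - 1)"
  using \<Gamma>\<^sub>2_Suc_odd[of p q "l - 1"] by (cases l) simp_all

text \<open>The two alternating clauses of the recursion become one statement in k after replacing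
  odd-indexed Gamma_1 by even-indexed Gamma_2 or conversely.\<close>

lemma singular_words_step:
  assumes V: "singular_words p q m \<alpha> V" and k: "1 \<le> k"
  shows "is_complex_power (U_N p q) (f_N p q (nd k)) (exponent k) (V k)
    (- of_int (\<Gamma>\<^sub>2 p q (k + 1)) * \<alpha> + of_int (\<Gamma>\<^sub>1 p q (k + 1)) * of_nat m) (V (Suc k))"
proof (cases "even k")
  case True
  then obtain l where l: "k = 2 * l" by blast
  with k have l1: "1 \<le> l" by simp
  have G: "of_int (\<Gamma>\<^sub>1 p q (2 * l - 1)) = of_int (\<Gamma>\<^sub>2 p q (2 * l))"
    "of_int (\<Gamma>\<^sub>1 p q (2 * l + 1)) = of_int (\<Gamma>\<^sub>2 p q (2 * l + 2))"
    using \<Gamma>_even_odd[OF l1] \<Gamma>_even_odd[of "l + 1"] by simp_all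
  have "nd (2 * l) = N1" "Suc (2 * l) = 2 * l + 1" by (simp_all add: nd_def)
  then show ?thesis
    using V l1 unfolding singular_words_def l exponent_def G by metis
next
  case False
  then obtain j where "k = 2 * j + 1" by (rule oddE)
  then obtain l where l: "k = 2 * l - 1" "1 \<le> l" by (intro that[of "Suc j"]) simp_all
  then have e: "nd k = N2" "k - 1 = 2 * l - 2" "k + 1 = 2 * l" "Suc k = 2 * l"
    by (auto simp: nd_def)
  show ?thesis
    using V l(2) unfolding singular_words_def e exponent_def \<Gamma>_even_odd[OF l(2)] unfolding l(1) by metis
qed

lemma singular_words_tilde_step:
  assumes V: "singular_words_tilde p q m \<alpha> V" and k: "1 \<le> k"
  shows "is_complex_power (U_N p q) (f_N p q (nd (Suc k))) (exponent_tilde k) (V k)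
    (- of_int (\<Gamma>\<^sub>1 p q k) * \<alpha> + of_int (\<Gamma>\<^sub>2 p q (k + 2)) * of_nat m) (V (Suc k))"
proof (cases "even k")
  case True
  then obtain l where l: "k = 2 * l" by blast
  with k have l1: "1 \<le> l" by simp
  have G: "of_int (\<Gamma>\<^sub>2 p q (2 * l)) = of_int (\<Gamma>\<^sub>1 p q (2 * l - 1))"
    "of_int (\<Gamma>\<^sub>2 p q (2 * l + 2)) = of_int (\<Gamma>\<^sub>1 p q (2 * l + 1))"
    using \<Gamma>_even_odd[OF l1] \<Gamma>_even_odd[of "l + 1"] by simp_all
  have e: "nd (Suc (2 * l)) = N2" "Suc (2 * l) = 2 * l + 1" by (simp_all add: nd_def)
  then show ?thesis
    using V l1 unfolding singular_words_tilde_def l exponent_tilde_def G by metis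
next
  case False
  then obtain j where "k = 2 * j + 1" by (rule oddE)
  then obtain l where l: "k = 2 * l - 1" "1 \<le> l" by (intro that[of "Suc j"]) simp_all
  then have e: "Suc k = 2 * l" "nd (2 * l) = N1" "k + 2 = 2 * l + 1"
    by (auto simp: nd_def)
  show ?thesis
    using V l(2)
    unfolding singular_words_tilde_def e exponent_tilde_def
    unfolding l(1) \<Gamma>_even_odd[OF l(2), symmetric] by metis
qed

lemma projection_singular_words:
  assumes pq: "2 \<le> p" "2 \<le> q" and \<phi>: "is_projection p q \<phi>"
    and V: "singular_words p q m \<alpha> V" and k: "1 \<le> k"
  shows "\<phi> (V k) = list_prod U_sl2 (map (Jcal p q m \<alpha> (int k) (int k - 2)) [1..<k])
    \<otimes>\<^bsub>U_sl2\<^esub> f_S (other (nd k)) [^]\<^bsub>U_sl2\<^esub> nat ((\<Gamma>\<^sub>1 p q k - \<Gamma>\<^sub>1 p q (k - 1)) * int m)"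
proof -
  interpret usl2_projection p q \<phi> by standard (rule \<phi>)
  let ?b = "\<lambda>k. - of_int (\<Gamma>\<^sub>2 p q (k + 1)) * \<alpha> + of_int (\<Gamma>\<^sub>1 p q (k + 1)) * of_nat m"
  let ?idx = "\<lambda>k. indices (int k) (int k - 2)"
  have "\<phi> (V k) = list_prod U_sl2 (map (\<lambda>w. to_U (prod_list (map Jt (?idx k w)))) [1..<k])
      \<otimes>\<^bsub>U_sl2\<^esub> f_S (other (nd k)) [^]\<^bsub>U_sl2\<^esub> word_mult k"
  proof (rule proj_words[where a = exponent and b = ?b and idx = ?idx, OF _ nd_Suc
        singular_words_step[OF V] _ indices_new indices_shift k])
    have "word_mult 1 = m" using \<Gamma>_initial[of p q] by (simp add: word_mult_def)
    then show "V 1 = f_N p q (other (nd 1)) [^]\<^bsub>UNpq\<^esub> word_mult 1"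
      using V by (simp add: singular_words_def nd_def)
    fix j :: nat assume j: "1 \<le> j"
    \<comment> \<open>In the sum of the two exponents \<alpha> cancels; what remains telescopes into
      the powers before and after the step.\<close>
    have "of_nat (word_mult j + word_mult (Suc j))
        = (of_int ((\<Gamma>\<^sub>1 p q (j + 1) - \<Gamma>\<^sub>1 p q (j - 1)) * int m) :: complex)"
      unfolding word_mult_sum[OF pq j, symmetric] by simp
    then show "exponent j + ?b j = of_nat (word_mult j + word_mult (Suc j))"
      by (simp add: exponent_def algebra_simps)
  qed
  moreover have "map (\<lambda>w. to_U (prod_list (map Jt (?idx k w)))) [1..<k]
      = map (Jcal p q m \<alpha> (int k) (int k - 2)) [1..<k]"
    by (intro map_cong) (simp_all add: Jcal_eq)
  ultimately show ?thesis by (simp only: word_mult_def)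
qed

lemma projection_singular_words_tilde:
  assumes pq: "2 \<le> p" "2 \<le> q" and \<phi>: "is_projection p q \<phi>"
    and V: "singular_words_tilde p q m \<alpha> V" and k: "1 \<le> k"
  shows "\<phi> (V k) = list_prod U_sl2 (map (Jcal_tilde p q m \<alpha> (int k - 1) (int k - 1)) [1..<k])
    \<otimes>\<^bsub>U_sl2\<^esub> f_S (nd k) [^]\<^bsub>U_sl2\<^esub> nat ((\<Gamma>\<^sub>2 p q (k + 1) - \<Gamma>\<^sub>2 p q k) * int m)"
proof -
  interpret usl2_projection p q \<phi> by standard (rule \<phi>)
  let ?b = "\<lambda>k. - of_int (\<Gamma>\<^sub>1 p q k) * \<alpha> + of_int (\<Gamma>\<^sub>2 p q (k + 2)) * of_nat m"
  let ?idx = "\<lambda>k. indices_tilde (int k - 1) (int k - 1)"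
  have "\<phi> (V k) = list_prod U_sl2 (map (\<lambda>w. to_U (prod_list (map Jt (?idx k w)))) [1..<k])
      \<otimes>\<^bsub>U_sl2\<^esub> f_S (other (nd (Suc k))) [^]\<^bsub>U_sl2\<^esub> word_mult_tilde k"
  \<comment> \<open>The tilde words start from f_2 and are first conjugated by f_1, so the
    alternation of generators is offset by one.\<close>
  proof (rule proj_words[where nd = "\<lambda>k. nd (Suc k)" and a = exponent_tilde and b = ?b and idx = ?idx,
        OF _ nd_Suc singular_words_tilde_step[OF V] _ indices_tilde_new indices_tilde_shift k])
    have "word_mult_tilde 1 = m"
      using \<Gamma>_initial[of p q] by (simp add: word_mult_tilde_def numeral_2_eq_2)
    then show "V 1 = f_N p q (other (nd (Suc 1))) [^]\<^bsub>UNpq\<^esub> word_mult_tilde 1"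
      using V by (simp add: singular_words_tilde_def nd_def)
    fix j :: nat assume j: "1 \<le> j"
    have "of_nat (word_mult_tilde j + word_mult_tilde (Suc j))
        = (of_int ((\<Gamma>\<^sub>2 p q (j + 2) - \<Gamma>\<^sub>2 p q j) * int m) :: complex)"
      unfolding word_mult_tilde_sum[OF pq, symmetric] by simp
    then show "exponent_tilde j + ?b j = of_nat (word_mult_tilde j + word_mult_tilde (Suc j))"
      by (simp add: exponent_tilde_def algebra_simps)
  qed
  moreover have "map (\<lambda>w. to_U (prod_list (map Jt (?idx k w)))) [1..<k]
      = map (Jcal_tilde p q m \<alpha> (int k - 1) (int k - 1)) [1..<k]"
    by (intro map_cong) (simp_all add: Jcal_tilde_eq)
  ultimately show ?thesis by (simp only: word_mult_tilde_def nd_Suc other_other)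
qed

end

theorem mainTheorem2:
  fixes p q m n :: nat and \<alpha> :: complex
    and \<pi>' :: "u_minus \<Rightarrow> u_sl2"
    and V V' :: "nat \<Rightarrow> u_minus"
  assumes "p \<ge> 2" and "q \<ge> 2" and "m \<ge> 1" and "n \<ge> 1"
    and "is_projection p q \<pi>'"
    and "singular_words p q m \<alpha> V"
    and "singular_words_tilde p q m \<alpha> V'"
  shows "(\<pi>' (V (2*n - 1)) =
           list_prod U_sl2 (map (Jcal p q m \<alpha> (2 * int n - 1) (2 * int n - 3)) [1..<2*n - 1])
           \<otimes>\<^bsub>U_sl2\<^esub> f_S N1 [^]\<^bsub>U_sl2\<^esub> nat ((\<Gamma>\<^sub>1 p q (2*n - 1) - \<Gamma>\<^sub>1 p q (2*n - 2)) * int m)) \<and>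
         (\<pi>' (V (2*n)) =
           list_prod U_sl2 (map (Jcal p q m \<alpha> (2 * int n) (2 * int n - 2)) [1..<2*n])
           \<otimes>\<^bsub>U_sl2\<^esub> f_S N2 [^]\<^bsub>U_sl2\<^esub> nat ((\<Gamma>\<^sub>1 p q (2*n) - \<Gamma>\<^sub>1 p q (2*n - 1)) * int m)) \<and>
         (\<pi>' (V' (2*n - 1)) =
           list_prod U_sl2 (map (Jcal_tilde p q m \<alpha> (2 * int n - 2) (2 * int n - 2)) [1..<2*n - 1])
           \<otimes>\<^bsub>U_sl2\<^esub> f_S N2 [^]\<^bsub>U_sl2\<^esub> nat ((\<Gamma>\<^sub>2 p q (2*n) - \<Gamma>\<^sub>2 p q (2*n - 1)) * int m)) \<and>
         (\<pi>' (V' (2*n)) =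
           list_prod U_sl2 (map (Jcal_tilde p q m \<alpha> (2 * int n - 1) (2 * int n - 1)) [1..<2*n])
           \<otimes>\<^bsub>U_sl2\<^esub> f_S N1 [^]\<^bsub>U_sl2\<^esub> nat ((\<Gamma>\<^sub>2 p q (2*n + 1) - \<Gamma>\<^sub>2 p q (2*n)) * int m))"
proof -
  \<comment> \<open>The surviving power belongs to \<open>other (nd k)\<close> for V_k and to
    \<open>nd k\<close> for the tilde words, which yields the generators in the four
    formulas.\<close>
  have odd: "1 \<le> 2 * n - 1" "nd (2 * n - 1) = N2" and even: "1 \<le> 2 * n" "nd (2 * n) = N1"
    using assms(4) by (auto simp: nd_def)
  have n: "int (2 * n - 1) = 2 * int n - 1" "2 * n - 1 - 1 = 2 * n - 2" "2 * n - 1 + 1 = 2 * n"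
      "int (2 * n) = 2 * int n" "2 * int n - 1 - 2 = 2 * int n - 3" "2 * int n - 1 - 1 = 2 * int n - 2"
    using assms(4) by simp_all
  note W = projection_singular_words[OF assms(1,2,5,6)]
  note W' = projection_singular_words_tilde[OF assms(1,2,5,7)]
  show ?thesis
    using W[OF odd(1), unfolded odd(2) n other.simps] W[OF even(1), unfolded even(2) n other.simps]
      W'[OF odd(1), unfolded odd(2) n] W'[OF even(1), unfolded even(2) n]
    by (intro conjI)
qed

end
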